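(* Let $G$ be a finite simple graph with $\ell$ vertices and let $q$ be a prime power. Each of the conditions (5), (6) below is equivalent to each of the conditions (1)–(4) (so all six conditions are equivalent): (1) $G$ has a perfect elimination ordering. (2) The graphical arrangement $\mathcal{A}_G$ is supersolvable. (3) The graphical arrangement $\mathcal{A}_G$ is free. (4) $G$ is chordal. (5) $\mathcal{A}_G^q$ is supersolvable. (6) $\mathcal{A}_G^q$ is free. Moreover, when $(v_1,\dots,v_\ell)$ is a perfect elimination ordering of $G$, $$\chi(\mathcal{A}_G^q,t)=\prod_{i=1}^{\ell}\left(t-q^{|N_{G_i}(v_i)|}\right),$$ where $G_i=G[\{v_1,\dots,v_i\}]$ is the subgraph of $G$ induced by $\{v_1,\dots,v_i\}$ and $N_{G_i}(v_i)$ is the set of vertices adjacent to $v_i$ in $G_i$.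
   Context: $\mathbb{F}_q$ is the field with $q$ elements. A central arrangement $\mathcal{A}$ is a finite collection of linear hyperplanes in a finite dimensional vector space $V$ over a field $\mathbb{K}$. Its intersection lattice is $L(\mathcal{A})=\{\bigcap_{H\in\mathcal{B}}H \mid \mathcal{B}\subseteq\mathcal{A}\}$ (the empty intersection being $V$), ordered by reverse inclusion, and its characteristic polynomial is $\chi(\mathcal{A},t)=\sum_{X\in L(\mathcal{A})}\mu(X)t^{\dim X}$, where $\mu(X)=\mu(V,X)$ is the Möbius function of $L(\mathcal{A})$. The rank of $\mathcal{A}$ is the codimension of $\bigcap_{H\in\mathcal{A}}H$. Identify the vertex set of $G$ with $[\ell]=\{1,\dots,\ell\}$. The graphical arrangement $\mathcal{A}_G$ in $\mathbb{R}^\ell$ is $\{\{x_i-x_j=0\}\mid \{i,j\}\in E_G\}$. The $q$-deformation of the graphical arrangement is the arrangement in $\mathbb{F}_q^\ell$ $$\mathcal{A}_G^q=\bigcup_{\{i_1,\dots,i_r\}}\Big\{\{a_{i_1}x_{i_1}+\dots+a_{i_r}x_{i_r}=0\}\ \Big|\ (a_{i_1},\dots,a_{i_r})\in\mathbb{F}_q^r\setminus\{0\}\Big\},$$ where $\{i_1,\dots,i_r\}$ runs over all nonempty cliques of $G$ (sets of pairwise adjacent vertices, including single vertices). An arrangement $\mathcal{A}$ of rank $r$ is supersolvable if there is a filtration $\varnothing=\mathcal{A}_0\subseteq\mathcal{A}_1\subseteq\dots\subseteq\mathcal{A}_r=\mathcal{A}$ such that, for each $i\in\{1,\dots,r\}$,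 $\operatorname{rank}\mathcal{A}_i=i$ and for any distinct hyperplanes $H,H'\in\mathcal{A}_i\setminus\mathcal{A}_{i-1}$ there exists $H''\in\mathcal{A}_{i-1}$ with $H\cap H'\subseteq H''$. For an arrangement $\mathcal{A}=\{H_1,\dots,H_n\}$ in $\mathbb{K}^\ell$ with $H_i=\alpha_i^{-1}(0)$ for linear forms $\alpha_i$, let $S=\mathbb{K}[x_1,\dots,x_\ell]$, $\partial_i=\partial/\partial x_i$, and $D(\mathcal{A})=\{\theta=\sum_{i=1}^\ell f_i\partial_i \mid f_i\in S,\ \theta\alpha_j\in(\alpha_j)\text{ for } 1\le j\le n\}$. The arrangement $\mathcal{A}$ is free if $D(\mathcal{A})$ is a free $S$-module. A vertex $v$ of a simple graph is simplicial if its set of neighbours is a clique. An ordering $(v_1,\dots,v_\ell)$ of the vertices of $G$ is a perfect elimination ordering if $v_i$ is simplicial in the subgraph induced by $\{v_1,\dots,v_i\}$ for each $i\in[\ell]$. A graph is chordal if it has no induced cycle of length at least $4$. *)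

theory Defs
  imports
    "HOL-Analysis.Analysis"
    "HOL-Computational_Algebra.Polynomial"
    "HOL-Library.Poly_Mapping"
    "HOL-Number_Theory.Prime_Powers"
begin

section \<open>Graphs\<close>

text \<open>
  A simple graph has all elements of a finite type \<open>'n\<close> as its vertices
  (so \<open>CARD('n)\<close> is the number of vertices), and is given by its set of edges.
\<close>

definition simple_graph :: "'n set set \<Rightarrow> bool" where
  "simple_graph E \<longleftrightarrow> (\<forall>e\<in>E. card e = 2)"

definition induced :: "'n set set \<Rightarrow> 'n set \<Rightarrow> 'n set set" where
  "induced E W = {e \<in> E. e \<subseteq> W}"

definition nbrs :: "'n set set \<Rightarrow> 'n \<Rightarrow> 'n set" where
  "nbrs E v = {u. {u, v} \<in> E}"

definition clique :: "'n set set \<Rightarrow> 'n set \<Rightarrow> bool" where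
  "clique E C \<longleftrightarrow> (\<forall>u\<in>C. \<forall>v\<in>C. u \<noteq> v \<longrightarrow> {u, v} \<in> E)"

definition simplicial :: "'n set set \<Rightarrow> 'n \<Rightarrow> bool" where
  "simplicial E v \<longleftrightarrow> clique E (nbrs E v)"

text \<open>
  An ordering of the vertices is a list, indexed from \<open>0\<close>; \<open>initial_graph E vs i\<close> is
  the subgraph induced by \<open>vs ! 0, \<dots>, vs ! i\<close>, that is, by the first \<open>i + 1\<close> vertices.
\<close>

definition initial_graph :: "'n set set \<Rightarrow> 'n list \<Rightarrow> nat \<Rightarrow> 'n set set" where
  "initial_graph E vs i = induced E (set (take (Suc i) vs))"

definition perfect_elimination_ordering :: "'n set set \<Rightarrow> 'n list \<Rightarrow> bool" where
  "perfect_elimination_ordering E vs \<longleftrightarrow>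
     distinct vs \<and> set vs = UNIV \<and>
     (\<forall>i<length vs. simplicial (initial_graph E vs i) (vs ! i))"

definition cycle_edges :: "'n list \<Rightarrow> 'n set set" where
  "cycle_edges cs = {{cs ! i, cs ! (Suc i mod length cs)} | i. i < length cs}"

definition chordal :: "'n set set \<Rightarrow> bool" where
  "chordal E \<longleftrightarrow>
     \<not> (\<exists>cs. distinct cs \<and> length cs \<ge> 4 \<and> induced E (set cs) = cycle_edges cs)"


section \<open>Central arrangements and their characteristic polynomials\<close>

text \<open>A central arrangement in \<open>'k ^ 'n\<close> is a finite set of linear hyperplanes, each of
  which is a set of vectors.\<close>

type_synonym ('k, 'n) arrangement = "('k ^ 'n) set set"

definition intersection_lattice :: "('k, 'n) arrangement \<Rightarrow> ('k ^ 'n) set set" where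
  "intersection_lattice A = {\<Inter>B | B. B \<subseteq> A}"

text \<open>
  The Moebius function \<open>\<mu>(V, X)\<close> of a finite set \<open>L\<close> of sets ordered by reverse inclusion:
  \<open>\<mu>(V, V) = 1\<close>, and \<open>\<mu>(V, X)\<close> is minus the sum of \<open>\<mu>(V, Y)\<close> over all \<open>Y \<in> L\<close> with
  \<open>V \<supseteq> Y \<supset> X\<close>. The other branches only make the function total.
\<close>

function moebius :: "'a set set \<Rightarrow> 'a set \<Rightarrow> 'a set \<Rightarrow> int" where
  "moebius L V X =
     (if \<not> finite L then 0
      else if X = V then 1
      else if X \<subset> V then - (\<Sum>Y\<in>{Y \<in> L. X \<subset> Y \<and> Y \<subseteq> V}. moebius L V Y)
      else 0)"
  by auto
termination
proof (relation "Wellfounded.measure (\<lambda>(L, V, X). card {Y \<in> L. X \<subset> Y})")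
  fix L :: "'a set set" and V X Y :: "'a set"
  assume "\<not> infinite L" and Y: "Y \<in> {Y \<in> L. X \<subset> Y \<and> Y \<subseteq> V}"
  then have "finite {Z \<in> L. X \<subset> Z}" by simp
  moreover have "{Z \<in> L. Y \<subset> Z} \<subset> {Z \<in> L. X \<subset> Z}" using Y by blast
  ultimately have "card {Z \<in> L. Y \<subset> Z} < card {Z \<in> L. X \<subset> Z}"
    by (rule psubset_card_mono)
  then show "((L, V, Y), (L, V, X)) \<in> Wellfounded.measure (\<lambda>(L, V, X). card {Y \<in> L. X \<subset> Y})"
    by simp
qed simp

declare moebius.simps [simp del]

definition char_poly :: "('k::field, 'n::finite) arrangement \<Rightarrow> int poly" where
  "char_poly A =
     (\<Sum>X\<in>intersection_lattice A. monom (moebius (intersection_lattice A) UNIV X) (vec.dim X))"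

definition arr_rank :: "('k::field, 'n::finite) arrangement \<Rightarrow> nat" where
  "arr_rank A = CARD('n) - vec.dim (\<Inter>A)"


section \<open>Supersolvable and free arrangements\<close>

definition supersolvable :: "('k::field, 'n::finite) arrangement \<Rightarrow> bool" where
  "supersolvable A \<longleftrightarrow>
     (\<exists>F :: nat \<Rightarrow> ('k, 'n) arrangement.
        F 0 = {} \<and> F (arr_rank A) = A \<and>
        (\<forall>i\<in>{1..arr_rank A}.
           F (i - 1) \<subseteq> F i \<and> arr_rank (F i) = i \<and>
           (\<forall>H\<in>F i - F (i - 1). \<forall>H'\<in>F i - F (i - 1).
              H \<noteq> H' \<longrightarrow> (\<exists>H''\<in>F (i - 1). H \<inter> H' \<subseteq> H''))))"

text \<open>The polynomial ring \<open>S\<close> over \<open>'k\<close> with one variable for each element of \<open>'n\<close>: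
  finitely supported coefficient functions on exponent vectors, with the convolution product.\<close>

type_synonym ('k, 'n) mpoly = "('n \<Rightarrow>\<^sub>0 nat) \<Rightarrow>\<^sub>0 'k"

definition pdiff :: "'n \<Rightarrow> ('k::comm_ring_1, 'n) mpoly \<Rightarrow> ('k, 'n) mpoly" where
  "pdiff i p =
     (\<Sum>m\<in>Poly_Mapping.keys p. Poly_Mapping.single (m - Poly_Mapping.single i 1)
                    (of_nat (Poly_Mapping.lookup m i) * Poly_Mapping.lookup p m))"

definition linear_form :: "'k::comm_ring_1 ^ 'n::finite \<Rightarrow> ('k, 'n) mpoly" where
  "linear_form a = (\<Sum>i\<in>UNIV. Poly_Mapping.single (Poly_Mapping.single i 1) (a $ i))"

definition hyperplane :: "'k::field ^ 'n::finite \<Rightarrow> ('k ^ 'n) set" where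
  "hyperplane a = {x. (\<Sum>i\<in>UNIV. a $ i * x $ i) = 0}"

text \<open>A derivation \<open>\<theta> = \<Sum>\<^sub>i f\<^sub>i \<partial>\<^sub>i\<close> of \<open>S\<close> is represented by its coefficient vector
  \<open>f \<in> S ^ 'n\<close>, and \<open>apply_derivation f\<close> is \<open>\<theta>\<close> as an operator on \<open>S\<close>.\<close>

definition apply_derivation ::
    "('k::comm_ring_1, 'n::finite) mpoly ^ 'n \<Rightarrow> ('k, 'n) mpoly \<Rightarrow> ('k, 'n) mpoly" where
  "apply_derivation f p = (\<Sum>i\<in>UNIV. f $ i * pdiff i p)"

text \<open>The module \<open>D(A)\<close>. A form defining \<open>H\<close> is unique up to a nonzero scalar, which does
  not affect the ideal it generates, so quantifying over all defining forms of \<open>H\<close> is the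
  same as fixing one of them.\<close>

definition derivation_module ::
    "('k::field, 'n::finite) arrangement \<Rightarrow> (('k, 'n) mpoly ^ 'n) set" where
  "derivation_module A =
     {f. \<forall>H\<in>A. \<forall>a. a \<noteq> 0 \<and> H = hyperplane a \<longrightarrow>
            linear_form a dvd apply_derivation f (linear_form a)}"

text \<open>A submodule of \<open>R ^ 'n\<close> is free if it has a basis.\<close>

definition free_submodule :: "('r::comm_ring_1 ^ 'n) set \<Rightarrow> bool" where
  "free_submodule M \<longleftrightarrow>
     (\<exists>B. \<not> module.dependent (*s) B \<and> module.span (*s) B = M)"

definition free_arrangement :: "('k::field, 'n::finite) arrangement \<Rightarrow> bool" where
  "free_arrangement A \<longleftrightarrow> free_submodule (derivation_module A)"


section \<open>Graphical arrangements\<close>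

definition graphical_arrangement :: "'n::finite set set \<Rightarrow> (real, 'n) arrangement" where
  "graphical_arrangement E = {{x. x $ i - x $ j = 0} | i j. {i, j} \<in> E}"

text \<open>The field with \<open>q\<close> elements is a type \<open>'k\<close> with \<open>CARD('k) = q\<close>.\<close>

definition q_graphical_arrangement :: "'n::finite set set \<Rightarrow> ('k::{field, finite}, 'n) arrangement" where
  "q_graphical_arrangement E =
     {{x. (\<Sum>i\<in>C. a i * x $ i) = 0} | C a. C \<noteq> {} \<and> clique E C \<and> (\<exists>i\<in>C. a i \<noteq> 0)}"

end

(* Both arrangements are handled through chordality of G: each of supersolvability and freeness
   follows from a perfect elimination ordering and fails in the presence of an induced cycle of
   length k >= 4; chordal graphs have perfect elimination orderings by Dirac's theorem.

   Freeness is obtained by adding simplicial vertices one at a time. A derivation extends to the new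
   vertex v by x_v |-> tau(x_v), where tau interpolates the derivation on the neighbours of v: a
   Newton interpolation polynomial for A_G, a q-polynomial (hence an additive function) for A_G^q.

   Conversely, near an induced cycle both modules of derivations look alike: writing f_i = g_i for A_G
   and f_i = x_i g_i for A_G^q, with y_i = x_i^m and m = 1 or m = q - 1 respectively, the condition is
   that y_i - y_(i+1) divides g_i - g_(i+1). Locally at the cycle this module needs more generators
   than its rank: besides 1 and (y_i) there are k - 1 independent quadratic ones, supported at single
   vertices.

   The characteristic polynomial at q^s counts the s-tuples of vectors contained in no common
   hyperplane of the arrangement. *)
theory Submission
  imports Defs
begin

section \<open>The polynomial ring\<close>

text \<open>Nonfreeness is proved by a form of Nakayama's lemma in which a denominator replaces
  localization. Let p be the prime ideal generated by the cycle variables, and h the product of the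
  forms not supported on the cycle. Then h is not in p, and h times a solution of the conditions on
  the cycle satisfies all conditions. The number of such elements that stay independent modulo p
  bounds the size of a basis from below. What detects independence modulo p is a relation around the
  cycle: the quotients w_i of g_i - g_(i+1) by y_i - y_(i+1) all agree modulo the ideal of the y_j,
  so the leading coefficients of w_i - w_0 are well behaved modulo p.

  For supersolvability, consider the highest level of the filtration that contains hyperplanes
  supported on the cycle. Two of these would have to combine to a form with nonadjacent vertices in
  its support, and the arrangement has no such form.\<close>

abbreviation (input) lookup where "lookup \<equiv> Poly_Mapping.lookup"

definition mvar :: "'n \<Rightarrow> ('k::comm_ring_1, 'n) mpoly" where
  "mvar i = Poly_Mapping.single (Poly_Mapping.single i 1) 1"

definition mconst :: "'k::comm_ring_1 \<Rightarrow> ('k, 'n) mpoly" where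
  "mconst c = Poly_Mapping.single 0 c"

lemma poly_mapping_sum_single:
  assumes "finite A" "Poly_Mapping.keys p \<subseteq> A"
  shows "p = (\<Sum>m\<in>A. Poly_Mapping.single m (lookup p m))"
proof (rule poly_mapping_eqI)
  fix k
  have "lookup (\<Sum>m\<in>A. Poly_Mapping.single m (lookup p m)) k
      = (\<Sum>m\<in>A. if m = k then lookup p m else 0)"
    by (auto simp: lookup_sum lookup_single when_def intro!: sum.cong)
  also have "\<dots> = lookup p k"
    using assms by (auto simp: in_keys_iff)
  finally show "lookup p k
      = lookup (\<Sum>m\<in>A. Poly_Mapping.single m (lookup p m)) k" by simp
qed

text \<open>Evaluation is generic in the coefficient map and in the images of the variables because
  the substitution for one variable and both reductions at the cycle are instances. Only
  \<open>\<iota>\<close> is constrained, so evaluations with different \<open>h\<close> can be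
  compared.\<close>

locale mpoly_eval =
  fixes \<iota> :: "'k::comm_ring_1 \<Rightarrow> 'r::comm_ring_1" and h :: "'n::finite \<Rightarrow> 'r"
  assumes one [simp]: "\<iota> 1 = 1"
    and add: "\<iota> (a + b) = \<iota> a + \<iota> b"
    and mult: "\<iota> (a * b) = \<iota> a * \<iota> b"
begin

definition ev :: "('k, 'n) mpoly \<Rightarrow> 'r" where
  "ev p = (\<Sum>m\<in>Poly_Mapping.keys p. \<iota> (lookup p m) * (\<Prod>i\<in>UNIV. h i ^ lookup m i))"

lemma zero [simp]: "\<iota> 0 = 0"
  using add[of 0 0] by simp

lemma ev_superset:
  assumes "finite A" "Poly_Mapping.keys p \<subseteq> A"
  shows "ev p = (\<Sum>m\<in>A. \<iota> (lookup p m) * (\<Prod>i\<in>UNIV. h i ^ lookup m i))"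
  unfolding ev_def using assms by (intro sum.mono_neutral_left) (auto simp: in_keys_iff)

lemma ev_0 [simp]: "ev 0 = 0"
  by (simp add: ev_def)

lemma ev_add: "ev (p + p') = ev p + ev p'"
proof -
  let ?A = "Poly_Mapping.keys p \<union> Poly_Mapping.keys p'"
  have "Poly_Mapping.keys (p + p') \<subseteq> ?A" by (rule keys_add)
  then show ?thesis
    by (subst (1 2 3) ev_superset[of ?A])
      (auto simp: lookup_add add algebra_simps sum.distrib)
qed

lemma ev_single:
  "ev (Poly_Mapping.single m c) = \<iota> c * (\<Prod>i\<in>UNIV. h i ^ lookup m i)"
  by (subst ev_superset[of "{m}"]) auto

lemma ev_sum: "ev (sum f A) = (\<Sum>x\<in>A. ev (f x))"
  by (induct A rule: infinite_finite_induct) (simp_all add: ev_add)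

lemma ev_mult: "ev (p * p') = ev p * ev p'"
proof -
  let ?s = "Poly_Mapping.single" and ?l = "lookup"
  have p: "p = (\<Sum>m\<in>Poly_Mapping.keys p. ?s m (?l p m))"
    and p': "p' = (\<Sum>m\<in>Poly_Mapping.keys p'. ?s m (?l p' m))"
    by (rule poly_mapping_sum_single; simp)+
  have "ev (p * p') = (\<Sum>m\<in>Poly_Mapping.keys p. \<Sum>m'\<in>Poly_Mapping.keys p'.
      ev (?s m (?l p m) * ?s m' (?l p' m')))"
    by (subst p, subst p') (simp add: sum_product ev_sum)
  also have "\<dots> = (\<Sum>m\<in>Poly_Mapping.keys p. \<Sum>m'\<in>Poly_Mapping.keys p'.
      ev (?s m (?l p m)) * ev (?s m' (?l p' m')))"
    by (simp add: mult_single ev_single lookup_add power_add mult prod.distrib algebra_simps)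
  also have "\<dots> = ev (\<Sum>m\<in>Poly_Mapping.keys p. ?s m (?l p m))
      * ev (\<Sum>m\<in>Poly_Mapping.keys p'. ?s m (?l p' m))"
    by (simp add: sum_product ev_sum)
  also have "\<dots> = ev p * ev p'"
    using p p' by simp
  finally show ?thesis .
qed

lemma ev_mconst [simp]: "ev (mconst c) = \<iota> c"
  by (simp add: mconst_def ev_single)

lemma ev_1 [simp]: "ev 1 = 1"
  using ev_mconst[of 1] by (simp add: mconst_def)

lemma ev_mvar [simp]: "ev (mvar i) = h i"
proof -
  have "h j ^ lookup (Poly_Mapping.single i 1) j = (if j = i then h i else 1)" for j
    by (simp add: lookup_single when_def)
  then have "(\<Prod>j\<in>UNIV. h j ^ lookup (Poly_Mapping.single i 1) j) = h i"
    by (simp del: One_nat_def)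
  then show ?thesis by (simp add: mvar_def ev_single del: One_nat_def)
qed

lemma ev_uminus: "ev (- p) = - ev p"
  using ev_add[of p "- p"] by (simp add: eq_neg_iff_add_eq_0 add.commute)

lemma ev_diff: "ev (p - p') = ev p - ev p'"
  using ev_add[of p "- p'"] by (simp add: ev_uminus)

lemma ev_power: "ev (p ^ n) = ev p ^ n"
  by (induct n) (simp_all add: ev_mult)

lemma ev_prod: "ev (prod f A) = (\<Prod>x\<in>A. ev (f x))"
  by (induct A rule: infinite_finite_induct) (simp_all add: ev_mult)

lemma ev_dvd: "p dvd p' \<Longrightarrow> ev p dvd ev p'"
  by (auto simp: dvd_def ev_mult)

lemmas ev_simps = ev_add ev_mult ev_uminus ev_diff ev_power ev_prod ev_sum

end

lemma prod_diff_dvd: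
  fixes f g :: "'a \<Rightarrow> 'r::comm_ring_1"
  assumes "\<And>i. i \<in> A \<Longrightarrow> d dvd f i - g i"
  shows "d dvd prod f A - prod g A"
  using assms
proof (induct A rule: infinite_finite_induct)
  case (insert x A)
  have "prod f (insert x A) - prod g (insert x A)
      = f x * (prod f A - prod g A) + (f x - g x) * prod g A"
    using insert by (simp add: algebra_simps)
  then show ?case using insert by (metis dvd_add dvd_mult dvd_mult2 insertI1 insertI2)
qed auto

lemma power_diff_dvd: "(x::'r::comm_ring_1) - y dvd x ^ n - y ^ n"
  using prod_diff_dvd[of "{..<n}" "x - y" "\<lambda>_. x" "\<lambda>_. y"] by simp

text \<open>Monomials are products of values of \<open>h\<close>, so a congruence on the variables
  propagates. Comparing the identity evaluation with a substitution gives the factor theorem behind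
  \<open>sub_cong\<close>.\<close>

lemma ev_diff_dvd:
  fixes h h' :: "'n::finite \<Rightarrow> 'r::comm_ring_1"
  assumes "mpoly_eval \<iota>" and "\<And>i. d dvd h i - h' i"
  shows "d dvd mpoly_eval.ev \<iota> h p - mpoly_eval.ev \<iota> h' p"
proof -
  interpret a: mpoly_eval \<iota> h by fact
  interpret b: mpoly_eval \<iota> h' by fact
  have "d dvd h i ^ n - h' i ^ n" for i n
    using dvd_trans[OF assms(2) power_diff_dvd] .
  then show ?thesis
    unfolding a.ev_def b.ev_def sum_subtractf[symmetric] right_diff_distrib[symmetric]
    by (intro dvd_sum dvd_mult prod_diff_dvd)
qed

lemma mconst_hom: "mpoly_eval mconst"
  by standard (simp_all add: mconst_def single_add mult_single)

lemma mconst_0 [simp]: "mconst 0 = 0" and mconst_1 [simp]: "mconst 1 = 1"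
  by (simp_all add: mconst_def)

lemma mconst_add: "mconst (a + b) = mconst a + mconst b"
  and mconst_mult: "mconst (a * b) = mconst a * mconst b"
  and mconst_uminus: "mconst (- a) = - mconst a"
  and mconst_diff: "mconst (a - b) = mconst a - mconst b"
  by (simp_all add: mconst_def single_add mult_single single_uminus single_diff)

lemma mconst_power: "mconst (a ^ n) = mconst a ^ n"
  by (induct n) (simp_all add: mconst_mult)

lemma prod_single_one:
  "(\<Prod>x\<in>A. Poly_Mapping.single (f x) (1::'k::comm_ring_1)) = Poly_Mapping.single (\<Sum>x\<in>A. f x) 1"
  by (induct A rule: infinite_finite_induct) (simp_all add: mult_single)

lemma power_single_one:
  "Poly_Mapping.single m (1::'k::comm_ring_1) ^ n = Poly_Mapping.single (\<Sum>i<n. m) 1"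
  using prod_single_one[of "\<lambda>_. m" "{..<n}"] by simp

lemma sum_single_index:
  "(\<Sum>j<n. Poly_Mapping.single (i::'a) (1::nat)) = Poly_Mapping.single i n"
  by (rule poly_mapping_eqI) (simp add: lookup_sum lookup_single when_def)

lemma mvar_power: "mvar i ^ n = Poly_Mapping.single (Poly_Mapping.single i n) 1"
  unfolding mvar_def power_single_one sum_single_index ..

lemma ev_mvar_id:
  fixes p :: "('k::comm_ring_1, 'n::finite) mpoly"
  shows "mpoly_eval.ev mconst mvar p = p"
proof -
  interpret mpoly_eval mconst mvar by (rule mconst_hom)
  have m: "(\<Sum>i\<in>UNIV. Poly_Mapping.single i (lookup m i)) = m" for m :: "'n \<Rightarrow>\<^sub>0 nat"
    using poly_mapping_sum_single[of UNIV m] by simp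
  have "mconst c * (\<Prod>i\<in>UNIV. mvar i ^ lookup m i) = Poly_Mapping.single m c"
    for c :: 'k and m :: "'n \<Rightarrow>\<^sub>0 nat"
    by (simp add: mvar_power prod_single_one mconst_def mult_single m)
  then show ?thesis
    unfolding ev_def using poly_mapping_sum_single[of "Poly_Mapping.keys p" p] by simp
qed

text \<open>An injection of the variables into \<open>nat\<close> embeds the ring into the
  polynomials in variables indexed by \<open>nat\<close>. There the exponent vectors carry a linear
  order compatible with addition, which excludes zero divisors.\<close>

lemma mpoly_no_zero_divisors:
  fixes p p' :: "('k::idom, 'n::finite) mpoly"
  assumes "p * p' = 0"
  shows "p = 0 \<or> p' = 0"
proof -
  obtain idx :: "'n \<Rightarrow> nat" where idx: "inj idx"
    using finite_imp_inj_to_nat_seg[of "UNIV :: 'n set"] by auto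
  define h :: "'n \<Rightarrow> (nat \<Rightarrow>\<^sub>0 nat) \<Rightarrow>\<^sub>0 'k" where "h i = mvar (idx i)" for i
  interpret mpoly_eval mconst h by (rule mconst_hom)
  define r :: "('n \<Rightarrow>\<^sub>0 nat) \<Rightarrow> nat \<Rightarrow>\<^sub>0 nat"
    where "r m = (\<Sum>i\<in>UNIV. Poly_Mapping.single (idx i) (lookup m i))" for m
  have lr: "lookup (r m) (idx j) = lookup m j" for m j
    using idx by (simp add: r_def lookup_sum lookup_single when_def inj_eq)
  have "inj r"
    by (rule injI) (metis lr poly_mapping_eqI)
  have ev_r: "ev p = (\<Sum>m\<in>Poly_Mapping.keys p. Poly_Mapping.single (r m) (lookup p m))" for p
    unfolding ev_def
    by (simp add: h_def mvar_power prod_single_one mconst_def mult_single r_def)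
  have "lookup (ev p) (r m) = lookup p m" for p m
    unfolding ev_r using \<open>inj r\<close>
    by (simp add: lookup_sum lookup_single when_def inj_eq in_keys_iff)
  then have inj: "ev p = 0 \<Longrightarrow> p = 0" for p
    by (metis lookup_zero poly_mapping_eqI)
  have "ev p * ev p' = 0" using assms by (metis ev_mult ev_0)
  then show ?thesis using inj by auto
qed

lemma mpoly_mult_cancel:
  fixes c :: "('k::idom, 'n::finite) mpoly"
  assumes "c * p = c * p'" "c \<noteq> 0"
  shows "p = p'"
  using mpoly_no_zero_divisors[of c "p - p'"] assms by (auto simp: algebra_simps)

lemma mpoly_prod_nonzero:
  fixes f :: "'a \<Rightarrow> ('k::idom, 'n::finite) mpoly"
  assumes "\<And>x. x \<in> A \<Longrightarrow> f x \<noteq> 0"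
  shows "prod f A \<noteq> 0"
  using assms
proof (induct A rule: infinite_finite_induct)
  case (insert x A)
  then show ?case using mpoly_no_zero_divisors[of "f x" "prod f A"] by auto
qed auto

section \<open>Substitution for one variable\<close>

definition sub :: "'n::finite \<Rightarrow> ('k::comm_ring_1, 'n) mpoly \<Rightarrow> ('k, 'n) mpoly \<Rightarrow> ('k, 'n) mpoly" where
  "sub v L = mpoly_eval.ev mconst (\<lambda>i. if i = v then L else mvar i)"

interpretation sub: mpoly_eval mconst "\<lambda>i. if i = v then L else mvar i"
  rewrites "mpoly_eval.ev mconst (\<lambda>i. if i = v then L else mvar i) = sub v L" for v L
  by (rule mconst_hom) (simp add: sub_def)

lemma sub_cong: "mvar v - L dvd p - sub v L p"
proof -
  have "mvar v - L dvd mpoly_eval.ev mconst mvar p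
      - mpoly_eval.ev mconst (\<lambda>i. if i = v then L else mvar i) p"
    by (rule ev_diff_dvd[OF mconst_hom]) simp
  then show ?thesis by (simp add: ev_mvar_id sub_def)
qed

text \<open>The variable v does not occur in p, expressed in the form that the factor theorem
  consumes.\<close>

definition indep :: "'n::finite \<Rightarrow> ('k::comm_ring_1, 'n) mpoly \<Rightarrow> bool" where
  "indep v p \<longleftrightarrow> (\<forall>L. sub v L p = p)"

lemma dvd_iff_sub:
  assumes "indep v L"
  shows "mvar v - L dvd p \<longleftrightarrow> sub v L p = 0"
proof
  assume "mvar v - L dvd p"
  then have "sub v L (mvar v - L) dvd sub v L p" by (rule sub.ev_dvd)
  then show "sub v L p = 0" using assms by (simp add: sub.ev_diff indep_def)
next
  assume "sub v L p = 0"
  then show "mvar v - L dvd p" using sub_cong[of v L p] by simp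
qed

text \<open>Takes the place of unique factorization. If p is the product of the earlier factors
  times r, then substituting L for v kills p but turns the earlier factors into nonzero differences
  \<open>L - L'\<close>, so it kills r.\<close>

lemma prod_dvd_mpoly:
  fixes p :: "('k::idom, 'n::finite) mpoly"
  assumes "finite T" "\<And>L. L \<in> T \<Longrightarrow> indep v L" "\<And>L. L \<in> T \<Longrightarrow> mvar v - L dvd p"
  shows "(\<Prod>L\<in>T. mvar v - L) dvd p"
  using assms
proof (induct T)
  case (insert L T)
  then obtain r where r: "p = (\<Prod>L\<in>T. mvar v - L) * r" by (auto simp: dvd_def)
  have i: "sub v L L' = L'" if "L' \<in> T" for L' using insert.prems(1) that by (simp add: indep_def)
  have "sub v L p = 0" using insert.prems dvd_iff_sub by blast
  then have "(\<Prod>L'\<in>T. L - L') * sub v L r = 0"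
    unfolding r by (simp add: sub.ev_simps i)
  moreover have "(\<Prod>L'\<in>T. L - L') \<noteq> 0"
    using insert.hyps by (intro mpoly_prod_nonzero) auto
  ultimately have "sub v L r = 0" using mpoly_no_zero_divisors by blast
  then have "mvar v - L dvd r" using dvd_iff_sub insert.prems(1) by blast
  then show ?case unfolding r using insert.hyps by (simp add: mult_dvd_mono mult.commute)
qed simp

section \<open>Linear forms\<close>

lemma linear_form_eq: "linear_form a = (\<Sum>i\<in>UNIV. mconst (a $ i) * mvar i)"
  by (simp add: linear_form_def mconst_def mvar_def mult_single)

lemma lookup_linear_form:
  "lookup (linear_form a) (Poly_Mapping.single i 1) = a $ i"
proof -
  have [simp]: "Poly_Mapping.single j (Suc 0) = Poly_Mapping.single i (Suc 0) \<longleftrightarrow> j = i" for j i :: 'b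
    by (metis lookup_single_eq lookup_single_not_eq nat.distinct(1))
  show ?thesis
    by (simp add: linear_form_def lookup_sum lookup_single when_def)
qed

lemma linear_form_0_iff [simp]: "linear_form a = 0 \<longleftrightarrow> a = 0"
proof
  assume "linear_form a = 0"
  then have "a $ i = 0" for i using lookup_linear_form[of a i] by simp
  then show "a = 0" by (simp add: vec_eq_iff)
qed (simp add: linear_form_eq)

lemma linear_form_inj: "linear_form a = linear_form b \<longleftrightarrow> a = b"
  by (metis lookup_linear_form vec_eq_iff)

lemma linear_form_add: "linear_form (a + b) = linear_form a + linear_form b"
  by (simp add: linear_form_eq mconst_add algebra_simps sum.distrib)

lemma linear_form_scale: "linear_form (c *s a) = mconst c * linear_form a"
  by (simp add: linear_form_eq mconst_mult algebra_simps sum_distrib_left)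

lemma linear_form_axis: "linear_form (axis i 1) = mvar i"
proof -
  have "linear_form (axis i 1) = (\<Sum>j\<in>UNIV. if j = i then mvar j else 0)"
    unfolding linear_form_eq by (intro sum.cong) (auto simp: axis_def)
  then show ?thesis by simp
qed

lemma indep_linear_form:
  assumes "a $ v = 0"
  shows "indep v (linear_form a)"
  unfolding indep_def linear_form_eq
  by (auto simp: sub.ev_simps assms intro!: sum.cong)

lemma mvar_nonzero [simp]: "(mvar i :: ('k::comm_ring_1, 'n) mpoly) \<noteq> 0"
proof
  assume "mvar i = (0 :: ('k, 'n) mpoly)"
  then have "lookup (mvar i :: ('k, 'n) mpoly) (Poly_Mapping.single i 1) = 0" by simp
  then show False by (simp add: mvar_def)
qed

lemma pdiff_linear_form: "pdiff i (linear_form a) = mconst (a $ i)"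
proof -
  let ?s = "\<lambda>j. Poly_Mapping.single j (1::nat)" and ?l = lookup
  let ?t = "\<lambda>m. Poly_Mapping.single (m - ?s i) (of_nat (?l m i) * ?l (linear_form a) m)"
  have inj: "inj ?s"
  proof (rule injI)
    fix j j' assume "?s j = ?s j'"
    then have "?l (?s j) j = ?l (?s j') j" by simp
    then show "j = j'" by (simp add: lookup_single when_def split: if_splits)
  qed
  have "Poly_Mapping.keys (linear_form a) \<subseteq> range ?s"
    unfolding linear_form_def by (rule order_trans[OF keys_sum]) auto
  then have "pdiff i (linear_form a) = (\<Sum>m\<in>range ?s. ?t m)"
    unfolding pdiff_def by (intro sum.mono_neutral_left) (auto simp: in_keys_iff)
  also have "\<dots> = (\<Sum>j\<in>UNIV. ?t (?s j))"
    by (subst sum.reindex[OF inj]) simp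
  also have "\<dots> = (\<Sum>j\<in>UNIV. if j = i then mconst (a $ i) else 0)"
    by (intro sum.cong refl) (auto simp: mconst_def lookup_single when_def lookup_linear_form[simplified])
  finally show ?thesis by simp
qed

section \<open>Free submodules over integral domains\<close>

lemma module_vec: "module ((*s) :: 'r::comm_ring_1 \<Rightarrow> 'r ^ 'n \<Rightarrow> 'r ^ 'n)"
  by unfold_locales (simp_all add: vec_eq_iff algebra_simps)

text \<open>Fraction-free Gaussian elimination. No type class is used for the absence of zero divisors,
  since the polynomial ring over the index type \<open>'n\<close> is not an instance of one.\<close>

lemma homogeneous_system_solution:
  fixes c :: "'i \<Rightarrow> 'j \<Rightarrow> 'r::comm_ring_1"
  assumes nzd: "\<And>a b :: 'r. a * b = 0 \<Longrightarrow> a = 0 \<or> b = 0"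
    and "finite I" "finite J" "card I < card J"
  shows "\<exists>s. (\<exists>j\<in>J. s j \<noteq> 0) \<and> (\<forall>i\<in>I. (\<Sum>j\<in>J. s j * c i j) = 0)"
  using assms(2-4)
proof (induct I arbitrary: J c)
  case empty
  then have "J \<noteq> {}" by auto
  then show ?case by (intro exI[of _ "\<lambda>_. 1"]) auto
next
  case (insert i I)
  show ?case
  proof (cases "\<forall>j\<in>J. c i j = 0")
    case True
    obtain s where "\<exists>j\<in>J. s j \<noteq> 0" "\<forall>i\<in>I. (\<Sum>j\<in>J. s j * c i j) = 0"
      using insert.hyps(3)[of J c] insert.hyps(1,2) insert.prems by auto
    then show ?thesis using True by (intro exI[of _ s]) auto
  next
    case False
    then obtain k where k: "k \<in> J" "c i k \<noteq> 0" by blast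
    let ?J = "J - {k}"
    have "card I < card ?J" using insert k by simp
    then obtain s where s: "\<exists>j\<in>?J. s j \<noteq> 0"
      "\<And>i'. i' \<in> I \<Longrightarrow> (\<Sum>j\<in>?J. s j * (c i k * c i' j - c i j * c i' k)) = 0"
      using insert.hyps(3)[of ?J "\<lambda>i' j. c i k * c i' j - c i j * c i' k"] insert.prems by blast
    \<comment> \<open>Scaling the solution of the reduced system by the pivot \<open>c i k\<close>
      lets equation i be solved for the unknown k without division.\<close>
    define s' where "s' j = (if j = k then - (\<Sum>j\<in>?J. s j * c i j) else c i k * s j)" for j
    obtain j where "j \<in> ?J" "s j \<noteq> 0" using s(1) by blast
    then have "j \<in> J" "s' j \<noteq> 0" using nzd k(2) by (auto simp: s'_def)
    then have "\<exists>j\<in>J. s' j \<noteq> 0" by blast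
    moreover have "(\<Sum>j\<in>J. s' j * c i' j) = 0" if "i' \<in> insert i I" for i'
    proof -
      have "(\<Sum>j\<in>J. s' j * c i' j) = s' k * c i' k + (\<Sum>j\<in>?J. s' j * c i' j)"
        using k insert.prems by (simp add: sum.remove)
      also have "(\<Sum>j\<in>?J. s' j * c i' j) = (\<Sum>j\<in>?J. c i k * s j * c i' j)"
        by (rule sum.cong) (auto simp: s'_def)
      also have "s' k * c i' k = - (\<Sum>j\<in>?J. s j * c i j * c i' k)"
        by (simp add: s'_def sum_distrib_right)
      also have "- (\<Sum>j\<in>?J. s j * c i j * c i' k) + (\<Sum>j\<in>?J. c i k * s j * c i' j)
          = (\<Sum>j\<in>?J. s j * (c i k * c i' j - c i j * c i' k))"
        by (simp add: algebra_simps sum_subtractf)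
      also have "\<dots> = 0" using that s(2) by (cases "i' = i") auto
      finally show ?thesis .
    qed
    ultimately show ?thesis by blast
  qed
qed

lemma vec_sum_nth: "(\<Sum>x\<in>A. f x) $ i = (\<Sum>x\<in>A. f x $ i)"
  by (induct A rule: infinite_finite_induct) simp_all

lemma independent_card_le:
  fixes B :: "('r::comm_ring_1 ^ 'n::finite) set"
  assumes nzd: "\<And>a b :: 'r. a * b = 0 \<Longrightarrow> a = 0 \<or> b = 0"
    and B: "\<not> module.dependent (*s) B"
  shows "finite B \<and> card B \<le> CARD('n)"
proof (rule ccontr)
  interpret module "(*s) :: 'r \<Rightarrow> 'r ^ 'n \<Rightarrow> 'r ^ 'n" by (rule module_vec)
  assume "\<not> ?thesis"
  then obtain T where T: "T \<subseteq> B" "finite T" "card T = Suc (CARD('n))"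
    by (metis infinite_arbitrarily_large not_less_eq_eq obtain_subset_with_card_n)
  obtain s where s: "\<exists>b\<in>T. s b \<noteq> 0" "\<forall>i\<in>(UNIV :: 'n set). (\<Sum>b\<in>T. s b * b $ i) = 0"
    using homogeneous_system_solution[OF nzd, of UNIV T "\<lambda>i b. b $ i"] T by auto
  have "(\<Sum>b\<in>T. s b *s b) = 0"
    using s(2) by (simp add: vec_eq_iff vec_sum_nth)
  then show False using B T s(1) unfolding dependent_explicit by blast
qed

text \<open>Prepares a count of generators after reduction: \<open>\<phi>\<close> will be reduction
  modulo the cycle variables, and \<open>s\<close> is a relation among the reduced coefficients
  only.\<close>

lemma free_submodule_relation:
  fixes M :: "('r::comm_ring_1 ^ 'n::finite) set" and \<phi> :: "'r \<Rightarrow> 'r" and e :: "'j \<Rightarrow> 'r ^ 'n"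
  assumes nzd: "\<And>a b :: 'r. a * b = 0 \<Longrightarrow> a = 0 \<or> b = 0"
    and "free_submodule M" "finite J" "card J > CARD('n)" "\<And>j. j \<in> J \<Longrightarrow> e j \<in> M"
  obtains B c s where "finite B" "B \<subseteq> M" "\<And>j. j \<in> J \<Longrightarrow> e j = (\<Sum>b\<in>B. c j b *s b)"
    "\<exists>j\<in>J. s j \<noteq> 0" "\<And>b. b \<in> B \<Longrightarrow> (\<Sum>j\<in>J. s j * \<phi> (c j b)) = 0"
proof -
  interpret module "(*s) :: 'r \<Rightarrow> 'r ^ 'n \<Rightarrow> 'r ^ 'n" by (rule module_vec)
  obtain B where B: "\<not> dependent B" "span B = M"
    using assms(2) unfolding free_submodule_def by blast
  have fin: "finite B" "card B \<le> CARD('n)" using independent_card_le[OF nzd B(1)] by auto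
  have "\<exists>c. e j = (\<Sum>b\<in>B. c b *s b)" if "j \<in> J" for j
    using assms(5)[OF that] unfolding B(2)[symmetric] span_finite[OF fin(1)] by auto
  then obtain c where c: "\<And>j. j \<in> J \<Longrightarrow> e j = (\<Sum>b\<in>B. c j b *s b)" by metis
  obtain s where "\<exists>j\<in>J. s j \<noteq> 0" "\<forall>b\<in>B. (\<Sum>j\<in>J. s j * \<phi> (c j b)) = 0"
    using homogeneous_system_solution[OF nzd, of B J "\<lambda>b j. \<phi> (c j b)"] fin assms(3,4) by auto
  with c fin(1) B(2) span_superset[of B] show thesis by (intro that) auto
qed

text \<open>The projection \<open>p\<close> forgets the coordinate v; it maps M onto M', and its
  kernel in M consists of the multiples of \<open>Q *s axis v 1\<close>. As M' is free, the sequence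
  splits: \<open>Q *s axis v 1\<close> and any lifts of a basis of M' form a basis of M.\<close>

lemma free_submodule_extend:
  fixes M M' :: "('r::comm_ring_1 ^ 'n::finite) set" and Q :: 'r and v :: 'n
  defines "p \<equiv> \<lambda>f. f - f $ v *s axis v 1"
  assumes nzd: "\<And>a b :: 'r. a * b = 0 \<Longrightarrow> a = 0 \<or> b = 0"
    and free: "free_submodule M'" and M: "module.subspace (*s) M"
    and v: "\<And>f. f \<in> M' \<Longrightarrow> f $ v = 0"
    and restrict: "\<And>f. f \<in> M \<Longrightarrow> p f \<in> M'"
    and extend: "\<And>f. f \<in> M' \<Longrightarrow> \<exists>g. f + g *s axis v 1 \<in> M"
    and kernel: "\<And>c. c *s axis v 1 \<in> M \<longleftrightarrow> Q dvd c" and Q: "Q \<noteq> 0"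
  shows "free_submodule M"
proof -
  interpret module "(*s) :: 'r \<Rightarrow> 'r ^ 'n \<Rightarrow> 'r ^ 'n" by (rule module_vec)
  obtain B' where B': "\<not> dependent B'" "span B' = M'"
    using free unfolding free_submodule_def by blast
  have "\<exists>g. b + g *s axis v 1 \<in> M" if "b \<in> B'" for b
    using extend that B'(2) span_base by blast
  then obtain g where g: "\<And>b. b \<in> B' \<Longrightarrow> b + g b *s axis v 1 \<in> M" by metis
  define \<beta> where "\<beta> b = b + g b *s axis v 1" for b
  have p_add: "p (x + y) = p x + p y" and p_scale: "p (c *s x) = c *s p x" for x y c
    by (simp_all add: p_def vec_eq_iff algebra_simps)
  have p_0: "p 0 = 0" by (simp add: p_def)
  have p_sum: "p (sum f A) = (\<Sum>x\<in>A. p (f x))" for f :: "'r ^ 'n \<Rightarrow> _" and A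
    by (induct A rule: infinite_finite_induct) (simp_all add: p_add p_0)
  have p_axis: "p (c *s axis v 1) = 0" for c by (simp add: p_def)
  have p_v: "p x = x" if "x \<in> M'" for x using v[OF that] by (simp add: p_def)
  have p_\<beta>: "p (\<beta> b) = b" if "b \<in> B'" for b
    using that B'(2) span_base[of b B'] by (simp add: \<beta>_def p_add p_axis p_v)
  have inj: "inj_on \<beta> B'" by (rule inj_on_inverseI[of _ p]) (rule p_\<beta>)
  let ?a = "Q *s axis v 1 :: 'r ^ 'n"
  let ?B = "insert ?a (\<beta> ` B')"
  have "\<not> dependent ?B"
  proof
    assume "dependent ?B"
    then obtain t u where t: "finite t" "t \<subseteq> ?B" "(\<Sum>x\<in>t. u x *s x) = 0" "\<exists>x\<in>t. u x \<noteq> 0"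
      unfolding dependent_explicit by auto
    define T where "T = {b \<in> B'. \<beta> b \<in> t}"
    have T: "t - {?a} \<subseteq> \<beta> ` T" "\<beta> ` T \<subseteq> t" "T \<subseteq> B'" using t(2) by (auto simp: T_def)
    have finT: "finite T"
      using finite_subset[OF T(2) t(1)] inj_on_subset[OF inj T(3)] finite_imageD by blast
    have "0 \<notin> B'" using B'(1) dependent_zero by blast
    have a': "?a \<notin> \<beta> ` T"
    proof
      assume "?a \<in> \<beta> ` T"
      then obtain b where b: "b \<in> B'" "?a = \<beta> b" using T(3) by auto
      then have "b = 0" using p_\<beta>[OF b(1)] p_axis[of Q] by simp
      with b(1) \<open>0 \<notin> B'\<close> show False by simp
    qed
    have split: "(\<Sum>x\<in>t. f x) = (if ?a \<in> t then f ?a else 0) + (\<Sum>b\<in>T. f (\<beta> b))"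
      for f :: "'r ^ 'n \<Rightarrow> 'r ^ 'n"
    proof -
      have "t = (if ?a \<in> t then {?a} else {}) \<union> \<beta> ` T" using T by auto
      then have "(\<Sum>x\<in>t. f x) = (\<Sum>x\<in>(if ?a \<in> t then {?a} else {}) \<union> \<beta> ` T. f x)" by simp
      also have "\<dots> = (\<Sum>x\<in>(if ?a \<in> t then {?a} else {}). f x) + (\<Sum>x\<in>\<beta> ` T. f x)"
        using a' finT by (intro sum.union_disjoint) auto
      finally have "(\<Sum>x\<in>t. f x) = (\<Sum>x\<in>(if ?a \<in> t then {?a} else {}). f x) + (\<Sum>x\<in>\<beta> ` T. f x)" .
      then show ?thesis using sum.reindex[OF inj_on_subset[OF inj T(3)], of f] by simp
    qed
    have "0 = p (\<Sum>x\<in>t. u x *s x)" using t(3) p_0 by simp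
    also have "\<dots> = (\<Sum>x\<in>t. u x *s p x)" by (simp add: p_sum p_scale)
    also have "\<dots> = (\<Sum>b\<in>T. u (\<beta> b) *s p (\<beta> b))" unfolding split by (simp add: p_axis)
    also have "\<dots> = (\<Sum>b\<in>T. u (\<beta> b) *s b)" using T(3) p_\<beta> by (intro sum.cong) auto
    finally have "u (\<beta> b) = 0" if "b \<in> T" for b
      using independentD[OF B'(1) finT T(3), of "\<lambda>b. u (\<beta> b)"] that by simp
    then have ub: "u x = 0" if "x \<in> t" "x \<noteq> ?a" for x using T(1) that by blast
    obtain x where "x \<in> t" "u x \<noteq> 0" using t(4) by blast
    then have at: "?a \<in> t" "u ?a \<noteq> 0" using ub[of x] by auto
    have "(\<Sum>b\<in>T. u (\<beta> b) *s \<beta> b) = 0"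
      using \<open>\<And>b. b \<in> T \<Longrightarrow> u (\<beta> b) = 0\<close> by simp
    then have "u ?a *s ?a = 0" using t(3) at unfolding split by simp
    then have "(u ?a *s ?a) $ v = 0" by simp
    then have "u ?a * Q = 0" by (simp add: axis_def)
    then show False using nzd at Q by blast
  qed
  moreover have "span ?B = M"
  proof
    have "?B \<subseteq> M" using g kernel[of Q] by (auto simp: \<beta>_def)
    then show "span ?B \<subseteq> M" using M span_minimal by blast
    show "M \<subseteq> span ?B"
    proof
      fix f assume f: "f \<in> M"
      have "\<exists>y\<in>span ?B. p y = x" if "x \<in> span B'" for x
        using that
      proof (induct rule: span_induct_alt)
        case base then show ?case using p_0 span_zero by blast
      next
        case (step c x y)
        then obtain z where z: "z \<in> span ?B" "p z = y" by blast
        have "c *s \<beta> x \<in> span ?B" using step(1) by (intro span_scale span_base) simp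
        with z show ?case
          by (intro bexI[of _ "c *s \<beta> x + z"]) (simp_all add: p_add p_scale p_\<beta> step(1) span_add)
      qed
      then obtain y where y: "y \<in> span ?B" "p y = p f" using restrict[OF f] B'(2) by metis
      have "p (f - y) = 0" using y(2) p_add[of "f - y" y] by simp
      then have fy: "f - y = (f - y) $ v *s axis v 1" unfolding p_def by (rule eq_iff_diff_eq_0[THEN iffD2])
      have "y \<in> M" using y(1) \<open>span ?B \<subseteq> M\<close> by (rule rev_subsetD)
      then have "f - y \<in> M" using f M by (intro subspace_diff)
      then have "Q dvd (f - y) $ v" using kernel[of "(f - y) $ v"] fy by simp
      then obtain r where r: "(f - y) $ v = Q * r" by (elim dvdE)
      have "f - y = r *s ?a" using fy[unfolded r] by (simp only: scale_scale mult.commute)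
      then have "f - y \<in> span ?B" by (simp only: span_base span_scale insertI1)
      then show "f \<in> span ?B" using y(1) span_add[of "f - y" ?B y] by simp
    qed
  qed
  ultimately have "\<not> dependent ?B \<and> span ?B = M" by (rule conjI)
  then show ?thesis unfolding free_submodule_def by (rule exI)
qed

section \<open>Hyperplanes and their coefficient vectors\<close>

definition dot :: "'k::comm_ring_1 ^ 'n::finite \<Rightarrow> 'k ^ 'n \<Rightarrow> 'k" where
  "dot a x = (\<Sum>i\<in>UNIV. a $ i * x $ i)"

definition supp :: "'k::zero ^ 'n \<Rightarrow> 'n set" where
  "supp a = {i. a $ i \<noteq> 0}"

lemma hyperplane_dot: "hyperplane a = {x. dot a x = 0}"
  by (simp add: hyperplane_def dot_def)

lemma dot_add_right: "dot a (x + y) = dot a x + dot a y"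
  and dot_scale_right: "dot a (c *s x) = c * dot a x"
  and dot_diff_right: "dot a (x - y) = dot a x - dot a y"
  and dot_add_left: "dot (a + b) x = dot a x + dot b x"
  and dot_scale_left: "dot (c *s a) x = c * dot a x"
  and dot_diff_left: "dot (a - b) x = dot a x - dot b x"
  and dot_zero_left: "dot 0 x = 0"
  by (simp_all add: dot_def algebra_simps sum.distrib sum_subtractf sum_distrib_left)

lemma dot_axis [simp]: "dot a (axis i c) = a $ i * c"
proof -
  have "dot a (axis i c) = (\<Sum>j\<in>UNIV. if j = i then a $ i * c else 0)"
    unfolding dot_def by (intro sum.cong) (auto simp: axis_def)
  then show ?thesis by simp
qed

lemma dot_axis_left [simp]: "dot (axis i c) x = c * x $ i"
proof -
  have "dot (axis i c) x = (\<Sum>j\<in>UNIV. if j = i then c * x $ i else 0)"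
    unfolding dot_def by (intro sum.cong) (auto simp: axis_def)
  then show ?thesis by simp
qed

lemma vec_eq_dot: "a = b \<longleftrightarrow> (\<forall>x. dot a x = dot b x)"
  by (metis dot_axis mult.right_neutral vec_eq_iff)

lemma supp_empty_iff [simp]: "supp a = {} \<longleftrightarrow> a = 0"
  by (auto simp: supp_def vec_eq_iff)

lemma exists_dot_nonzero: "a \<noteq> 0 \<Longrightarrow> \<exists>x. dot a x \<noteq> 0"
  by (metis vec_eq_dot dot_zero_left)

lemma hyperplane_subset:
  fixes a b :: "'k::field ^ 'n::finite"
  assumes "hyperplane a \<subseteq> hyperplane b" "a \<noteq> 0" "b \<noteq> 0"
  obtains c where "c \<noteq> 0" "b = c *s a"
proof -
  obtain i where i: "a $ i \<noteq> 0" using assms(2) by (auto simp: vec_eq_iff)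
  have "b $ j * a $ i = b $ i * a $ j" for j
  proof -
    have "a $ i *s axis j 1 - a $ j *s axis i 1 \<in> hyperplane a"
      by (simp add: hyperplane_dot dot_diff_right dot_scale_right)
    then have "a $ i *s axis j 1 - a $ j *s axis i 1 \<in> hyperplane b" using assms(1) by blast
    then show ?thesis by (simp add: hyperplane_dot dot_diff_right dot_scale_right mult.commute)
  qed
  then have b: "b = (b $ i / a $ i) *s a" using i by (simp add: vec_eq_iff field_simps)
  then have "b $ i / a $ i \<noteq> 0" using assms(3) by auto
  with b show thesis using that by blast
qed

lemma hyperplane_scale: "c \<noteq> 0 \<Longrightarrow> hyperplane (c *s a) = hyperplane a"
  by (simp add: hyperplane_dot dot_scale_left)

lemma hyperplane_eqD:
  assumes "hyperplane a = hyperplane b" "a \<noteq> 0" "b \<noteq> 0"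
  obtains c where "c \<noteq> 0" "b = c *s a"
  using hyperplane_subset[of a b] assms by blast

lemma hyperplane_subset_eq:
  "hyperplane a \<subseteq> hyperplane b \<Longrightarrow> a \<noteq> 0 \<Longrightarrow> b \<noteq> 0 \<Longrightarrow> hyperplane a = hyperplane b"
  by (metis hyperplane_subset hyperplane_scale)

text \<open>As neither hyperplane contains the other, there are y and x dual to a and b up to
  scalars. Subtracting multiples of them projects any z into the intersection, where c vanishes;
  this computes \<open>dot c z\<close>.\<close>

lemma hyperplane_inter_subset:
  fixes a b c :: "'k::field ^ 'n::finite"
  assumes "hyperplane a \<inter> hyperplane b \<subseteq> hyperplane c" "hyperplane a \<noteq> hyperplane b"
    and "a \<noteq> 0" "b \<noteq> 0"
  obtains s t where "c = s *s a + t *s b"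
proof -
  obtain x where x: "dot a x = 0" "dot b x \<noteq> 0"
    using hyperplane_subset_eq[of a b] assms by (auto simp: hyperplane_dot)
  obtain y where y: "dot b y = 0" "dot a y \<noteq> 0"
    using hyperplane_subset_eq[of b a] assms by (auto simp: hyperplane_dot)
  have "dot c z = dot ((dot c y / dot a y) *s a + (dot c x / dot b x) *s b) z" for z
  proof -
    have "z - (dot a z / dot a y) *s y - (dot b z / dot b x) *s x \<in> hyperplane a \<inter> hyperplane b"
      using x y by (simp add: hyperplane_dot dot_diff_right dot_scale_right)
    then have "z - (dot a z / dot a y) *s y - (dot b z / dot b x) *s x \<in> hyperplane c"
      using assms(1) by blast
    then show ?thesis
      by (simp add: hyperplane_dot dot_diff_right dot_scale_right dot_add_left dot_scale_left
          dot_add_right algebra_simps)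
  qed
  then have "c = (dot c y / dot a y) *s a + (dot c x / dot b x) *s b"
    unfolding vec_eq_dot[of c] by blast
  then show thesis by (rule that)
qed

abbreviation apply_form :: "'k::comm_ring_1 ^ 'n::finite \<Rightarrow> ('k, 'n) mpoly ^ 'n \<Rightarrow> ('k, 'n) mpoly" where
  "apply_form a f \<equiv> (\<Sum>i\<in>UNIV. mconst (a $ i) * f $ i)"

definition der :: "('k::comm_ring_1 ^ 'n::finite) set \<Rightarrow> (('k, 'n) mpoly ^ 'n) set" where
  "der \<Phi> = {f. \<forall>a\<in>\<Phi>. linear_form a dvd apply_form a f}"

lemma derivation_module_hyperplanes:
  fixes \<Phi> :: "('k::field ^ 'n::finite) set"
  assumes "0 \<notin> \<Phi>"
  shows "derivation_module (hyperplane ` \<Phi>) = der \<Phi>"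
proof -
  have ap: "apply_derivation f (linear_form a) = apply_form a f"
    for f and a :: "'k ^ 'n"
    by (simp add: apply_derivation_def pdiff_linear_form mult.commute)
  have unit: "mconst c * mconst (inverse c) = (1 :: ('k, 'n) mpoly)" if "c \<noteq> 0" for c :: 'k
    using that by (simp flip: mconst_mult)
  have scale: "linear_form (c *s a) dvd (\<Sum>i\<in>UNIV. mconst ((c *s a) $ i) * f $ i)"
    if "linear_form a dvd apply_form a f" for c a and f :: "('k, 'n) mpoly ^ 'n"
    using that by (simp add: linear_form_scale mconst_mult mult.assoc mult_dvd_mono flip: sum_distrib_left)
  show ?thesis
  proof (intro equalityI subsetI)
    fix f assume f: "f \<in> derivation_module (hyperplane ` \<Phi>)"
    show "f \<in> der \<Phi>" unfolding der_def
    proof (intro CollectI ballI)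
      fix a assume "a \<in> \<Phi>"
      then have "hyperplane a \<in> hyperplane ` \<Phi>" "a \<noteq> 0" using assms by auto
      then show "linear_form a dvd apply_form a f"
        using f unfolding derivation_module_def ap mem_Collect_eq by (elim ballE allE) auto
    qed
  next
    fix f assume f: "f \<in> der \<Phi>"
    show "f \<in> derivation_module (hyperplane ` \<Phi>)" unfolding derivation_module_def ap
    proof (intro CollectI ballI allI impI)
      fix H a assume H: "H \<in> hyperplane ` \<Phi>" "a \<noteq> 0 \<and> H = hyperplane a"
      then obtain b where b: "b \<in> \<Phi>" "H = hyperplane b" by blast
      then have "b \<noteq> 0" using assms by blast
      with b H(2) obtain c where c: "a = c *s b" using hyperplane_eqD[of b a] by auto
      show "linear_form a dvd apply_form a f"
        unfolding c using f b(1) by (intro scale) (simp add: der_def)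
    qed
  qed
qed

lemma subspace_der:
  fixes \<Phi> :: "('k::comm_ring_1 ^ 'n::finite) set"
  shows "module.subspace (*s) (der \<Phi>)"
proof -
  interpret module "(*s) :: ('k, 'n) mpoly \<Rightarrow> ('k, 'n) mpoly ^ 'n \<Rightarrow> ('k, 'n) mpoly ^ 'n"
    by (rule module_vec)
  have s: "(\<Sum>i\<in>UNIV. mconst (a $ i) * (p * f $ i)) = p * apply_form a f"
    for a :: "'k ^ 'n" and p and f :: "('k, 'n) mpoly ^ 'n"
    by (simp add: sum_distrib_left mult.left_commute)
  show ?thesis
    by (rule subspaceI) (auto simp: der_def distrib_left sum.distrib s intro!: dvd_add)
qed

text \<open>A hyperplane is represented by several vectors, here by both signs and in
  \<open>clique_forms\<close> by all nonzero multiples, so that no representative has to be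
  chosen.\<close>

definition graph_forms :: "'n::finite set set \<Rightarrow> ('k::field ^ 'n) set" where
  "graph_forms E = {axis i 1 - axis j 1 | i j. {i, j} \<in> E}"

definition clique_forms :: "'n::finite set set \<Rightarrow> ('k::field ^ 'n) set" where
  "clique_forms E = {a. a \<noteq> 0 \<and> clique E (supp a)}"

lemma simple_graphD: "simple_graph E \<Longrightarrow> {u, v} \<in> E \<Longrightarrow> u \<noteq> v"
  unfolding simple_graph_def by fastforce

lemma graph_forms_nonzero: "simple_graph E \<Longrightarrow> 0 \<notin> graph_forms E"
  unfolding graph_forms_def by (auto dest!: simple_graphD simp: axis_eq_axis)

lemma clique_forms_nonzero: "0 \<notin> clique_forms E"
  by (simp add: clique_forms_def)

lemma graphical_arrangement_eq:
  fixes E :: "'n::finite set set"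
  shows "graphical_arrangement E = hyperplane ` graph_forms E"
proof -
  have h: "{x :: real ^ 'n. x $ i - x $ j = 0} = hyperplane (axis i 1 - axis j 1)" for i j :: 'n
    by (simp add: hyperplane_dot dot_diff_left)
  show ?thesis unfolding graphical_arrangement_def graph_forms_def h by blast
qed

lemma clique_subset: "clique E C \<Longrightarrow> D \<subseteq> C \<Longrightarrow> clique E D"
  unfolding clique_def by blast

lemma q_graphical_arrangement_eq:
  "(q_graphical_arrangement E :: ('k::{field, finite}, 'n::finite) arrangement)
    = hyperplane ` clique_forms E"
proof (intro equalityI subsetI)
  fix H :: "('k ^ 'n) set" assume "H \<in> q_graphical_arrangement E"
  then obtain C a where H: "H = {x. (\<Sum>i\<in>C. a i * x $ i) = 0}" "clique E C" "\<exists>i\<in>C. a i \<noteq> 0"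
    unfolding q_graphical_arrangement_def by blast
  define b where "b = (\<chi> i. if i \<in> C then a i else 0)"
  have "dot b x = (\<Sum>i\<in>C. a i * x $ i)" for x
    unfolding dot_def b_def by (rule sum.mono_neutral_cong_right) auto
  then have "H = hyperplane b" by (simp add: H(1) hyperplane_dot)
  moreover have "supp b \<subseteq> C" by (auto simp: supp_def b_def split: if_splits)
  moreover have "b \<noteq> 0" using H(3) by (auto simp: b_def vec_eq_iff)
  ultimately show "H \<in> hyperplane ` clique_forms E"
    using clique_subset[OF H(2)] by (auto simp: clique_forms_def)
next
  fix H :: "('k ^ 'n) set" assume "H \<in> hyperplane ` clique_forms E"
  then obtain a where a: "H = hyperplane a" "a \<noteq> 0" "clique E (supp a)"
    by (auto simp: clique_forms_def)
  have "dot a x = (\<Sum>i\<in>supp a. a $ i * x $ i)" for x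
    unfolding dot_def by (rule sum.mono_neutral_cong_right) (auto simp: supp_def)
  then have "H = {x. (\<Sum>i\<in>supp a. a $ i * x $ i) = 0}" by (simp add: a(1) hyperplane_dot)
  moreover have "supp a \<noteq> {}" "\<exists>i\<in>supp a. a $ i \<noteq> 0" using a(2) by (auto simp: supp_def vec_eq_iff)
  ultimately show "H \<in> q_graphical_arrangement E"
    unfolding q_graphical_arrangement_def using a(3)
    by (intro CollectI exI[of _ "supp a"] exI[of _ "\<lambda>i. a $ i"]) simp
qed

section \<open>Induced cycles obstruct freeness\<close>

lemma lookup_single_mult:
  fixes p :: "('k::comm_ring_1, 'n) mpoly"
  shows "lookup (Poly_Mapping.single t 1 * p) (t + e) = lookup p e"
    and "(\<And>e'. e \<noteq> t + e') \<Longrightarrow> lookup (Poly_Mapping.single t 1 * p) e = 0"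
proof -
  have p: "p = (\<Sum>m\<in>Poly_Mapping.keys p. Poly_Mapping.single m (lookup p m))"
    by (rule poly_mapping_sum_single) simp_all
  have l: "lookup (Poly_Mapping.single t 1 * p) n
      = (\<Sum>m\<in>Poly_Mapping.keys p. if t + m = n then lookup p m else 0)" for n
    by (subst p) (simp add: sum_distrib_left mult_single lookup_sum lookup_single when_def)
  show "lookup (Poly_Mapping.single t 1 * p) (t + e) = lookup p e"
    unfolding l by (simp add: in_keys_iff)
  show "lookup (Poly_Mapping.single t 1 * p) e = 0" if "\<And>e'. e \<noteq> t + e'"
    unfolding l using that by (intro sum.neutral) auto
qed

text \<open>No power below X^m occurs in P, so the coefficient of X^m in the product meets only the
  constant term of Q. This is what makes the coefficient functionals on the cycle
  semilinear.\<close>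

lemma coeff_mult_monom_dvd:
  fixes P Q :: "'r::comm_ring_1 poly"
  assumes "monom 1 m dvd P"
  shows "coeff (Q * P) m = coeff Q 0 * coeff P m"
proof -
  obtain R where "P = monom 1 m * R" using assms by (elim dvdE)
  then have "coeff P m = coeff R 0" "coeff (Q * P) m = coeff (Q * R) 0"
    by (simp_all add: coeff_monom_mult mult.left_commute[of Q])
  then show ?thesis by (simp add: coeff_mult)
qed

section \<open>Splines on a cycle and their generators\<close>

locale long_cycle =
  fixes c :: "nat \<Rightarrow> 'n::finite" and k m :: nat
  assumes k: "4 \<le> k" and inj: "inj_on c {..<k}" and m: "0 < m"
begin

definition C :: "'n set" where "C = c ` {..<k}"

definition next_ix :: "nat \<Rightarrow> nat" where "next_ix i = (if Suc i = k then 0 else Suc i)"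

definition y :: "nat \<Rightarrow> ('k::field, 'n) mpoly" where "y i = mvar (c i) ^ m"

text \<open>Reduction modulo the prime ideal generated by the cycle variables, with values again in
  the full ring.\<close>

definition kill :: "('k::field, 'n) mpoly \<Rightarrow> ('k, 'n) mpoly" where
  "kill = mpoly_eval.ev mconst (\<lambda>v. if v \<in> C then 0 else mvar v)"

text \<open>Reduction modulo the cycle variables other than \<open>c t\<close>, which survives as
  the variable of a univariate polynomial: coefficient m sees \<open>y t\<close>, and coefficient 0
  is \<open>kill\<close>.\<close>

definition keep :: "nat \<Rightarrow> ('k::field, 'n) mpoly \<Rightarrow> ('k, 'n) mpoly poly" where
  "keep t = mpoly_eval.ev (\<lambda>a. [:mconst a:])
     (\<lambda>v. if v = c t then [:0, 1:] else if v \<in> C then 0 else [:mvar v:])"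

text \<open>The quotients w are part of the data because the functionals are evaluated on
  them.\<close>

definition spline :: "(nat \<Rightarrow> ('k::field, 'n) mpoly) \<Rightarrow> (nat \<Rightarrow> ('k, 'n) mpoly) \<Rightarrow> bool" where
  "spline g w \<longleftrightarrow> (\<forall>i<k. g i - g (next_ix i) = (y i - y (next_ix i)) * w i)"

text \<open>The functionals are semilinear over \<open>kill\<close>, and their matrix on the elements \<open>elt\<close> is triangular
  with units on the diagonal. The index \<open>None\<close> stands for \<open>(y\<^sub>i)\<close>, the vertex \<open>c 0\<close> for \<open>(1, \<dots>, 1)\<close>, the
  other vertices of the cycle for the generators supported there, and \<open>v \<notin> C\<close> for \<open>\<partial>\<^sub>v\<close>.\<close>

definition functional ::
    "'n option \<Rightarrow> ('k::field, 'n) mpoly ^ 'n \<Rightarrow> (nat \<Rightarrow> ('k, 'n) mpoly) \<Rightarrow> (nat \<Rightarrow> ('k, 'n) mpoly)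
      \<Rightarrow> ('k, 'n) mpoly"
  where "functional i f g w = (case i of None \<Rightarrow> kill (w 0)
     | Some v \<Rightarrow> if v \<notin> C then kill (f $ v) else if v = c 0 then kill (g 0)
         else (let j = inv_into {..<k} c v in coeff (keep (if j = 1 then 0 else j) (w j - w 0)) m))"

text \<open>An element supported at one vertex of the cycle has to be divisible by the differences
  along both edges there; the generator is their product. The predecessor is \<open>i - 1\<close>
  because \<open>c 0\<close> has its own branch.\<close>

definition elt_g :: "'n option \<Rightarrow> nat \<Rightarrow> ('k::field, 'n) mpoly" where
  "elt_g o' i = (case o' of None \<Rightarrow> y i
     | Some v \<Rightarrow> if v \<notin> C then 0 else if v = c 0 then 1
         else if v = c i then (y i - y (i - 1)) * (y i - y (next_ix i)) else 0)"

text \<open>The quotients belonging to \<open>elt_g\<close>: on each of the two edges at the vertex,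
  the factor of the other edge remains.\<close>

definition elt_w :: "'n option \<Rightarrow> nat \<Rightarrow> ('k::field, 'n) mpoly" where
  "elt_w o' i = (case o' of None \<Rightarrow> 1
     | Some v \<Rightarrow> if v \<notin> C then 0 else if v = c 0 then 0
         else if v = c i then y i - y (i - 1)
         else if v = c (next_ix i) then y (next_ix i) - y (next_ix (next_ix i)) else 0)"

text \<open>The factor \<open>s\<close> relates f to g on the cycle: it will be 1 for the graphical
  arrangement and the variable itself for the q-deformation.\<close>

definition elt :: "('n \<Rightarrow> ('k::field, 'n) mpoly) \<Rightarrow> 'n option \<Rightarrow> ('k, 'n) mpoly ^ 'n" where
  "elt s o' = (\<chi> u. if u \<in> C then s u * elt_g o' (inv_into {..<k} c u)
     else if o' = Some u then 1 else 0)"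

interpretation kill: mpoly_eval "mconst :: 'k::field \<Rightarrow> ('k, 'n) mpoly" "\<lambda>v. if v \<in> C then 0 else mvar v"
  rewrites "mpoly_eval.ev (mconst :: 'k::field \<Rightarrow> ('k, 'n) mpoly) (\<lambda>v. if v \<in> C then 0 else mvar v) = kill"
  by (rule mconst_hom) (simp add: kill_def)

lemma keep_hom: "mpoly_eval (\<lambda>a. [:mconst a:])"
  by standard (simp_all add: mconst_add mconst_mult one_pCons)

interpretation keep: mpoly_eval "\<lambda>a :: 'k::field. [:mconst a :: ('k, 'n) mpoly:]"
    "\<lambda>v. if v = c t then [:0, 1:] else if v \<in> C then 0 else [:mvar v:]"
  rewrites "mpoly_eval.ev (\<lambda>a :: 'k::field. [:mconst a :: ('k, 'n) mpoly:])
    (\<lambda>v. if v = c t then [:0, 1:] else if v \<in> C then 0 else [:mvar v:]) = keep t" for t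
  by (rule keep_hom) (simp add: keep_def)

section \<open>Cyclic indices and the two reductions\<close>

lemma c_in [simp]: "i < k \<Longrightarrow> c i \<in> C"
  by (simp add: C_def)

lemma c_eq [simp]: "i < k \<Longrightarrow> j < k \<Longrightarrow> c i = c j \<longleftrightarrow> i = j"
  using inj by (auto simp: inj_on_def)

lemma inv_c [simp]: "i < k \<Longrightarrow> inv_into {..<k} c (c i) = i"
  using inj by simp

lemma next_ix_less [simp]: "i < k \<Longrightarrow> next_ix i < k"
  using k by (auto simp: next_ix_def)

lemma next_ix_neq [simp]: "i < k \<Longrightarrow> next_ix i \<noteq> i"
  using k by (auto simp: next_ix_def)

lemma next_ix_3: "i < k \<Longrightarrow> next_ix (next_ix (next_ix i)) \<noteq> i"
  using k by (auto simp: next_ix_def)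

lemma next_ix_mod: "i < k \<Longrightarrow> next_ix i = Suc i mod k"
  by (auto simp: next_ix_def)

lemma prev_ix: "i < k \<Longrightarrow> \<exists>p<k. next_ix p = i"
proof (cases "i = 0")
  case True
  then show ?thesis using k by (intro exI[of _ "k - 1"]) (auto simp: next_ix_def)
next
  case False
  then show "i < k \<Longrightarrow> ?thesis" by (intro exI[of _ "i - 1"]) (auto simp: next_ix_def)
qed

lemma sum_next_ix: "(\<Sum>i<k. f (next_ix i)) = (\<Sum>i<k. f i)"
proof (rule sum.reindex_bij_betw, rule bij_betwI[of _ _ _ "\<lambda>i. if i = 0 then k - 1 else i - 1"])
qed (use k in \<open>auto simp: next_ix_def\<close>)

lemma next_ix_2: "i < k \<Longrightarrow> next_ix (next_ix i) \<noteq> i"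
  using k by (auto simp: next_ix_def)

lemma next_ix_inj: "i < k \<Longrightarrow> j < k \<Longrightarrow> next_ix i = next_ix j \<Longrightarrow> i = j"
  by (auto simp: next_ix_def split: if_splits)

lemma C_cases:
  assumes "v \<in> C"
  obtains j where "j < k" "v = c j"
  using assms unfolding C_def by auto

lemma kill_y [simp]: "i < k \<Longrightarrow> kill (y i) = 0"
  using m by (simp add: y_def kill.ev_simps power_0_left)

lemma keep_y: "i < k \<Longrightarrow> t < k \<Longrightarrow> keep t (y i) = (if i = t then monom 1 m else 0)"
  using m by (simp add: y_def keep.ev_simps monom_altdef power_0_left)

lemma coeff_keep_0:
  fixes p :: "('k::field, 'n) mpoly"
  assumes "t < k"
  shows "coeff (keep t p) 0 = kill p"
proof -
  have "poly (if v = c t then [:0, 1:] else if v \<in> C then 0 else [:mvar v:]) 0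
      = (if v \<in> C then 0 else mvar v :: ('k, 'n) mpoly)" for v
    using assms by simp
  then show ?thesis
    unfolding poly_0_coeff_0[symmetric] keep.ev_def kill.ev_def poly_sum
    by (simp add: poly_prod poly_power)
qed

lemma y_diff_nonzero:
  assumes "i < k" "j < k" "i \<noteq> j"
  shows "y i - y j \<noteq> (0 :: ('k::field, 'n) mpoly)"
proof
  assume "y i - y j = (0 :: ('k, 'n) mpoly)"
  then have "keep i (y i - y j) = (0 :: ('k, 'n) mpoly poly)" by simp
  then show False using assms by (simp add: keep.ev_diff keep_y)
qed

text \<open>Summing the spline condition around the cycle telescopes on one side; a cyclic shift
  turns the other side into the sum of \<open>y (next_ix i) * (w (next_ix i) - w i)\<close>, which
  is therefore 0. If all exponents of e on the cycle are below m, the monomial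
  \<open>y (next_ix j)\<close> times e can occur in the j-th summand only, so
  \<open>w (next_ix j)\<close> and \<open>w j\<close> have the same coefficient at e.\<close>

lemma spline_reduced:
  fixes w :: "nat \<Rightarrow> ('k::field, 'n) mpoly"
  assumes "spline g w" "i < k" and e: "\<forall>v\<in>C. lookup e v < m"
  shows "lookup (w i - w 0) e = 0"
proof -
  have "(\<Sum>i<k. y (next_ix i) * (w (next_ix i) - w i))
      = (\<Sum>i<k. y (next_ix i) * w (next_ix i)) - (\<Sum>i<k. y (next_ix i) * w i)"
    by (simp add: right_diff_distrib sum_subtractf)
  also have "\<dots> = (\<Sum>i<k. (y i - y (next_ix i)) * w i)"
    by (subst sum_next_ix) (simp add: left_diff_distrib sum_subtractf)
  also have "\<dots> = (\<Sum>i<k. g i - g (next_ix i))"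
    using assms(1) by (intro sum.cong) (auto simp: spline_def)
  also have "\<dots> = 0" by (simp add: sum_subtractf sum_next_ix)
  finally have rel: "(\<Sum>i<k. y (next_ix i) * (w (next_ix i) - w i)) = 0" .
  have step: "lookup (w (next_ix j)) e = lookup (w j) e" if "j < k" for j
  proof -
    let ?\<delta> = "\<lambda>i. Poly_Mapping.single (c (next_ix i)) m"
    have y: "y (next_ix i) = Poly_Mapping.single (?\<delta> i) 1" for i
      by (simp add: y_def mvar_power)
    have "lookup (y (next_ix i) * p) (?\<delta> j + e) = 0" if "i < k" "i \<noteq> j" for i p
    proof -
      have "c (next_ix i) \<noteq> c (next_ix j)"
        using that \<open>j < k\<close> next_ix_inj by auto
      then have "lookup (?\<delta> j + e) (c (next_ix i)) < m"
        using e that by (simp add: lookup_add lookup_single)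
      then have "?\<delta> j + e \<noteq> ?\<delta> i + e'" for e'
        by (metis lookup_add lookup_single_eq not_add_less1)
      then show ?thesis unfolding y by (rule lookup_single_mult)
    qed
    then have "lookup (\<Sum>i<k. y (next_ix i) * (w (next_ix i) - w i)) (?\<delta> j + e)
        = lookup (y (next_ix j) * (w (next_ix j) - w j)) (?\<delta> j + e)"
      unfolding lookup_sum using that by (subst sum.remove[of _ j]) (auto intro!: sum.neutral)
    also have "\<dots> = lookup (w (next_ix j) - w j) e"
      unfolding y by (rule lookup_single_mult)
    finally show ?thesis unfolding rel by (simp add: lookup_minus)
  qed
  have "lookup (w i) e = lookup (w 0) e"
    using assms(2)
  proof (induct i)
    case (Suc i)
    then show ?case using step[of i] by (simp add: next_ix_def)
  qed simp
  then show ?thesis by (simp add: lookup_minus)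
qed

text \<open>The hypothesis puts p into the ideal generated by the m-th powers of the cycle
  variables, and \<open>keep t\<close> sends these powers to X^m or 0.\<close>

lemma monom_dvd_keep:
  fixes p :: "('k::field, 'n) mpoly"
  assumes "\<And>e. \<forall>v\<in>C. lookup e v < m \<Longrightarrow> lookup p e = 0"
  shows "monom 1 m dvd keep t p"
  unfolding keep.ev_def
proof (rule dvd_sum)
  fix e assume "e \<in> Poly_Mapping.keys p"
  then obtain v where v: "v \<in> C" "m \<le> lookup e v"
    using assms[of e] by (metis in_keys_iff not_le)
  let ?h = "\<lambda>v. if v = c t then [:0, 1:] else if v \<in> C then 0 else [:mvar v :: ('k, 'n) mpoly:]"
  have "monom 1 m dvd [:0, 1 :: ('k, 'n) mpoly:] ^ lookup e v"
    unfolding monom_altdef using v(2) by (simp add: le_imp_power_dvd)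
  then have "monom 1 m dvd ?h v ^ lookup e v"
    using v m by (auto simp: power_0_left)
  also have "\<dots> dvd (\<Prod>i\<in>UNIV. ?h i ^ lookup e i)" by (rule dvd_prodI) auto
  finally show "monom 1 m dvd [:mconst (lookup p e):] * (\<Prod>i\<in>UNIV. ?h i ^ lookup e i)"
    by (rule dvd_mult)
qed

lemma spline_keep_dvd: "spline g w \<Longrightarrow> i < k \<Longrightarrow> monom 1 m dvd keep t (w i - w 0)"
  by (rule monom_dvd_keep) (rule spline_reduced)

lemma inv_less: "v \<in> C \<Longrightarrow> inv_into {..<k} c v < k"
  unfolding C_def using inv_into_into[of v c "{..<k}"] by auto

text \<open>Since \<open>keep\<close> of \<open>w b j - w b 0\<close> is divisible by X^m, its
  coefficient there meets only the constant term of \<open>keep (r b)\<close>, which is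
  \<open>kill (r b)\<close>.\<close>

lemma functional_semilinear:
  fixes g :: "'b \<Rightarrow> nat \<Rightarrow> ('k::field, 'n) mpoly"
  assumes sp: "\<And>b. b \<in> B \<Longrightarrow> spline (g b) (w b)"
    and f: "\<And>v. v \<notin> C \<Longrightarrow> f' $ v = (\<Sum>b\<in>B. r b * f b $ v)"
    and g: "g' 0 = (\<Sum>b\<in>B. r b * g b 0)"
    and w: "\<And>i. i < k \<Longrightarrow> w' i = (\<Sum>b\<in>B. r b * w b i)"
  shows "functional i f' g' w' = (\<Sum>b\<in>B. kill (r b) * functional i (f b) (g b) (w b))"
proof (cases "\<exists>v. i = Some v \<and> v \<in> C \<and> v \<noteq> c 0")
  case True
  then obtain v where v: "i = Some v" "v \<in> C" "v \<noteq> c 0" by blast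
  define j where "j = inv_into {..<k} c v"
  define t where "t = (if j = 1 then 0 else j)"
  have "j < k" "t < k" "0 < k" using inv_less[OF v(2)] k by (auto simp: j_def t_def)
  have "w' j - w' 0 = (\<Sum>b\<in>B. r b * (w b j - w b 0))"
    using w[OF \<open>j < k\<close>] w[OF \<open>0 < k\<close>] by (simp add: right_diff_distrib sum_subtractf)
  then have "coeff (keep t (w' j - w' 0)) m = (\<Sum>b\<in>B. coeff (keep t (r b) * keep t (w b j - w b 0)) m)"
    by (simp add: keep.ev_sum keep.ev_mult coeff_sum)
  also have "\<dots> = (\<Sum>b\<in>B. kill (r b) * coeff (keep t (w b j - w b 0)) m)"
    using spline_keep_dvd[OF sp \<open>j < k\<close>, of _ t] \<open>t < k\<close>
    by (intro sum.cong) (simp_all add: coeff_mult_monom_dvd coeff_keep_0)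
  finally have "coeff (keep t (w' j - w' 0)) m = (\<Sum>b\<in>B. kill (r b) * coeff (keep t (w b j - w b 0)) m)" .
  moreover have "functional i f g w = coeff (keep t (w j - w 0)) m" for f :: "('k, 'n) mpoly ^ 'n" and g w
    using v by (simp add: functional_def Let_def t_def j_def)
  ultimately show ?thesis by simp
next
  case False
  then show ?thesis using f g w[of 0] k
    by (auto simp: functional_def kill.ev_sum kill.ev_mult split: option.split)
qed

lemma spline_elt: "spline (elt_g i) (elt_w i :: nat \<Rightarrow> ('k::field, 'n) mpoly)"
proof -
  have "(elt_g i j :: ('k, 'n) mpoly) - elt_g i (next_ix j)
    = (y j - y (next_ix j)) * elt_w i j" if j: "j < k" for j
  proof (cases "\<exists>v. i = Some v \<and> v \<in> C \<and> v \<noteq> c 0")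
    case True
    then obtain a where a: "i = Some (c a)" "a < k" "a \<noteq> 0" by (auto simp: C_def)
    consider "a = j" | "a = next_ix j" | "a \<noteq> j" "a \<noteq> next_ix j" by blast
    then show ?thesis
    proof cases
      case 1 then show ?thesis using a j next_ix_neq[OF j] k
        by (simp add: elt_g_def elt_w_def algebra_simps)
    next
      case 2
      then have "j = a - 1" using a j by (auto simp: next_ix_def split: if_splits)
      then show ?thesis using 2 a j next_ix_neq[OF j] k by (simp add: elt_g_def elt_w_def algebra_simps)
    next
      case 3 then show ?thesis using a j k by (simp add: elt_g_def elt_w_def)
    qed
  next
    case False
    then show ?thesis by (auto simp: elt_g_def elt_w_def split: option.split)
  qed
  then show ?thesis by (simp add: spline_def)
qed

lemma elt_independent:
  fixes s :: "'n option \<Rightarrow> ('k::field, 'n) mpoly"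
  assumes zero: "\<And>i. (\<Sum>o'\<in>UNIV. s o' * functional i (elt S o') (elt_g o') (elt_w o')) = 0"
  shows "s o' = 0"
proof -
  let ?F = "\<lambda>i o'. functional i (elt S o') (elt_g o') (elt_w o') :: ('k, 'n) mpoly"
  \<comment> \<open>Reads off one row of the matrix: the diagonal entry is a unit, and every other
    term vanishes by its entry or by a coefficient already known to be 0.\<close>
  have single: "s p = 0" if "?F i p = 1 \<or> ?F i p = - 1" and "\<And>q. q \<noteq> p \<Longrightarrow> s q = 0 \<or> ?F i q = 0" for i p
  proof -
    have "(\<Sum>o'\<in>UNIV. s o' * ?F i o') = s p * ?F i p + (\<Sum>o'\<in>UNIV - {p}. s o' * ?F i o')"
      by (rule sum.remove) auto
    also have "(\<Sum>o'\<in>UNIV - {p}. s o' * ?F i o') = 0"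
      using that(2) by (intro sum.neutral ballI) (metis DiffD2 insertI1 mult_zero_left mult_zero_right)
    finally show ?thesis using zero[of i] that(1) by auto
  qed
  have k0: "0 < k" "1 < k" "2 < k" "3 < k" using k by auto
  have nx: "next_ix 0 = Suc 0" "next_ix (Suc 0) = 2" "next_ix 2 = 3" using k by (auto simp: next_ix_def)
  have cases: "q = None \<or> (\<exists>v. q = Some v \<and> v \<notin> C) \<or> (\<exists>j<k. q = Some (c j))" for q
    by (cases q) (auto simp: C_def)
  have None: "s None = 0"
  proof (rule single[of None])
    show "?F None None = 1 \<or> ?F None None = - 1"
      by (simp add: functional_def elt_w_def)
    show "s q = 0 \<or> ?F None q = 0" if "q \<noteq> None" for q
      using that k0 by (auto simp: functional_def elt_w_def nx kill.ev_simps split: if_splits option.split)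
  qed
  have out: "s (Some v) = 0" if "v \<notin> C" for v
  proof (rule single[of "Some v"])
    show "?F (Some v) (Some v) = 1 \<or> ?F (Some v) (Some v) = - 1"
      using that by (simp add: functional_def elt_def)
    show "s q = 0 \<or> ?F (Some v) q = 0" if "q \<noteq> Some v" for q
      using \<open>v \<notin> C\<close> that by (auto simp: functional_def elt_def)
  qed
  have c0: "s (Some (c 0)) = 0"
  proof (rule single[of "Some (c 0)"])
    show "?F (Some (c 0)) (Some (c 0)) = 1 \<or> ?F (Some (c 0)) (Some (c 0)) = - 1"
      using k0 by (simp add: functional_def elt_g_def)
    show "s q = 0 \<or> ?F (Some (c 0)) q = 0" if "q \<noteq> Some (c 0)" for q
      using cases[of q] that k0 by (auto simp: functional_def elt_g_def None split: if_splits)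
  qed
  have F: "?F (Some (c j)) (Some (c a)) = coeff (keep (if j = 1 then 0 else j)
      (elt_w (Some (c a)) j - elt_w (Some (c a)) 0)) m"
    if "j < k" "j \<noteq> 0" for j a
    using that k0 by (simp add: functional_def Let_def)
  \<comment> \<open>In this row \<open>y 1\<close> cancels from the diagonal entry,
    \<open>w 1 - w 0 = y 2 - y 0\<close>; hence the choice of \<open>keep 0\<close> for
    \<open>j = 1\<close> in \<open>functional\<close>. The generator at \<open>c 2\<close> enters
    with \<open>w 1 = y 2 - y 3\<close>, which \<open>keep 0\<close> annihilates because
    \<open>k \<ge> 4\<close> makes the index 3 different from 0.\<close>
  have c1: "s (Some (c 1)) = 0"
  proof (rule single[of "Some (c 1)"])
    show "?F (Some (c 1)) (Some (c 1)) = 1 \<or> ?F (Some (c 1)) (Some (c 1)) = - 1"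
      using k0 by (simp add: F elt_w_def nx keep.ev_simps keep_y)
    show "s q = 0 \<or> ?F (Some (c 1)) q = 0" if "q \<noteq> Some (c 1)" for q
    proof -
      have "?F (Some (c 1)) (Some (c a)) = 0" if "a < k" "2 \<le> a" for a
        using that k0 by (simp add: F elt_w_def nx keep.ev_simps keep_y)
      moreover have "a = 0 \<or> a = 1 \<or> 2 \<le> a" for a :: nat by linarith
      ultimately show ?thesis using cases[of q] that None out c0 by metis
    qed
  qed
  \<comment> \<open>Row \<open>c 2\<close> meets the generator at \<open>c 1\<close> through
    \<open>w 0\<close>, so \<open>c 1\<close> had to be settled before.\<close>
  have cj: "s (Some (c j)) = 0" if j: "j < k" "2 \<le> j" for j
  proof (rule single[of "Some (c j)"])
    show "?F (Some (c j)) (Some (c j)) = 1 \<or> ?F (Some (c j)) (Some (c j)) = - 1"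
    proof -
      have "j - 1 \<noteq> j" using j by simp
      then show ?thesis using k0 j by (simp add: F elt_w_def nx keep.ev_simps keep_y)
    qed
    show "s q = 0 \<or> ?F (Some (c j)) q = 0" if "q \<noteq> Some (c j)" for q
    proof -
      have "?F (Some (c j)) (Some (c a)) = 0" if "a < k" "2 \<le> a" "a \<noteq> j" for a
      proof -
        have "next_ix (next_ix j) \<noteq> j" using j k by (auto simp: next_ix_def split: if_splits)
        then show ?thesis using that k0 j by (simp add: F elt_w_def nx keep.ev_simps keep_y)
      qed
      moreover have "a = 0 \<or> a = 1 \<or> 2 \<le> a" for a :: nat by linarith
      ultimately show ?thesis using cases[of q] that None out c0 c1 by metis
    qed
  qed
  show ?thesis
    using cases[of o'] None out c0 c1 cj by (metis One_nat_def Suc_1 less_2_cases not_le)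
qed

text \<open>The \<open>CARD('n) + 1\<close> elements \<open>h *s elt s o'\<close> are expanded in a
  basis, and a relation t holds among their coefficients modulo the cycle variables. Semilinearity
  carries it to the values of the functionals, where \<open>kill h\<close> cancels and
  \<open>elt_independent\<close> forces t to be 0. The last two hypotheses say that, up to h, the
  module is described on the cycle by splines.\<close>

theorem not_free:
  fixes M :: "(('k::field, 'n) mpoly ^ 'n) set"
  assumes free: "free_submodule M" and s: "\<And>v. s v \<noteq> 0" and h: "kill h \<noteq> 0"
    and M: "\<And>f. f \<in> M \<Longrightarrow> \<exists>g w. spline g w \<and> (\<forall>i<k. f $ c i = s (c i) * g i)"
    and M': "\<And>f g w. spline g w \<Longrightarrow> (\<And>i. i < k \<Longrightarrow> f $ c i = s (c i) * g i) \<Longrightarrow> h *s f \<in> M"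
  shows False
proof -
  note nzd = mpoly_no_zero_divisors[where 'k = 'k and 'n = 'n]
  have elt_c: "elt s o' $ c i = s (c i) * elt_g o' i" if "i < k" for i o'
    using that by (simp add: elt_def)
  have "h *s elt s o' \<in> M" for o' by (rule M'[OF spline_elt elt_c])
  then obtain B r t where B: "finite B" "B \<subseteq> M"
    and r: "\<And>o'. h *s elt s o' = (\<Sum>b\<in>B. r o' b *s b)"
    and t: "\<exists>o'. t o' \<noteq> 0" "\<And>b. b \<in> B \<Longrightarrow> (\<Sum>o'\<in>UNIV. t o' * kill (r o' b)) = 0"
    using free_submodule_relation[OF nzd free, of "UNIV :: 'n option set" "\<lambda>o'. h *s elt s o'" kill thesis]
    by auto
  have "\<forall>b\<in>B. \<exists>g w. spline g w \<and> (\<forall>i<k. b $ c i = s (c i) * g i)" using M B(2) by blast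
  then obtain g w where gw: "\<And>b. b \<in> B \<Longrightarrow> spline (g b) (w b)"
    "\<And>b i. b \<in> B \<Longrightarrow> i < k \<Longrightarrow> b $ c i = s (c i) * g b i" by metis
  have rv: "h * elt s o' $ v = (\<Sum>b\<in>B. r o' b * b $ v)" for o' v
    using arg_cong[OF r[of o'], of "\<lambda>x. x $ v"] by (simp add: vec_sum_nth)
  have g: "h * elt_g o' i = (\<Sum>b\<in>B. r o' b * g b i)" if "i < k" for o' i
  proof (rule mpoly_mult_cancel[OF _ s])
    have "(\<Sum>b\<in>B. r o' b * b $ c i) = (\<Sum>b\<in>B. s (c i) * (r o' b * g b i))"
      using gw(2) that by (intro sum.cong) (simp_all add: mult.left_commute)
    then show "s (c i) * (h * elt_g o' i) = s (c i) * (\<Sum>b\<in>B. r o' b * g b i)"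
      using rv[of o' "c i"] elt_c[OF that, of o'] by (simp add: sum_distrib_left mult.left_commute)
  qed
  have w: "h * elt_w o' i = (\<Sum>b\<in>B. r o' b * w b i)" if i: "i < k" for o' i
  proof (rule mpoly_mult_cancel)
    show "y i - y (next_ix i) \<noteq> (0 :: ('k, 'n) mpoly)"
      using y_diff_nonzero[OF i next_ix_less[OF i]] next_ix_neq[OF i] by metis
    have "(y i - y (next_ix i)) * (h * elt_w o' i) = h * ((y i - y (next_ix i)) * elt_w o' i)"
      by (rule mult.left_commute)
    also have "\<dots> = h * elt_g o' i - h * elt_g o' (next_ix i)"
      using spline_elt[of o'] i by (metis right_diff_distrib spline_def)
    also have "\<dots> = (\<Sum>b\<in>B. r o' b * (g b i - g b (next_ix i)))"
      using g i by (simp add: sum_subtractf right_diff_distrib)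
    also have "\<dots> = (\<Sum>b\<in>B. r o' b * ((y i - y (next_ix i)) * w b i))"
      using gw(1) i by (intro sum.cong) (simp_all add: spline_def)
    finally show "(y i - y (next_ix i)) * (h * elt_w o' i) = (y i - y (next_ix i)) * (\<Sum>b\<in>B. r o' b * w b i)"
      by (simp add: sum_distrib_left mult.left_commute)
  qed
  have "t o' = 0" for o'
  proof (rule elt_independent[of t s])
    fix i
    let ?F = "\<lambda>o'. functional i (elt s o') (elt_g o') (elt_w o')"
    have F: "kill h * ?F o' = (\<Sum>b\<in>B. kill (r o' b) * functional i b (g b) (w b))" for o'
    proof -
      have "functional i (h *s elt s o') (\<lambda>i. h * elt_g o' i) (\<lambda>i. h * elt_w o' i)
          = (\<Sum>b\<in>B. kill (r o' b) * functional i b (g b) (w b))"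
        using k by (intro functional_semilinear) (simp_all add: gw rv g w)
      moreover have "functional i (h *s elt s o') (\<lambda>i. h * elt_g o' i) (\<lambda>i. h * elt_w o' i)
          = (\<Sum>b\<in>{()}. kill h * functional i (elt s o') (elt_g o') (elt_w o'))"
        by (intro functional_semilinear) (simp_all add: spline_elt)
      ultimately show ?thesis by simp
    qed
    have "kill h * (\<Sum>o'\<in>UNIV. t o' * ?F o') = (\<Sum>o'\<in>UNIV. t o' * (kill h * ?F o'))"
      by (simp add: sum_distrib_left mult.left_commute)
    also have "\<dots> = (\<Sum>o'\<in>UNIV. \<Sum>b\<in>B. (t o' * kill (r o' b)) * functional i b (g b) (w b))"
      by (simp add: F sum_distrib_left mult.assoc)
    also have "\<dots> = (\<Sum>b\<in>B. (\<Sum>o'\<in>UNIV. t o' * kill (r o' b)) * functional i b (g b) (w b))"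
      by (subst sum.swap) (simp add: sum_distrib_right)
    also have "\<dots> = 0" using t(2) by simp
    finally show "(\<Sum>o'\<in>UNIV. t o' * ?F o') = 0" using nzd h by blast
  qed
  then show False using t(1) by blast
qed

lemma kill_linear_form: "kill (linear_form a) = linear_form (\<chi> i. if i \<in> C then 0 else a $ i)"
  unfolding linear_form_eq by (auto simp: kill.ev_simps intro!: sum.cong)

text \<open>A form not supported on the cycle keeps a nonzero part under \<open>kill\<close>. The
  factor h, the product of all of these, makes their conditions automatic, so only the forms
  supported on the cycle remain to be analysed.\<close>

lemma not_free_der:
  fixes \<Phi> :: "('k::field ^ 'n) set"
  assumes fin: "finite \<Phi>" and s: "\<And>v. s v \<noteq> 0"
    and M: "\<And>f. (\<And>a. a \<in> \<Phi> \<Longrightarrow> supp a \<subseteq> C \<Longrightarrow> linear_form a dvd apply_form a f)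
      \<Longrightarrow> \<exists>g w. spline g w \<and> (\<forall>i<k. f $ c i = s (c i) * g i)"
    and M': "\<And>f g w a. spline g w \<Longrightarrow> (\<And>i. i < k \<Longrightarrow> f $ c i = s (c i) * g i) \<Longrightarrow> a \<in> \<Phi> \<Longrightarrow> supp a \<subseteq> C
      \<Longrightarrow> linear_form a dvd apply_form a f"
  shows "\<not> free_submodule (der \<Phi>)"
proof
  assume free: "free_submodule (der \<Phi>)"
  define h where "h = (\<Prod>a\<in>{a \<in> \<Phi>. \<not> supp a \<subseteq> C}. linear_form a)"
  show False
  proof (rule not_free[OF free s])
    show "kill h \<noteq> 0" unfolding h_def kill.ev_prod
      by (intro mpoly_prod_nonzero) (auto simp: kill_linear_form supp_def vec_eq_iff)
    show "\<exists>g w. spline g w \<and> (\<forall>i<k. f $ c i = s (c i) * g i)" if "f \<in> der \<Phi>" for f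
      using that by (intro M) (simp add: der_def)
    show "h *s f \<in> der \<Phi>" if "spline g w" "\<And>i. i < k \<Longrightarrow> f $ c i = s (c i) * g i" for f g w
      unfolding der_def
    proof (intro CollectI ballI)
      fix a assume a: "a \<in> \<Phi>"
      have "linear_form a dvd h * apply_form a f"
      proof (cases "supp a \<subseteq> C")
        case True
        show ?thesis by (rule dvd_mult) (rule M'[OF that(1) that(2) a True])
      next
        case False
        then have "linear_form a dvd h" unfolding h_def using a fin by (intro dvd_prodI) auto
        then show ?thesis by (rule dvd_mult2)
      qed
      then show "linear_form a dvd (\<Sum>i\<in>UNIV. mconst (a $ i) * (h *s f) $ i)"
        by (simp add: sum_distrib_left mult.left_commute)
    qed
  qed
qed

end

section \<open>Finite fields\<close>

lemma card_field_ge_2: "2 \<le> CARD('k::{field, finite})"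
  using card_mono[of "UNIV :: 'k set" "{0, 1}"] by simp

lemma finite_field_power_eq_1:
  fixes x :: "'k::{field, finite}"
  assumes "x \<noteq> 0"
  shows "x ^ (CARD('k) - 1) = 1"
proof -
  have "(\<Prod>y\<in>UNIV - {0}. x * y) = (\<Prod>y\<in>UNIV - {0}. y)"
    by (rule prod.reindex_bij_witness[of _ "\<lambda>y. y / x" "\<lambda>y. x * y"]) (use assms in auto)
  then have "x ^ (CARD('k) - 1) * \<Prod>(UNIV - {0}) = 1 * \<Prod>(UNIV - {0 :: 'k})"
    by (simp add: prod.distrib)
  moreover have "\<Prod>(UNIV - {0 :: 'k}) \<noteq> 0" by simp
  ultimately show ?thesis by (rule mult_right_cancel[THEN iffD1, rotated])
qed

lemma degree_prod_linear:
  "degree (\<Prod>t\<in>T. [:- t, 1:] :: 'k::idom poly) = card T"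
  by (induct T rule: infinite_finite_induct) (simp_all add: degree_mult_eq del: mult_pCons_left)

text \<open>Both sides are monic of degree \<open>CARD('k) - 1\<close> and vanish at every nonzero
  element of the field.\<close>

lemma prod_linear_nonzero_field:
  "(\<Prod>t\<in>UNIV - {0}. [:- t, 1:]) = monom 1 (CARD('k) - 1) - (1 :: 'k::{field, finite} poly)"
proof (rule poly_eqI_degree_lead_coeff[where A = "UNIV - {0}"])
  let ?m = "CARD('k) - 1"
  have m: "0 < ?m" using card_field_ge_2[where 'k = 'k] by simp
  have c: "card (UNIV - {0 :: 'k}) = ?m" by (simp add: card_Diff_singleton)
  have "lead_coeff (\<Prod>t\<in>T. [:- t, 1:] :: 'k poly) = 1" for T
    by (simp add: lead_coeff_prod)
  from this[of "UNIV - {0}"]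
  show "coeff (\<Prod>t\<in>UNIV - {0}. [:- t, 1:]) ?m = coeff (monom 1 ?m - (1 :: 'k poly)) ?m"
    using m unfolding degree_prod_linear c by simp
  show "degree (\<Prod>t\<in>UNIV - {0 :: 'k}. [:- t, 1:]) \<le> ?m" unfolding degree_prod_linear c ..
  show "degree (monom 1 ?m - (1 :: 'k poly)) \<le> ?m"
    by (intro degree_diff_le) (simp_all add: degree_monom_le)
  show "poly (\<Prod>t\<in>UNIV - {0}. [:- t, 1:]) z = poly (monom 1 ?m - 1) z" if "z \<in> UNIV - {0 :: 'k}" for z
  proof -
    have "poly (\<Prod>t\<in>UNIV - {0}. [:- t, 1:]) z = 0" using that by (auto simp: poly_prod)
    then show ?thesis using that finite_field_power_eq_1[of z] by (simp add: poly_monom)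
  qed
qed (simp add: card_Diff_singleton)

text \<open>Homogenization carries the polynomial identity over to the ring of multivariate polynomials.\<close>

lemma prod_linear_homogeneous:
  fixes A B :: "('k::field, 'n::finite) mpoly"
  assumes "finite T"
  shows "(\<Prod>t\<in>T. A - mconst t * B)
    = (\<Sum>j\<le>card T. mconst (coeff (\<Prod>t\<in>T. [:- t, 1:]) j) * A ^ j * B ^ (card T - j))"
  using assms
proof (induct T)
  case (insert t T)
  let ?n = "card T" and ?p = "\<Prod>t\<in>T. [:- t, 1:] :: 'k poly"
  define f :: "nat \<Rightarrow> ('k, 'n) mpoly" where "f j = mconst (coeff ?p j)" for j
  have top: "f (Suc ?n) = 0" unfolding f_def by (simp add: coeff_eq_0 degree_prod_linear)
  have c: "mconst (coeff ([:- t, 1:] * ?p) j)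
      = (case j of 0 \<Rightarrow> 0 | Suc i \<Rightarrow> f i) - mconst t * f j" for j
    by (simp add: f_def coeff_pCons mconst_diff mconst_mult mconst_uminus mconst_add split: nat.split)
  have "(\<Sum>j\<le>Suc ?n. mconst (coeff ([:- t, 1:] * ?p) j) * A ^ j * B ^ (Suc ?n - j))
      = (\<Sum>j\<le>Suc ?n. (case j of 0 \<Rightarrow> 0 | Suc i \<Rightarrow> f i) * A ^ j * B ^ (Suc ?n - j))
        - (\<Sum>j\<le>Suc ?n. mconst t * f j * A ^ j * B ^ (Suc ?n - j))"
    unfolding c by (simp add: left_diff_distrib sum_subtractf del: sum.atMost_Suc)
  also have "(\<Sum>j\<le>Suc ?n. (case j of 0 \<Rightarrow> 0 | Suc i \<Rightarrow> f i) * A ^ j * B ^ (Suc ?n - j))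
      = A * (\<Sum>j\<le>?n. f j * A ^ j * B ^ (?n - j))"
    by (subst sum.atMost_Suc_shift) (simp add: sum_distrib_left algebra_simps)
  also have "(\<Sum>j\<le>Suc ?n. mconst t * f j * A ^ j * B ^ (Suc ?n - j))
      = mconst t * B * (\<Sum>j\<le>?n. f j * A ^ j * B ^ (?n - j))"
    using top by (simp add: sum_distrib_left Suc_diff_le algebra_simps)
  finally show ?case using insert by (simp add: f_def left_diff_distrib)
qed simp

lemma prod_linear_nonzero:
  fixes A B :: "('k::{field, finite}, 'n::finite) mpoly"
  shows "(\<Prod>t\<in>UNIV - {0}. A - mconst t * B) = A ^ (CARD('k) - 1) - B ^ (CARD('k) - 1)"
proof -
  let ?m = "CARD('k) - 1"
  have m: "0 < ?m" using card_field_ge_2[where 'k = 'k] by simp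
  have c: "coeff (monom 1 ?m - (1 :: 'k poly)) j
      = (if j = ?m then 1 else 0) - (if j = 0 then 1 else 0)" for j
    by (auto simp: coeff_1)
  have "(\<Prod>t\<in>UNIV - {0}. A - mconst t * B)
      = (\<Sum>j\<le>?m. (if j = ?m then A ^ j * B ^ (?m - j) else 0) - (if j = 0 then A ^ j * B ^ (?m - j) else 0))"
    by (subst prod_linear_homogeneous, simp)
      (auto simp: prod_linear_nonzero_field card_Diff_singleton c mconst_diff intro!: sum.cong)
  then show ?thesis by (simp add: sum_subtractf)
qed

lemma prod_linear_field:
  fixes A B :: "('k::{field, finite}, 'n::finite) mpoly"
  shows "(\<Prod>t\<in>UNIV. A + mconst t * B) = A ^ CARD('k) - A * B ^ (CARD('k) - 1)"
proof -
  have "(\<Prod>t\<in>UNIV. A + mconst t * B) = (\<Prod>t\<in>UNIV. A - mconst t * B)"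
    by (rule prod.reindex_bij_witness[of _ uminus uminus]) (simp_all add: mconst_uminus)
  also have "\<dots> = A * (\<Prod>t\<in>UNIV - {0}. A - mconst t * B)"
    by (subst prod.remove[of _ 0]) simp_all
  also have "\<dots> = A ^ Suc (CARD('k) - 1) - A * B ^ (CARD('k) - 1)"
    unfolding prod_linear_nonzero right_diff_distrib power_Suc ..
  also have "Suc (CARD('k) - 1) = CARD('k)" using card_field_ge_2[where 'k = 'k] by simp
  finally show ?thesis .
qed

lemma CHAR_dvd_card_field: "CHAR('k::{field, finite}) dvd CARD('k)"
proof -
  have "(\<Sum>x\<in>(UNIV :: 'k set). x + 1) = (\<Sum>x\<in>UNIV. x)"
    by (rule sum.reindex_bij_witness[of _ "\<lambda>x. x - 1" "\<lambda>x. x + 1"]) auto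
  then have "of_nat (CARD('k)) = (0 :: 'k)" by (simp add: sum.distrib)
  then show ?thesis by (simp add: of_nat_eq_0_iff_char_dvd)
qed

text \<open>The polynomial ring inherits the characteristic of the field, a prime dividing
  \<open>CARD('k)\<close> and therefore the prime of which \<open>CARD('k)\<close> is a
  power.\<close>

lemma mpoly_frobenius_add:
  fixes p p' :: "('k::{field, finite}, 'n::finite) mpoly"
  assumes "primepow (CARD('k))"
  shows "(p + p') ^ CARD('k) = p ^ CARD('k) + p' ^ CARD('k)"
proof -
  obtain r n where r: "prime r" "CARD('k) = r ^ n" using assms by (auto simp: primepow_def)
  have "CHAR('k) > 0" by (rule finite_imp_CHAR_pos) simp
  then have "prime CHAR('k)" by (rule prime_CHAR_semidom)
  then have "CHAR('k) = r"
    using CHAR_dvd_card_field[where 'k = 'k] r prime_dvd_power primes_dvd_imp_eq by metis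
  moreover have "CHAR(('k, 'n) mpoly) = CHAR('k)"
  proof (rule CHAR_eqI)
    have l: "(of_nat n :: ('k, 'n) mpoly) = mconst (of_nat n)" for n by (simp add: mconst_def)
    then show "of_nat CHAR('k) = (0 :: ('k, 'n) mpoly)" by simp
    fix n assume "of_nat n = (0 :: ('k, 'n) mpoly)"
    then have "mconst (of_nat n) = (mconst 0 :: ('k, 'n) mpoly)" unfolding l by simp
    then have "of_nat n = (0 :: 'k)" unfolding mconst_def by (metis lookup_single_eq)
    then show "CHAR('k) dvd n" by (simp add: of_nat_eq_0_iff_char_dvd)
  qed
  ultimately show ?thesis using r by (intro freshmans_dream') auto
qed

section \<open>Freeness implies chordality\<close>

lemma not_chordal_cycle:
  assumes "\<not> chordal E"
  obtains c k where "4 \<le> k" "inj_on c {..<k}"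
    "\<And>i j. i < k \<Longrightarrow> j < k \<Longrightarrow> {c i, c j} \<in> E \<longleftrightarrow> j = Suc i mod k \<or> i = Suc j mod k"
proof -
  obtain cs where cs: "distinct cs" "4 \<le> length cs" "induced E (set cs) = cycle_edges cs"
    using assms unfolding chordal_def by blast
  let ?k = "length cs"
  have eq: "cs ! i = cs ! j \<longleftrightarrow> i = j" if "i < ?k" "j < ?k" for i j
    using nth_eq_iff_index_eq[OF cs(1) that] .
  have md: "Suc i mod ?k < ?k" for i using cs(2) by (intro mod_less_divisor) linarith
  have "{cs ! i, cs ! j} \<in> E \<longleftrightarrow> j = Suc i mod ?k \<or> i = Suc j mod ?k" if ij: "i < ?k" "j < ?k" for i j
  proof -
    have "{cs ! i, cs ! j} \<in> E \<longleftrightarrow> {cs ! i, cs ! j} \<in> cycle_edges cs"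
      using ij unfolding cs(3)[symmetric] induced_def by auto
    also have "\<dots> \<longleftrightarrow> (\<exists>l<?k. {cs ! i, cs ! j} = {cs ! l, cs ! (Suc l mod ?k)})"
      unfolding cycle_edges_def by auto
    also have "\<dots> \<longleftrightarrow> (\<exists>l<?k. i = l \<and> j = Suc l mod ?k \<or> i = Suc l mod ?k \<and> j = l)"
      using eq[OF ij(1)] eq[OF ij(2)] md unfolding doubleton_eq_iff by metis
    also have "\<dots> \<longleftrightarrow> j = Suc i mod ?k \<or> i = Suc j mod ?k" using ij by blast
    finally show ?thesis .
  qed
  moreover have "inj_on ((!) cs) {..<?k}" using cs(1) by (simp add: inj_on_nth)
  ultimately show thesis using that[OF cs(2)] by blast
qed

lemma finite_graph_forms: "finite (graph_forms (E :: 'n::finite set set))"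
proof -
  have "graph_forms E \<subseteq> (\<lambda>(i, j). axis i 1 - axis j 1) ` UNIV" by (auto simp: graph_forms_def)
  then show ?thesis by (rule finite_subset) simp
qed

lemma sum_two_support:
  fixes a :: "'k::field ^ 'n::finite"
  assumes "supp a \<subseteq> {u, v}" "u \<noteq> v"
  shows "(\<Sum>i\<in>UNIV. mconst (a $ i) * f i) = mconst (a $ u) * f u + mconst (a $ v) * (f v :: ('k, 'n) mpoly)"
proof -
  have "a $ i = 0" if "i \<notin> {u, v}" for i using assms(1) that by (auto simp: supp_def)
  then have "(\<Sum>i\<in>UNIV. mconst (a $ i) * f i) = (\<Sum>i\<in>{u, v}. mconst (a $ i) * f i)"
    by (intro sum.mono_neutral_right) auto
  then show ?thesis using assms(2) by simp
qed

lemma der_graph_forms: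
  fixes f :: "('k::field, 'n::finite) mpoly ^ 'n"
  assumes "u \<noteq> v"
  shows "linear_form (axis u 1 - axis v 1) = mvar u - (mvar v :: ('k, 'n) mpoly)"
    and "(\<Sum>i\<in>UNIV. mconst ((axis u 1 - axis v 1) $ i) * f $ i) = f $ u - f $ v"
proof -
  have s: "supp (axis u 1 - axis v 1 :: 'k ^ 'n) \<subseteq> {u, v}"
    by (auto simp: supp_def axis_def)
  have a: "(axis u 1 - axis v 1 :: 'k ^ 'n) $ u = 1" "(axis u 1 - axis v 1 :: 'k ^ 'n) $ v = - 1"
    using assms by (auto simp: axis_def)
  show "linear_form (axis u 1 - axis v 1) = mvar u - (mvar v :: ('k, 'n) mpoly)"
    unfolding linear_form_eq sum_two_support[OF s assms] a by (simp add: mconst_uminus)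
  show "(\<Sum>i\<in>UNIV. mconst ((axis u 1 - axis v 1) $ i) * f $ i) = f $ u - f $ v"
    unfolding sum_two_support[OF s assms] a by (simp add: mconst_uminus)
qed

theorem free_graph_forms_chordal:
  fixes E :: "'n::finite set set"
  assumes E: "simple_graph E" and free: "free_submodule (der (graph_forms E :: ('k::field ^ 'n) set))"
  shows "chordal E"
proof (rule ccontr)
  assume "\<not> chordal E"
  then obtain c k where ck: "4 \<le> k" "inj_on c {..<k}"
    "\<And>i j. i < k \<Longrightarrow> j < k \<Longrightarrow> {c i, c j} \<in> E \<longleftrightarrow> j = Suc i mod k \<or> i = Suc j mod k"
    by (rule not_chordal_cycle) blast
  define m :: nat where "m = 1"
  interpret long_cycle c k m by standard (use ck m_def in auto)
  have adj: "{c i, c j} \<in> E \<longleftrightarrow> j = next_ix i \<or> i = next_ix j" if "i < k" "j < k" for i j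
    using ck(3)[OF that] that by (simp add: next_ix_mod)
  have y1: "y i = (mvar (c i) :: ('k, 'n) mpoly)" for i
    unfolding y_def by (simp add: m_def)
  have "\<not> free_submodule (der (graph_forms E :: ('k ^ 'n) set))"
  proof (rule not_free_der[OF finite_graph_forms, of "\<lambda>_. 1"])
    fix f :: "('k, 'n) mpoly ^ 'n"
    assume f: "linear_form a dvd apply_form a f" if "a \<in> graph_forms E" "supp a \<subseteq> C" for a
    have "\<exists>w. f $ c i - f $ c (next_ix i) = (y i - y (next_ix i)) * w" if i: "i < k" for i
    proof -
      have e: "{c i, c (next_ix i)} \<in> E" using adj[of i "next_ix i"] i by simp
      have "supp (axis (c i) 1 - axis (c (next_ix i)) 1 :: 'k ^ 'n) \<subseteq> C"
        using i by (auto simp: supp_def axis_def split: if_splits)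
      then show ?thesis
        using f[of "axis (c i) 1 - axis (c (next_ix i)) 1"] e simple_graphD[OF E e]
        unfolding der_graph_forms[OF simple_graphD[OF E e]]
        by (auto simp: graph_forms_def y1 dvd_def)
    qed
    then obtain w where "\<And>i. i < k \<Longrightarrow> f $ c i - f $ c (next_ix i) = (y i - y (next_ix i)) * w i"
      by metis
    then show "\<exists>g w. spline g w \<and> (\<forall>i<k. f $ c i = 1 * g i)"
      by (intro exI[of _ "\<lambda>i. f $ c i"] exI[of _ w]) (simp add: spline_def)
  next
    fix f :: "('k, 'n) mpoly ^ 'n" and g w :: "nat \<Rightarrow> ('k, 'n) mpoly" and a :: "'k ^ 'n"
    assume sp: "spline g w" and g: "\<And>i. i < k \<Longrightarrow> f $ c i = 1 * g i"
      and a: "a \<in> graph_forms E" "supp a \<subseteq> C"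
    obtain u v where uv: "a = axis u 1 - axis v 1" "{u, v} \<in> E" using a(1) by (auto simp: graph_forms_def)
    have "u \<noteq> v" using simple_graphD[OF E uv(2)] .
    then have "u \<in> supp a" "v \<in> supp a" by (auto simp: uv(1) supp_def axis_def)
    then obtain i j where ij: "i < k" "u = c i" "j < k" "v = c j" using a(2) unfolding C_def by blast
    have d: "y l - y (next_ix l) dvd g l - g (next_ix l)" if "l < k" for l
      using sp that by (simp add: spline_def)
    have "mvar u - mvar v dvd f $ u - f $ v"
    proof (cases "j = next_ix i")
      case True
      then show ?thesis using d[of i] ij g by (simp add: y1)
    next
      case False
      then have "i = next_ix j" using adj[of i j] uv(2) ij by simp
      then have "mvar v - mvar u dvd f $ v - f $ u" using d[of j] ij g by (simp add: y1)
      then show ?thesis by (metis dvd_minus_iff minus_diff_eq minus_dvd_iff)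
    qed
    then show "linear_form a dvd apply_form a f"
      unfolding uv(1) der_graph_forms[OF \<open>u \<noteq> v\<close>] .
  qed simp
  then show False using free by simp
qed

text \<open>A hole has no triangles, so forms supported on it live on a vertex or an edge. The
  coordinate forms give \<open>f $ c i = mvar (c i) * g i\<close>. On an edge, the forms
  \<open>mvar u - t * mvar v\<close> for all nonzero t make \<open>g i - g (next_ix i)\<close>
  divisible by their product, which is the difference of the powers with exponent
  \<open>CARD('k) - 1\<close>.\<close>

theorem free_clique_forms_chordal:
  fixes E :: "'n::finite set set"
  assumes E: "simple_graph E" and free: "free_submodule (der (clique_forms E :: ('k::{field, finite} ^ 'n) set))"
  shows "chordal E"
proof (rule ccontr)
  assume "\<not> chordal E"
  then obtain c k where ck: "4 \<le> k" "inj_on c {..<k}"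
    "\<And>i j. i < k \<Longrightarrow> j < k \<Longrightarrow> {c i, c j} \<in> E \<longleftrightarrow> j = Suc i mod k \<or> i = Suc j mod k"
    by (rule not_chordal_cycle) blast
  define m where "m = CARD('k) - 1"
  interpret long_cycle c k m
    by standard (use ck m_def card_field_ge_2[where 'k = 'k] in auto)
  have adj: "{c i, c j} \<in> E \<longleftrightarrow> j = next_ix i \<or> i = next_ix j" if "i < k" "j < k" for i j
    using ck(3)[OF that] that by (simp add: next_ix_mod)
  have two: "\<exists>i<k. supp a \<subseteq> {c i, c (next_ix i)}" if a: "clique E (supp a)" "a \<noteq> 0" "supp a \<subseteq> C"
    for a :: "'k ^ 'n"
  proof -
    have "supp a \<noteq> {}" using a(2) by simp
    then obtain x where x: "x \<in> supp a" by (metis ex_in_conv)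
    then have "x \<in> C" using a(3) by (rule rev_subsetD)
    then obtain i where "i < k" "x = c i" by (rule C_cases)
    then have i: "i < k" "c i \<in> supp a" using x by simp_all
    have nb: "j = i \<or> j = next_ix i \<or> i = next_ix j" if "j < k" "c j \<in> supp a" for j
      using a(1) i that adj[of i j] unfolding clique_def by (metis c_eq)
    show ?thesis
    proof (cases "c (next_ix i) \<in> supp a")
      case True
      have claim: "j = i \<or> j = next_ix i" if j: "j < k" "c j \<in> supp a" for j
      proof (rule ccontr)
        assume n: "\<not> ?thesis"
        then have "i = next_ix j" using nb[OF j] by simp
        moreover have "{c j, c (next_ix i)} \<in> E"
          using a(1) True j n i(1) unfolding clique_def by (metis c_eq next_ix_less)
        then have "next_ix i = next_ix j \<or> j = next_ix (next_ix i)"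
          by (rule adj[THEN iffD1, OF j(1) next_ix_less[OF i(1)]])
        ultimately show False using next_ix_neq[OF i(1)] next_ix_3[OF i(1)] by metis
      qed
      have "supp a \<subseteq> {c i, c (next_ix i)}"
      proof
        fix x assume x: "x \<in> supp a"
        with a(3) have "x \<in> C" by (rule subsetD)
        then obtain j where j: "j < k" "x = c j" by (rule C_cases)
        show "x \<in> {c i, c (next_ix i)}" using claim[OF j(1)] x j(2) by auto
      qed
      then show ?thesis using i(1) by blast
    next
      case False
      define p where "p = (if i = 0 then k - 1 else i - 1)"
      have p: "p < k" "next_ix p = i" using i(1) k by (auto simp: p_def next_ix_def)
      have claim: "j = i \<or> j = p" if j: "j < k" "c j \<in> supp a" for j
      proof -
        have "j \<noteq> next_ix i" using False j by blast
        then show ?thesis using nb[OF j] p i(1) j(1) by (auto simp: next_ix_def split: if_splits)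
      qed
      have "supp a \<subseteq> {c p, c (next_ix p)}"
      proof
        fix x assume x: "x \<in> supp a"
        with a(3) have "x \<in> C" by (rule subsetD)
        then obtain j where j: "j < k" "x = c j" by (rule C_cases)
        show "x \<in> {c p, c (next_ix p)}" using claim[OF j(1)] x j(2) p(2) by auto
      qed
      then show ?thesis using p(1) by blast
    qed
  qed
  have cl: "a \<in> clique_forms E" if "supp a \<subseteq> {c i, c (next_ix i)}" "i < k" "a \<noteq> 0" for a :: "'k ^ 'n" and i
  proof -
    have "{c i, c (next_ix i)} \<in> E" using adj[of i "next_ix i"] that by simp
    then have "clique E {c i, c (next_ix i)}" by (auto simp: clique_def insert_commute)
    then show ?thesis using clique_subset that by (auto simp: clique_forms_def)
  qed
  have "\<not> free_submodule (der (clique_forms E :: ('k ^ 'n) set))"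
  proof (rule not_free_der[where s = mvar])
    show "finite (clique_forms E :: ('k ^ 'n) set)" by simp
  next
    fix f :: "('k, 'n) mpoly ^ 'n"
    assume f: "linear_form a dvd apply_form a f" if "a \<in> clique_forms E" "supp a \<subseteq> C" for a
    have f2: "mconst s * mvar (c i) + mconst t * mvar (c (next_ix i))
        dvd mconst s * f $ c i + mconst t * f $ c (next_ix i)" if i: "i < k" and st: "s \<noteq> 0" for i s t
    proof -
      let ?u = "c i" and ?v = "c (next_ix i)"
      have ne: "?u \<noteq> ?v" using i next_ix_neq[OF i] by (metis c_eq next_ix_less)
      define a where "a = s *s axis ?u 1 + t *s axis ?v (1::'k)"
      have a: "a $ ?u = s" "a $ ?v = t" "supp a \<subseteq> {?u, ?v}"
        using ne by (auto simp: a_def axis_def supp_def split: if_splits)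
      then have "a \<noteq> 0" using st by auto
      then have "a \<in> clique_forms E" using cl[OF a(3) i] by simp
      moreover have "supp a \<subseteq> C" using a(3) i by auto
      ultimately have "linear_form a dvd apply_form a f" by (rule f)
      then show ?thesis unfolding linear_form_eq sum_two_support[OF a(3) ne] a by simp
    qed
    have "\<exists>g. f $ c i = mvar (c i) * g" if "i < k" for i
      using f2[OF that, of 1 0] by (simp add: dvd_def)
    then obtain g where g: "\<And>i. i < k \<Longrightarrow> f $ c i = mvar (c i) * g i" by metis
    have "\<exists>w. g i - g (next_ix i) = (y i - y (next_ix i)) * w" if i: "i < k" for i
    proof -
      let ?u = "c i" and ?v = "c (next_ix i)" and ?d = "g i - g (next_ix i)"
      have ne: "?u \<noteq> ?v" using i next_ix_neq[OF i] by (metis c_eq next_ix_less)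
      have ind: "indep ?u (mconst t * mvar ?v)" for t :: 'k
        using ne by (auto simp: indep_def sub.ev_simps)
      have d: "mvar ?u - mconst t * mvar ?v dvd ?d" if "t \<noteq> 0" for t
      proof -
        have "mvar ?u - mconst t * mvar ?v dvd f $ ?u - mconst t * f $ ?v"
          using f2[OF i, of 1 "- t"] by (simp add: mconst_uminus)
        moreover have "f $ ?u - mconst t * f $ ?v
            = (mvar ?u - mconst t * mvar ?v) * g (next_ix i) + mvar ?u * ?d"
          using g i by (simp add: algebra_simps)
        ultimately have "mvar ?u - mconst t * mvar ?v
            dvd (mvar ?u - mconst t * mvar ?v) * g (next_ix i) + mvar ?u * ?d" by simp
        then have "mvar ?u - mconst t * mvar ?v dvd mvar ?u * ?d"
          by (rule dvd_add_right_iff[THEN iffD1, OF dvd_triv_left])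
        \<comment> \<open>Substituting t times \<open>mvar ?v\<close> for \<open>mvar ?u\<close>
          turns the factor \<open>mvar ?u\<close> into a nonzero element, which can be
          cancelled.\<close>
        then have "mconst t * mvar ?v * sub ?u (mconst t * mvar ?v) ?d = 0"
          unfolding dvd_iff_sub[OF ind] by (simp add: sub.ev_mult)
        moreover have "mconst t \<noteq> (0 :: ('k, 'n) mpoly)"
          using that unfolding mconst_def by (metis lookup_single_eq lookup_zero)
        then have "mconst t * mvar ?v \<noteq> (0 :: ('k, 'n) mpoly)"
          using mpoly_no_zero_divisors[of "mconst t" "mvar ?v"] by auto
        ultimately have "sub ?u (mconst t * mvar ?v) ?d = 0"
          using mpoly_no_zero_divisors[of "mconst t * mvar ?v"] by auto
        then show ?thesis unfolding dvd_iff_sub[OF ind] .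
      qed
      let ?T = "(\<lambda>t :: 'k. mconst t * mvar ?v :: ('k, 'n) mpoly) ` (UNIV - {0})"
      have inj: "inj_on (\<lambda>t :: 'k. mconst t * mvar ?v :: ('k, 'n) mpoly) (UNIV - {0})"
      proof (rule inj_onI)
        fix s t :: 'k assume "mconst s * mvar ?v = (mconst t * mvar ?v :: ('k, 'n) mpoly)"
        then have "mconst s = (mconst t :: ('k, 'n) mpoly)"
          using mpoly_mult_cancel[of "mvar ?v"] by (simp add: mult.commute)
        then show "s = t" unfolding mconst_def by (metis lookup_single_eq)
      qed
      have "(\<Prod>L\<in>?T. mvar ?u - L) dvd ?d"
        using d ind by (intro prod_dvd_mpoly) auto
      then have "y i - y (next_ix i) dvd ?d"
        unfolding y_def unfolding prod.reindex[OF inj] o_def prod_linear_nonzero m_def .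
      then show ?thesis by (simp add: dvd_def)
    qed
    then obtain w where "\<And>i. i < k \<Longrightarrow> g i - g (next_ix i) = (y i - y (next_ix i)) * w i"
      by metis
    then show "\<exists>g w. spline g w \<and> (\<forall>i<k. f $ c i = mvar (c i) * g i)"
      using g by (intro exI[of _ g] exI[of _ w]) (simp add: spline_def)
  next
    fix f :: "('k, 'n) mpoly ^ 'n" and g w :: "nat \<Rightarrow> ('k, 'n) mpoly" and a :: "'k ^ 'n"
    assume sp: "spline g w" and g: "\<And>i. i < k \<Longrightarrow> f $ c i = mvar (c i) * g i"
      and a: "a \<in> clique_forms E" "supp a \<subseteq> C"
    obtain i where i: "i < k" "supp a \<subseteq> {c i, c (next_ix i)}"
      using two[of a] a by (auto simp: clique_forms_def)
    let ?u = "c i" and ?v = "c (next_ix i)"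
    have ne: "?u \<noteq> ?v" using i next_ix_neq[OF i(1)] by (metis c_eq next_ix_less)
    define s t where "s = a $ ?u" and "t = a $ ?v"
    have lin: "linear_form a = mconst s * mvar ?u + mconst t * mvar ?v"
      unfolding linear_form_eq sum_two_support[OF i(2) ne] s_def t_def ..
    have f: "mconst s * f $ ?u + mconst t * f $ ?v
        = linear_form a * g (next_ix i) + mconst s * mvar ?u * (g i - g (next_ix i))"
      using g i by (simp add: lin algebra_simps)
    have "linear_form a dvd linear_form a * g (next_ix i) + mconst s * mvar ?u * (g i - g (next_ix i))"
    proof (rule dvd_add[OF dvd_triv_left])
      show "linear_form a dvd mconst s * mvar ?u * (g i - g (next_ix i))"
      proof (cases "s = 0 \<or> t = 0")
        case True
        then show ?thesis by (auto simp: lin)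
      next
        case False
        \<comment> \<open>With this r, the form a is s times
          \<open>mvar ?u - mconst r * mvar ?v\<close>, and \<open>r ^ m = 1\<close> makes the latter
          a divisor of \<open>y i - y (next_ix i)\<close>.\<close>
        define r where "r = - t / s"
        have r: "r \<noteq> 0" "t = - (s * r)" using False by (auto simp: r_def)
        have "(mconst r * mvar ?v) ^ m = mvar ?v ^ m"
          using finite_field_power_eq_1[OF r(1)] by (simp add: power_mult_distrib m_def flip: mconst_power)
        then have "mvar ?u - mconst r * mvar ?v dvd y i - y (next_ix i)"
          using power_diff_dvd[of "mvar ?u" "mconst r * mvar ?v" m] by (simp add: y_def)
        moreover have "g i - g (next_ix i) = (y i - y (next_ix i)) * w i"
          using sp i(1) by (simp add: spline_def)
        ultimately have "mvar ?u - mconst r * mvar ?v dvd g i - g (next_ix i)" by simp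
        then have d: "mconst s * (mvar ?u - mconst r * mvar ?v) dvd mconst s * (g i - g (next_ix i))"
          by (rule mult_dvd_mono[OF dvd_refl])
        have "mconst t = - (mconst s * mconst r :: ('k, 'n) mpoly)"
          using r(2) by (simp flip: mconst_mult mconst_uminus)
        then have l: "mconst s * (mvar ?u - mconst r * mvar ?v) = linear_form a"
          by (simp add: lin algebra_simps)
        have "linear_form a dvd mvar ?u * (mconst s * (g i - g (next_ix i)))"
          using d unfolding l by (rule dvd_mult)
        then show ?thesis by (simp add: ac_simps)
      qed
    qed
    then show "linear_form a dvd apply_form a f"
      unfolding sum_two_support[OF i(2) ne] s_def[symmetric] t_def[symmetric] f .
  qed simp
  then show False using free by simp
qed

section \<open>Supersolvable arrangements\<close>

lemma arr_rank_empty [simp]: "arr_rank ({} :: ('k::field, 'n::finite) arrangement) = 0"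
  by (simp add: arr_rank_def vec_dim_card del: vec.dim_UNIV)

definition modular_step :: "'a set set \<Rightarrow> 'a set set \<Rightarrow> bool" where
  "modular_step F' F \<longleftrightarrow> F' \<subseteq> F \<and>
     (\<forall>H\<in>F - F'. \<forall>H'\<in>F - F'. H \<noteq> H' \<longrightarrow> (\<exists>H''\<in>F'. H \<inter> H' \<subseteq> H''))"

lemma supersolvable_iff:
  "supersolvable A \<longleftrightarrow> (\<exists>F. F 0 = {} \<and> F (arr_rank A) = A \<and>
     (\<forall>i\<in>{1..arr_rank A}. modular_step (F (i - 1)) (F i) \<and> arr_rank (F i) = i))"
  unfolding supersolvable_def modular_step_def by (simp only: conj_ac)

lemma modular_stepD:
  "modular_step F' F \<Longrightarrow> F' \<subseteq> F"
  "modular_step F' F \<Longrightarrow> H \<in> F - F' \<Longrightarrow> H' \<in> F - F' \<Longrightarrow> H \<noteq> H' \<Longrightarrow> \<exists>H''\<in>F'. H \<inter> H' \<subseteq> H''"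
  by (simp_all add: modular_step_def)

lemma supersolvable_empty: "supersolvable ({} :: ('k::field, 'n::finite) arrangement)"
  unfolding supersolvable_def by (intro exI[of _ "\<lambda>_. {}"]) simp

lemma supersolvable_extend:
  assumes ss: "supersolvable A'" and r: "arr_rank A = Suc (arr_rank A')" and "modular_step A' A"
  shows "supersolvable A"
proof -
  let ?r = "arr_rank A'"
  obtain F where F: "F 0 = {}" "F ?r = A'"
    and step: "\<And>i. i \<in> {1..?r} \<Longrightarrow> modular_step (F (i - 1)) (F i) \<and> arr_rank (F i) = i"
    using ss unfolding supersolvable_iff by auto
  define G where "G i = (if i \<le> ?r then F i else A)" for i
  have "modular_step (G (i - 1)) (G i) \<and> arr_rank (G i) = i" if i: "i \<in> {1..Suc ?r}" for i
  proof (cases "i = Suc ?r")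
    case True
    then have "G (i - 1) = A'" "G i = A" by (simp_all add: G_def F)
    then show ?thesis using assms True by simp
  next
    case False
    then have "G (i - 1) = F (i - 1)" "G i = F i" "i \<in> {1..?r}" using i by (auto simp: G_def)
    then show ?thesis using step[of i] by simp
  qed
  moreover have "G 0 = {}" "G (Suc ?r) = A" by (simp_all add: G_def F)
  ultimately show ?thesis unfolding supersolvable_iff r by (intro exI[of _ G]) simp
qed

section \<open>Filtrations under the addition of a vertex\<close>

lemma subspace_hyperplane: "vec.subspace (hyperplane a)"
proof -
  have "dot a 0 = 0" by (simp add: dot_def)
  then show ?thesis by (auto simp: vec.subspace_def hyperplane_dot dot_add_right dot_scale_right)
qed

lemma subspace_Inter_hyperplanes: "vec.subspace (\<Inter> (hyperplane ` \<Phi>))"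
  by (rule vec.subspace_Inter) (auto intro: subspace_hyperplane)

definition forms_in :: "('k::zero ^ 'n) set \<Rightarrow> 'n set \<Rightarrow> ('k ^ 'n) set" where
  "forms_in \<Phi> W = {a \<in> \<Phi>. supp a \<subseteq> W}"

lemma forms_in_insert: "v \<notin> W \<Longrightarrow> a \<in> forms_in \<Phi> W \<longleftrightarrow> a \<in> forms_in \<Phi> (insert v W) \<and> a $ v = 0"
  by (auto simp: forms_in_def supp_def)

text \<open>All forms involving v make up one new level. By the modular condition, any two of them
  that define different hyperplanes have a combination among the old forms, so on the intersection
  of the old hyperplanes they are all proportional and the rank grows by exactly 1. If no form
  involves v, the arrangement is unchanged and the filtration must not be lengthened.\<close>

lemma supersolvable_insert:
  fixes \<Phi> :: "('k::field ^ 'n::finite) set"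
  assumes ss: "supersolvable (hyperplane ` forms_in \<Phi> W)" and v: "v \<notin> W" and 0: "0 \<notin> \<Phi>"
    and modular: "\<And>a b. a \<in> forms_in \<Phi> (insert v W) \<Longrightarrow> b \<in> forms_in \<Phi> (insert v W) \<Longrightarrow> a $ v \<noteq> 0 \<Longrightarrow> b $ v \<noteq> 0
      \<Longrightarrow> hyperplane a \<noteq> hyperplane b \<Longrightarrow> \<exists>c\<in>forms_in \<Phi> W. hyperplane a \<inter> hyperplane b \<subseteq> hyperplane c"
  shows "supersolvable (hyperplane ` forms_in \<Phi> (insert v W))"
proof (cases "\<exists>a\<in>forms_in \<Phi> (insert v W). a $ v \<noteq> 0")
  case False
  then have "forms_in \<Phi> (insert v W) = forms_in \<Phi> W" using forms_in_insert[OF v] by blast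
  then show ?thesis using ss by simp
next
  case True
  let ?A = "hyperplane ` forms_in \<Phi> (insert v W)" and ?A' = "hyperplane ` forms_in \<Phi> W"
  obtain a where a: "a \<in> forms_in \<Phi> (insert v W)" "a $ v \<noteq> 0" using True by blast
  have nz: "c \<noteq> 0" if "c \<in> forms_in \<Phi> U" for c U using that 0 by (auto simp: forms_in_def)
  have new: "\<exists>b\<in>forms_in \<Phi> (insert v W). H = hyperplane b \<and> b $ v \<noteq> 0" if "H \<in> ?A - ?A'" for H
    using that forms_in_insert[OF v] by blast
  have sub: "?A' \<subseteq> ?A" using forms_in_insert[OF v] by blast
  have v': "axis v 1 \<in> \<Inter>?A'" using forms_in_insert[OF v] by (auto simp: hyperplane_dot)
  have ker: "y \<in> \<Inter>?A" if y: "y \<in> \<Inter>?A'" "dot a y = 0" for y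
  proof (rule InterI)
    fix H assume "H \<in> ?A"
    show "y \<in> H"
    proof (cases "H \<in> ?A'")
      case True then show ?thesis using y by blast
    next
      case False
      then obtain b where b: "b \<in> forms_in \<Phi> (insert v W)" "H = hyperplane b" "b $ v \<noteq> 0"
        using new \<open>H \<in> ?A\<close> by blast
      show ?thesis
      proof (cases "hyperplane a = hyperplane b")
        case True then show ?thesis using y(2) b(2) by (simp add: hyperplane_dot set_eq_iff)
      next
        case False
        obtain c where c: "c \<in> forms_in \<Phi> W" "hyperplane a \<inter> hyperplane b \<subseteq> hyperplane c"
          using modular[OF a(1) b(1) a(2) b(3) False] by blast
        obtain s t where st: "c = s *s a + t *s b"
          using hyperplane_inter_subset[OF c(2) False nz[OF a(1)] nz[OF b(1)]] by blast
        have cv: "c $ v = 0" using c(1) forms_in_insert[OF v] by blast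
        have "t \<noteq> 0"
        proof
          assume "t = 0"
          then have "s = 0" using cv a(2) st by simp
          then show False using nz[OF c(1)] st \<open>t = 0\<close> by simp
        qed
        moreover have "dot c y = 0" using y(1) c(1) by (auto simp: hyperplane_dot)
        ultimately have "dot b y = 0" using y(2) by (simp add: st dot_add_left dot_scale_left)
        then show ?thesis by (simp add: b(2) hyperplane_dot)
      qed
    qed
  qed
  let ?X = "\<Inter>?A" and ?X' = "\<Inter>?A'"
  \<comment> \<open>The old intersection is the new one extended by the line of
    \<open>axis v 1\<close>, on which a does not vanish; this gives the step in rank.\<close>
  have X': "vec.span (insert (axis v 1) ?X) = ?X'"
  proof
    have "?X \<subseteq> ?X'" using sub by (rule Inter_anti_mono)
    then show "vec.span (insert (axis v 1) ?X) \<subseteq> ?X'"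
      using v' subspace_Inter_hyperplanes by (intro vec.span_minimal) auto
    show "?X' \<subseteq> vec.span (insert (axis v 1) ?X)"
    proof
      fix x assume x: "x \<in> ?X'"
      let ?y = "x - (dot a x / a $ v) *s axis v 1"
      have "?y \<in> ?X'" using x v' subspace_Inter_hyperplanes
        by (intro vec.subspace_diff vec.subspace_scale)
      moreover have "dot a ?y = 0" using a(2) by (simp add: dot_diff_right dot_scale_right)
      ultimately have "?y \<in> ?X" by (rule ker)
      then have "?y + (dot a x / a $ v) *s axis v 1 \<in> vec.span (insert (axis v 1) ?X)"
        by (intro vec.span_add vec.span_scale) (auto intro: vec.span_base)
      then show "x \<in> vec.span (insert (axis v 1) ?X)" by simp
    qed
  qed
  have "axis v 1 \<notin> ?X" using a by (auto simp: hyperplane_dot)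
  then have "axis v 1 \<notin> vec.span ?X"
    using vec.span_eq_iff subspace_Inter_hyperplanes by metis
  then have d: "vec.dim ?X' = vec.dim ?X + 1"
    unfolding X'[symmetric] vec.dim_span by (simp add: vec.dim_insert)
  have "vec.dim ?X' \<le> CARD('n)"
    using vec.dim_subset_UNIV[of ?X'] by (simp add: vec.dimension_def card_cart_basis)
  with d have "arr_rank ?A = Suc (arr_rank ?A')" by (simp add: arr_rank_def)
  then show ?thesis
  proof (rule supersolvable_extend[OF ss])
    show "modular_step ?A' ?A" unfolding modular_step_def
    proof (intro conjI sub ballI impI)
      fix H H' assume "H \<in> ?A - ?A'" "H' \<in> ?A - ?A'" "H \<noteq> H'"
      moreover from this obtain b b' where "b \<in> forms_in \<Phi> (insert v W)" "H = hyperplane b" "b $ v \<noteq> 0"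
        "b' \<in> forms_in \<Phi> (insert v W)" "H' = hyperplane b'" "b' $ v \<noteq> 0"
        using new[of H] new[of H'] by auto
      ultimately show "\<exists>H''\<in>?A'. H \<inter> H' \<subseteq> H''" using modular[of b b'] by auto
    qed
  qed
qed

text \<open>A level is closed in the next one. The difference in rank yields a new K and a point p
  of the lower intersection outside K. If H were new, the modular condition for H and K would give
  H'' in F' containing \<open>H \<inter> K\<close>. Both H and H'' contain p, and H is spanned by p
  and \<open>H \<inter> K\<close>, so H = H''.\<close>

lemma supersolvable_closed:
  fixes A :: "('k::field, 'n::finite) arrangement"
  assumes A: "\<And>H. H \<in> A \<Longrightarrow> \<exists>a. a \<noteq> 0 \<and> H = hyperplane a"
    and step: "modular_step F' F" "F \<subseteq> A" "arr_rank F \<noteq> arr_rank F'"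
    and H: "H \<in> F" "\<Inter>F' \<subseteq> H"
  shows "H \<in> F'"
proof (rule ccontr)
  assume nH: "H \<notin> F'"
  have "\<Inter>F \<noteq> \<Inter>F'" using step(3) by (auto simp: arr_rank_def)
  then obtain K p where K: "K \<in> F" "p \<in> \<Inter>F'" "p \<notin> K"
    using modular_stepD(1)[OF step(1)] by blast
  then have "K \<in> F - F'" "H \<noteq> K" using H(2) by auto
  then obtain H'' where H'': "H'' \<in> F'" "H \<inter> K \<subseteq> H''"
    using modular_stepD(2)[OF step(1), of H K] H(1) nH by auto
  have "H \<in> A" "K \<in> A" "H'' \<in> A"
    using H(1) K(1) H''(1) step(2) modular_stepD(1)[OF step(1)] by auto
  then obtain a b c where abc: "H = hyperplane a" "K = hyperplane b" "H'' = hyperplane c" "a \<noteq> 0" "c \<noteq> 0"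
    using A[of H] A[of K] A[of H''] by auto
  have "p \<in> H" "p \<in> H''" using subsetD[OF H(2) K(2)] InterD[OF K(2) H''(1)] by auto
  then have p: "dot a p = 0" "dot b p \<noteq> 0" "dot c p = 0"
    using K(3) by (simp_all add: abc hyperplane_dot)
  have "hyperplane a \<subseteq> hyperplane c"
  proof
    fix y assume "y \<in> hyperplane a"
    then have "y - (dot b y / dot b p) *s p \<in> H \<inter> K"
      using p by (simp add: abc hyperplane_dot dot_diff_right dot_scale_right)
    then have "y - (dot b y / dot b p) *s p \<in> hyperplane c" using H''(2) abc(3) by blast
    then show "y \<in> hyperplane c" using p by (simp add: hyperplane_dot dot_diff_right dot_scale_right)
  qed
  then have "H = H''" unfolding abc using abc(4,5) by (rule hyperplane_subset_eq)
  then show False using nH H''(1) by simp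
qed

text \<open>The members of \<open>T\<close> outside \<open>U\<close> are those at the highest level of the filtration met by \<open>T\<close>.\<close>

lemma supersolvable_top:
  fixes A :: "('k::field, 'n::finite) arrangement"
  assumes ss: "supersolvable A" and A: "\<And>H. H \<in> A \<Longrightarrow> \<exists>a. a \<noteq> 0 \<and> H = hyperplane a"
    and T: "T \<subseteq> A" "T \<noteq> {}"
  obtains U where "U \<subseteq> T" "U \<noteq> T" "\<And>H. H \<in> T - U \<Longrightarrow> \<not> \<Inter>U \<subseteq> H"
    "\<And>H H'. H \<in> T - U \<Longrightarrow> H' \<in> T - U \<Longrightarrow> H \<noteq> H' \<Longrightarrow> \<exists>H''\<in>A - (T - U). H \<inter> H' \<subseteq> H''"
proof -
  let ?r = "arr_rank A"
  obtain F where F: "F 0 = {}" "F ?r = A"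
    and step: "\<And>i. i \<in> {1..?r} \<Longrightarrow> modular_step (F (i - 1)) (F i) \<and> arr_rank (F i) = i"
    using ss unfolding supersolvable_iff by auto
  define i where "i = (LEAST i. T \<subseteq> F i)"
  have Ti: "T \<subseteq> F i" unfolding i_def by (rule LeastI[of _ ?r]) (use T F in simp)
  have ir: "i \<le> ?r" unfolding i_def by (rule Least_le) (use T F in simp)
  have "i \<noteq> 0"
  proof
    assume "i = 0"
    then show False using Ti F(1) T(2) by simp
  qed
  then have i: "i \<in> {1..?r}" using ir by simp
  have nT: "\<not> T \<subseteq> F (i - 1)" using not_less_Least[of "i - 1" "\<lambda>i. T \<subseteq> F i"] \<open>i \<noteq> 0\<close> unfolding i_def by simp
  have down: "j \<le> ?r \<Longrightarrow> F (?r - j) \<subseteq> A" for j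
  proof (induct j)
    case (Suc j)
    then have "F (?r - Suc j) \<subseteq> F (?r - j)" using step[of "?r - j"] by (simp add: modular_step_def)
    then show ?case using Suc by simp
  qed (simp add: F)
  have mono: "F j \<subseteq> A" if "j \<le> ?r" for j using down[of "?r - j"] that by simp
  \<comment> \<open>The rank condition of the filtration starts at level 1; level 0 is empty and has
    rank 0.\<close>
  have rank: "arr_rank (F i) \<noteq> arr_rank (F (i - 1))"
  proof (cases "i = 1")
    case True
    then show ?thesis using step[OF i] F(1) by simp
  next
    case False
    then have "i - 1 \<in> {1..?r}" using i by auto
    then show ?thesis using step[OF i] step[of "i - 1"] \<open>i \<noteq> 0\<close> by simp
  qed
  show thesis
  proof (rule that[of "T \<inter> F (i - 1)"])
    show "T \<inter> F (i - 1) \<noteq> T" using nT by blast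
    fix H assume H: "H \<in> T - T \<inter> F (i - 1)"
    show "\<not> \<Inter> (T \<inter> F (i - 1)) \<subseteq> H"
    proof
      assume "\<Inter> (T \<inter> F (i - 1)) \<subseteq> H"
      then have "\<Inter> (F (i - 1)) \<subseteq> H" by blast
      then have "H \<in> F (i - 1)"
        using supersolvable_closed[OF A _ mono[OF ir] rank, of H] step[OF i] H Ti by auto
      then show False using H by blast
    qed
    fix H' assume H': "H' \<in> T - T \<inter> F (i - 1)" "H \<noteq> H'"
    then obtain H'' where H'': "H'' \<in> F (i - 1)" "H \<inter> H' \<subseteq> H''"
      using modular_stepD(2)[of "F (i - 1)" "F i" H H'] step[OF i] H Ti by auto
    have "i - 1 \<le> ?r" using ir by simp
    then have "H'' \<in> A" using H''(1) mono by auto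
    then show "\<exists>H''\<in>A - (T - T \<inter> F (i - 1)). H \<inter> H' \<subseteq> H''" using H'' by blast
  qed simp
qed

text \<open>The family T consists of the edges of a hole. Their forms \<open>e i\<close> sum to 0,
  so a single edge at the top level would contain the intersection of the others; hence at least two
  are there. The hyperplane required for two of them is a combination with both coefficients
  nonzero: for consecutive edges it would be a chord, otherwise its support has more than two
  vertices.\<close>

theorem supersolvable_graph_forms_chordal:
  fixes E :: "'n::finite set set"
  assumes E: "simple_graph E" and ss: "supersolvable (hyperplane ` graph_forms E :: ('k::field, 'n) arrangement)"
  shows "chordal E"
proof (rule ccontr)
  assume "\<not> chordal E"
  then obtain c k where ck: "4 \<le> k" "inj_on c {..<k}"
    "\<And>i j. i < k \<Longrightarrow> j < k \<Longrightarrow> {c i, c j} \<in> E \<longleftrightarrow> j = Suc i mod k \<or> i = Suc j mod k"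
    by (rule not_chordal_cycle) blast
  interpret long_cycle c k 1 by standard (use ck in auto)
  have adj: "{c i, c j} \<in> E \<longleftrightarrow> j = next_ix i \<or> i = next_ix j" if "i < k" "j < k" for i j
    using ck(3)[OF that] that by (simp add: next_ix_mod)
  define e where "e i = axis (c i) 1 - axis (c (next_ix i)) (1 :: 'k)" for i
  have dote: "dot (e i) x = x $ c i - x $ c (next_ix i)" for i x
    by (simp add: e_def dot_diff_left)
  have e: "e i \<in> graph_forms E" if "i < k" for i
    using adj[of i "next_ix i"] that by (auto simp: e_def graph_forms_def)
  have nz: "a \<noteq> 0" if "a \<in> graph_forms E" for a :: "'k ^ 'n"
    using that graph_forms_nonzero[OF E] by auto
  let ?A = "hyperplane ` graph_forms E :: ('k, 'n) arrangement"
  let ?T = "(\<lambda>i. hyperplane (e i)) ` {..<k}"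
  have T: "?T \<subseteq> ?A" "?T \<noteq> {}" using e k by (auto simp: lessThan_empty_iff bot_nat_def)
  have A: "\<exists>a. a \<noteq> 0 \<and> H = hyperplane a" if "H \<in> ?A" for H
    using that nz by blast
  obtain U where U: "U \<subseteq> ?T" "U \<noteq> ?T" and top: "\<And>H. H \<in> ?T - U \<Longrightarrow> \<not> \<Inter>U \<subseteq> H"
    and pair: "\<And>H H'. H \<in> ?T - U \<Longrightarrow> H' \<in> ?T - U \<Longrightarrow> H \<noteq> H' \<Longrightarrow> \<exists>H''\<in>?A - (?T - U). H \<inter> H' \<subseteq> H''"
    by (rule supersolvable_top[OF ss _ T], erule A) (rule that)
  obtain i where i: "i < k" "hyperplane (e i) \<in> ?T - U" using U by blast
  have "\<exists>j<k. j \<noteq> i \<and> hyperplane (e j) \<notin> U"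
  proof (rule ccontr)
    assume "\<not> ?thesis"
    then have all: "hyperplane (e j) \<in> U" if "j < k" "j \<noteq> i" for j using that by blast
    have "\<Inter>U \<subseteq> hyperplane (e i)"
    proof
      fix x assume x: "x \<in> \<Inter>U"
      have z: "dot (e j) x = 0" if "j < k" "j \<noteq> i" for j
        using all[OF that] x by (auto simp: hyperplane_dot)
      have "(\<Sum>j<k. dot (e j) x) = 0"
        unfolding dote sum_subtractf using sum_next_ix[of "\<lambda>j. x $ c j"] by simp
      moreover have "(\<Sum>j<k. dot (e j) x) = dot (e i) x + (\<Sum>j\<in>{..<k} - {i}. dot (e j) x)"
        using i(1) by (intro sum.remove) auto
      moreover have "(\<Sum>j\<in>{..<k} - {i}. dot (e j) x) = 0" using z by (intro sum.neutral) auto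
      ultimately show "x \<in> hyperplane (e i)" by (simp add: hyperplane_dot)
    qed
    then show False using top[OF i(2)] by blast
  qed
  then obtain j where j: "j < k" "j \<noteq> i" "hyperplane (e j) \<in> ?T - U" by blast
  have ne: "hyperplane (e i) \<noteq> hyperplane (e j)"
  proof
    assume "hyperplane (e i) = hyperplane (e j)"
    then obtain s where "s \<noteq> 0" "e j = s *s e i"
      using hyperplane_eqD[OF _ nz[OF e[OF i(1)]] nz[OF e[OF j(1)]]] by blast
    then have "dot (e j) (axis v 1) = 0 \<longleftrightarrow> dot (e i) (axis v 1) = 0" for v
      by (simp add: dot_scale_left)
    from this[of "c i"] this[of "c (next_ix i)"] show False
      using i(1) j(1,2) next_ix_neq[OF i(1)] next_ix_neq[OF j(1)] next_ix_2[OF i(1)]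
      unfolding dote by (auto simp: axis_def split: if_splits)
  qed
  obtain H'' where H'': "H'' \<in> ?A" "H'' \<notin> ?T - U" "hyperplane (e i) \<inter> hyperplane (e j) \<subseteq> H''"
    using pair[OF i(2) j(3) ne] by blast
  obtain u v where uv: "H'' = hyperplane (axis u 1 - axis v 1)" "{u, v} \<in> E"
    using H''(1) by (auto simp: graph_forms_def)
  let ?d = "axis u 1 - axis v 1 :: 'k ^ 'n"
  have d: "?d \<noteq> 0" using uv(2) by (intro nz) (auto simp: graph_forms_def)
  obtain s t where st: "?d = s *s e i + t *s e j"
    using hyperplane_inter_subset[OF H''(3)[unfolded uv(1)] ne nz[OF e[OF i(1)]] nz[OF e[OF j(1)]]] by blast
  \<comment> \<open>A zero coefficient would make H'' one of the two given hyperplanes, but H'' is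
    not at the top level of T.\<close>
  have "s \<noteq> 0" "t \<noteq> 0"
    using st d H''(2) i(2) j(3) hyperplane_scale[of t "e j"] hyperplane_scale[of s "e i"] uv(1)
    by (metis add.left_neutral vector_smult_lzero, metis add.right_neutral vector_smult_lzero)
  have supp_d: "w \<in> {u, v}" if "?d $ w \<noteq> 0" for w
    using that by (auto simp: axis_def split: if_splits)
  have coef: "?d $ w = s * ((if w = c i then 1 else 0) - (if w = c (next_ix i) then 1 else 0))
      + t * ((if w = c j then 1 else 0) - (if w = c (next_ix j) then 1 else 0))" for w
    unfolding st by (simp add: e_def axis_def)
  have consec: False if "a < k" "x \<noteq> 0" "y \<noteq> 0"
    and "\<And>w. ?d $ w = x * ((if w = c a then 1 else 0) - (if w = c (next_ix a) then 1 else 0))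
      + y * ((if w = c (next_ix a) then 1 else 0) - (if w = c (next_ix (next_ix a)) then 1 else 0))"
    for a x y
  proof -
    have "?d $ c a \<noteq> 0" "?d $ c (next_ix (next_ix a)) \<noteq> 0"
      using that(1-3) next_ix_neq[OF that(1)] next_ix_2[OF that(1)] next_ix_neq[of "next_ix a"]
      unfolding that(4) by auto
    then have "c a \<in> {u, v}" "c (next_ix (next_ix a)) \<in> {u, v}" using supp_d by blast+
    moreover have "c a \<noteq> c (next_ix (next_ix a))" using that(1) next_ix_2[OF that(1)] by simp
    ultimately have "{c a, c (next_ix (next_ix a))} = {u, v}" by auto
    then have "next_ix (next_ix a) = next_ix a \<or> a = next_ix (next_ix (next_ix a))"
      using uv(2) adj[of a "next_ix (next_ix a)"] that(1) by simp
    then show False using that(1) next_ix_neq[of "next_ix a"] next_ix_3[OF that(1)] by auto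
  qed
  show False
  proof (cases "j = next_ix i \<or> i = next_ix j")
    case True
    then show False
    proof
      assume "j = next_ix i"
      then show False using consec[OF i(1) \<open>s \<noteq> 0\<close> \<open>t \<noteq> 0\<close>] coef by simp
    next
      assume "i = next_ix j"
      then show False using consec[OF j(1) \<open>t \<noteq> 0\<close> \<open>s \<noteq> 0\<close>] coef by (simp add: add.commute)
    qed
  next
    case False
    have "next_ix i \<noteq> next_ix j" using next_ix_inj[OF i(1) j(1)] j(2) by blast
    then have "?d $ c i \<noteq> 0" "?d $ c (next_ix i) \<noteq> 0" "?d $ c j \<noteq> 0"
      unfolding coef using False i(1) j(1,2) \<open>s \<noteq> 0\<close> \<open>t \<noteq> 0\<close>
      by (auto simp: next_ix_neq[THEN not_sym])
    then have "c i \<in> {u, v}" "c (next_ix i) \<in> {u, v}" "c j \<in> {u, v}" using supp_d by blast+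
    moreover have "c i \<noteq> c j" "c i \<noteq> c (next_ix i)" "c j \<noteq> c (next_ix i)"
      using False i(1) j(1,2) by (simp_all add: next_ix_neq[THEN not_sym])
    ultimately show False by auto
  qed
qed

text \<open>The family T consists of all forms supported on a hole, and \<open>P\<close> marks those
  at its top level. Two of them clash if each contains a vertex missing from the other and these two
  vertices are not adjacent, since the required combination contains both. Some coordinate form, at
  \<open>c i\<close>, is at the top. By clashes, the coordinates of the vertices not adjacent to it,
  and then those of its two neighbours, vanish on the intersection of U. So adding either neighbour
  to \<open>c i\<close> gives two more top forms, and these clash because the neighbours are not
  adjacent.\<close>

theorem supersolvable_clique_forms_chordal:
  fixes E :: "'n::finite set set"
  assumes E: "simple_graph E" and ss: "supersolvable (hyperplane ` clique_forms E :: ('k::field, 'n) arrangement)"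
  shows "chordal E"
proof (rule ccontr)
  assume "\<not> chordal E"
  then obtain c k where ck: "4 \<le> k" "inj_on c {..<k}"
    "\<And>i j. i < k \<Longrightarrow> j < k \<Longrightarrow> {c i, c j} \<in> E \<longleftrightarrow> j = Suc i mod k \<or> i = Suc j mod k"
    by (rule not_chordal_cycle) blast
  interpret long_cycle c k 1 by standard (use ck in auto)
  have adj: "{c i, c j} \<in> E \<longleftrightarrow> j = next_ix i \<or> i = next_ix j" if "i < k" "j < k" for i j
    using ck(3)[OF that] that by (simp add: next_ix_mod)
  let ?A = "hyperplane ` clique_forms E :: ('k, 'n) arrangement"
  let ?T = "hyperplane ` forms_in (clique_forms E) C :: ('k, 'n) arrangement"
  have nz: "a \<noteq> 0" if "a \<in> clique_forms E" for a :: "'k ^ 'n"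
    using that by (auto simp: clique_forms_def)
  let ?x = "\<lambda>v. axis v 1 :: 'k ^ 'n"
  have form: "a \<in> forms_in (clique_forms E) C" if "a \<noteq> 0" "supp a \<subseteq> {u, v}" "{u, v} \<subseteq> C"
      "u = v \<or> {u, v} \<in> E" for a :: "'k ^ 'n" and u v
  proof -
    have "clique E {u, v}" using that(4) by (auto simp: clique_def insert_commute)
    then show ?thesis using that(1-3) clique_subset[OF _ that(2)]
      by (auto simp: clique_forms_def forms_in_def)
  qed
  have x_form: "?x v \<in> forms_in (clique_forms E) C" if "v \<in> C" for v
  proof (rule form[of _ v v])
    show "?x v \<noteq> 0" by (simp add: axis_eq_0_iff)
  qed (use that in \<open>auto simp: supp_def axis_def split: if_splits\<close>)
  have T: "?T \<subseteq> ?A" "?T \<noteq> {}" using x_form[of "c 0"] k by (auto simp: forms_in_def)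
  have A: "\<exists>a. a \<noteq> 0 \<and> H = hyperplane a" if "H \<in> ?A" for H
    using that nz by blast
  obtain U where U: "U \<subseteq> ?T" "U \<noteq> ?T" and top: "\<And>H. H \<in> ?T - U \<Longrightarrow> \<not> \<Inter>U \<subseteq> H"
    and pair: "\<And>H H'. H \<in> ?T - U \<Longrightarrow> H' \<in> ?T - U \<Longrightarrow> H \<noteq> H' \<Longrightarrow> \<exists>H''\<in>?A - (?T - U). H \<inter> H' \<subseteq> H''"
    by (rule supersolvable_top[OF ss _ T], erule A) (rule that)
  define P where "P a \<longleftrightarrow> a \<in> forms_in (clique_forms E) C \<and> hyperplane a \<notin> U" for a
  have P2: "\<exists>s t. s \<noteq> 0 \<and> t \<noteq> 0 \<and> clique E (supp (s *s a + t *s b))"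
    if a: "P a" and b: "P b" and ne: "hyperplane a \<noteq> hyperplane b" for a b
  proof -
    have ab: "hyperplane a \<in> ?T - U" "hyperplane b \<in> ?T - U" "a \<noteq> 0" "b \<noteq> 0"
      using a b nz by (auto simp: P_def forms_in_def)
    obtain H'' where H'': "H'' \<in> ?A" "H'' \<notin> ?T - U" "hyperplane a \<inter> hyperplane b \<subseteq> H''"
      using pair[OF ab(1,2) ne] by blast
    then obtain d where d: "d \<in> clique_forms E" "H'' = hyperplane d" by blast
    obtain s t where st: "d = s *s a + t *s b"
      using hyperplane_inter_subset[OF H''(3)[unfolded d(2)] ne ab(3,4)] by blast
    have "s \<noteq> 0" "t \<noteq> 0"
      using st nz[OF d(1)] H''(2) ab(1,2) hyperplane_scale[of t b] hyperplane_scale[of s a] d(2)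
      by (metis add.left_neutral vector_smult_lzero, metis add.right_neutral vector_smult_lzero)
    then show ?thesis using d(1) st by (auto simp: clique_forms_def)
  qed
  have clash: False
    if as: "P a" "P b" "{u, w} \<notin> E" "u \<noteq> w" "a $ u \<noteq> 0" "b $ u = 0" "b $ w \<noteq> 0" "a $ w = 0" for a b u w
  proof -
    have "hyperplane a \<noteq> hyperplane b"
    proof
      assume "hyperplane a = hyperplane b"
      then obtain r where "r \<noteq> 0" "b = r *s a"
        using hyperplane_eqD[of a b] as(1,2) nz by (auto simp: P_def forms_in_def)
      then show False using that(5,6) by simp
    qed
    then obtain s t where st: "s \<noteq> 0" "t \<noteq> 0" "clique E (supp (s *s a + t *s b))"
      using P2[OF as(1,2)] by auto
    then have "u \<in> supp (s *s a + t *s b)" "w \<in> supp (s *s a + t *s b)"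
      using that by (auto simp: supp_def)
    then show False using st(3) that(3,4) unfolding clique_def by blast
  qed
  have Px: "P (?x v) \<or> (\<forall>x\<in>\<Inter>U. x $ v = 0)" if "v \<in> C" for v
    using x_form[OF that] by (auto simp: P_def hyperplane_dot)
  have Ptop: "\<not> (\<forall>x\<in>\<Inter>U. dot a x = 0)" if "P a" for a
    using top[of "hyperplane a"] that by (auto simp: P_def hyperplane_dot)
  have far: "\<forall>x\<in>\<Inter>U. x $ w = 0" if "P (?x u)" "w \<in> C" "u \<noteq> w" "{u, w} \<notin> E" for u w
  proof -
    have "\<not> P (?x w)"
      using clash[OF that(1) _ that(4) that(3), of "?x w"] that(3) by (auto simp: axis_def)
    then show ?thesis using Px[OF that(2)] by blast
  qed
  have PI: "P a" if "a \<in> forms_in (clique_forms E) C" "\<exists>x\<in>\<Inter>U. dot a x \<noteq> 0" for a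
    using that unfolding P_def hyperplane_dot by auto
  have edge_form: "?x u + ?x v \<in> forms_in (clique_forms E) C" if "u \<in> C" "v \<in> C" "u \<noteq> v"
    "{u, v} \<in> E" for u v
  proof (rule form[of _ u v])
    have "(?x u + ?x v) $ u \<noteq> 0" using that(3) by (simp add: axis_def)
    then show "?x u + ?x v \<noteq> 0" by (metis zero_index)
  qed (use that in \<open>auto simp: supp_def axis_def split: if_splits\<close>)
  \<comment> \<open>If the coordinate v did not vanish on the intersection of U, then
    \<open>?x v + ?x w\<close> would be at the top, as w vanishes there, and it would clash with
    \<open>?x u\<close>.\<close>
  have near: "\<forall>x\<in>\<Inter>U. x $ v = 0"
    if "P (?x u)" "v \<in> C" "w \<in> C" "u \<noteq> v" "v \<noteq> w" "u \<noteq> w" "{v, w} \<in> E" "{u, w} \<notin> E" for u v w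
  proof (rule ccontr)
    assume n: "\<not> ?thesis"
    have w: "\<forall>x\<in>\<Inter>U. x $ w = 0" using far that by blast
    have "P (?x v + ?x w)"
      using edge_form[OF that(2,3,5,7)] n w by (intro PI) (auto simp: dot_add_left)
    then show False using clash[OF that(1) _ that(8,6), of "?x v + ?x w"] that(4-6) by (simp add: axis_def)
  qed
  have "\<exists>i<k. P (?x (c i))"
  proof (rule ccontr)
    assume n: "\<not> ?thesis"
    obtain a where a: "a \<in> forms_in (clique_forms E) C" "hyperplane a \<notin> U" using U by blast
    have "\<forall>x\<in>\<Inter>U. x $ v = 0" if "v \<in> C" for v
      using Px[OF that] n that by (metis C_cases)
    moreover have "supp a \<subseteq> C" using a(1) by (simp add: forms_in_def)
    ultimately have "\<forall>x\<in>\<Inter>U. dot a x = 0"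
      unfolding dot_def supp_def by (intro ballI sum.neutral) auto
    then show False using Ptop[of a] a by (simp add: P_def)
  qed
  then obtain i where i: "i < k" "P (?x (c i))" by blast
  obtain p where p: "p < k" "next_ix p = i" using prev_ix[OF i(1)] by blast
  obtain r where r: "r < k" "next_ix r = p" using prev_ix[OF p(1)] by blast
  let ?u = "c i" and ?v = "c (next_ix i)" and ?p = "c p"
  have n2: "next_ix i < k" "next_ix (next_ix i) < k" using i(1) by simp_all
  have d1: "p \<noteq> next_ix i" using next_ix_2[OF p(1)] p(2) by auto
  have d2: "{c i, c (next_ix (next_ix i))} \<notin> E"
    using adj[OF i(1) n2(2)] next_ix_neq[OF n2(1)] next_ix_3[OF i(1)] by auto
  have d3: "{c i, c r} \<notin> E"
    using adj[OF i(1) r(1)] next_ix_neq[OF p(1)] next_ix_3[OF r(1)] p r by auto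
  have d4: "{?v, ?p} \<notin> E"
    using adj[OF n2(1) p(1)] next_ix_neq[OF i(1)] next_ix_3[OF p(1)] p by auto
  have v0: "\<forall>x\<in>\<Inter>U. x $ ?v = 0"
    by (rule near[OF i(2) _ _ _ _ _ _ d2])
      (use i(1) n2 next_ix_neq[OF i(1)] next_ix_neq[OF n2(1)] next_ix_2[OF i(1)] adj[OF n2] in \<open>auto simp: next_ix_neq[THEN not_sym]\<close>)
  have p0: "\<forall>x\<in>\<Inter>U. x $ ?p = 0"
    by (rule near[OF i(2) _ _ _ _ _ _ d3])
      (use i(1) p r next_ix_neq[OF p(1)] next_ix_neq[OF r(1)] next_ix_2[OF r(1)] adj[OF p(1) r(1)] in auto)
  have Pi: "\<not> (\<forall>x\<in>\<Inter>U. x $ ?u = 0)" using Ptop[OF i(2)] by simp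
  have "P (?x ?u + ?x ?v)"
    using edge_form[of ?u ?v] i(1) n2(1) next_ix_neq[OF i(1)] adj[OF i(1) n2(1)] Pi v0
    by (intro PI) (auto simp: dot_add_left next_ix_neq[THEN not_sym])
  moreover have "P (?x ?u + ?x ?p)"
    using edge_form[of ?u ?p] i(1) p next_ix_neq[OF p(1)] adj[OF i(1) p(1)] Pi p0
    by (intro PI) (auto simp: dot_add_left next_ix_neq[THEN not_sym])
  ultimately show False
    by (rule clash[OF _ _ d4])
      (use i(1) p n2(1) d1 next_ix_neq[OF i(1)] next_ix_neq[OF p(1)] in \<open>auto simp: axis_def\<close>)
qed

section \<open>Perfect elimination orderings\<close>

lemma simple_graph_edgeE:
  assumes "simple_graph E" "e \<in> E"
  obtains u v where "e = {u, v}" "u \<noteq> v"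
  using assms unfolding simple_graph_def by (metis card_2_iff)

lemma chordal_no_hole:
  assumes E: "simple_graph E" and ch: "chordal E" and cs: "distinct cs" "4 \<le> length cs"
    and adj: "\<And>i j. i < j \<Longrightarrow> j < length cs \<Longrightarrow> {cs ! i, cs ! j} \<in> E \<longleftrightarrow> j = Suc i \<or> i = 0 \<and> j = length cs - 1"
  shows False
proof -
  let ?k = "length cs"
  have "induced E (set cs) = cycle_edges cs"
  proof (intro equalityI subsetI)
    fix e assume "e \<in> induced E (set cs)"
    then have e: "e \<in> E" "e \<subseteq> set cs" by (auto simp: induced_def)
    obtain u v where uv: "e = {u, v}" "u \<noteq> v" using simple_graph_edgeE[OF E e(1)] .
    obtain i j where ij: "i < ?k" "j < ?k" "u = cs ! i" "v = cs ! j"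
      using e(2) uv(1) by (auto simp: in_set_conv_nth)
    have "\<exists>i j. i < j \<and> j < ?k \<and> e = {cs ! i, cs ! j}"
    proof (cases "i < j")
      case True then show ?thesis using ij uv(1) by blast
    next
      case False
      then have "j < i" using ij uv(2) by (metis linorder_neqE_nat)
      then show ?thesis using ij uv(1) by (intro exI[of _ j] exI[of _ i]) auto
    qed
    then obtain a b where ab: "a < b" "b < ?k" "e = {cs ! a, cs ! b}" by blast
    then have "b = Suc a \<or> a = 0 \<and> b = ?k - 1" using adj e(1) by blast
    then show "e \<in> cycle_edges cs"
    proof
      assume "b = Suc a"
      then show ?thesis unfolding cycle_edges_def using ab by (intro CollectI exI[of _ a]) simp
    next
      assume "a = 0 \<and> b = ?k - 1"
      moreover from this have "Suc b = ?k" using cs(2) by simp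
      ultimately have "Suc b mod ?k = a" "e = {cs ! b, cs ! a}" using ab(3) by auto
      then show ?thesis unfolding cycle_edges_def using ab(2) by (intro CollectI exI[of _ b]) simp
    qed
  next
    fix e assume "e \<in> cycle_edges cs"
    then obtain i where i: "i < ?k" "e = {cs ! i, cs ! (Suc i mod ?k)}" by (auto simp: cycle_edges_def)
    show "e \<in> induced E (set cs)"
    proof (cases "Suc i < ?k")
      case True
      then show ?thesis using i adj[of i "Suc i"] by (auto simp: induced_def)
    next
      case False
      then have "Suc i = ?k" using i(1) by simp
      then have e: "i = ?k - 1" "e = {cs ! 0, cs ! i}" using i(2) by auto
      have "cs ! 0 \<in> set cs" "cs ! i \<in> set cs" using i(1) by (auto intro!: nth_mem)
      moreover have "{cs ! 0, cs ! i} \<in> E" using adj[of 0 i] e(1) i(1) cs(2) by simp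
      ultimately show ?thesis unfolding e(2) induced_def by simp
    qed
  qed
  then show False using ch cs unfolding chordal_def by blast
qed

section \<open>Separators and simplicial vertices of chordal graphs\<close>

definition edge_rel :: "'n set set \<Rightarrow> 'n set \<Rightarrow> ('n \<times> 'n) set" where
  "edge_rel E X = {(u, v). u \<in> X \<and> v \<in> X \<and> {u, v} \<in> E}"

definition conn :: "'n set set \<Rightarrow> 'n set \<Rightarrow> bool" where
  "conn E X \<longleftrightarrow> (\<forall>a\<in>X. \<forall>b\<in>X. (a, b) \<in> (edge_rel E X)\<^sup>*)"

definition outer :: "'n set set \<Rightarrow> 'n set \<Rightarrow> 'n set \<Rightarrow> 'n set" where
  "outer E W X = {z \<in> W - X. \<exists>x\<in>X. {x, z} \<in> E}"

lemma conn_insert: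
  assumes X: "conn E X" and x: "x \<in> X" "{x, z} \<in> E"
  shows "conn E (insert z X)"
proof -
  let ?R = "(edge_rel E (insert z X))\<^sup>*"
  have "edge_rel E X \<subseteq> edge_rel E (insert z X)" by (auto simp: edge_rel_def)
  then have old: "(a, b) \<in> ?R" if "a \<in> X" "b \<in> X" for a b
    using X that rtrancl_mono unfolding conn_def by blast
  have "(x, z) \<in> edge_rel E (insert z X)" "(z, x) \<in> edge_rel E (insert z X)"
    using x by (auto simp: edge_rel_def insert_commute)
  then have "(x, z) \<in> ?R" "(z, x) \<in> ?R" by auto
  then have "(a, x) \<in> ?R" "(x, a) \<in> ?R" if "a \<in> insert z X" for a using old x(1) that by auto
  then show ?thesis unfolding conn_def by (metis rtrancl_trans)
qed

text \<open>A shortest path through \<open>X\<close> between two nonadjacent vertices, closed up by \<open>y\<close>, is a hole.\<close>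

lemma outer_adjacent:
  assumes E: "simple_graph E" and ch: "chordal E" and X: "conn E X" "z \<notin> X" "z' \<notin> X" "z \<noteq> z'"
    and z: "x \<in> X" "{z, x} \<in> E" "x' \<in> X" "{x', z'} \<in> E"
    and y: "y \<notin> X" "{y, z} \<in> E" "{y, z'} \<in> E" "\<And>x. x \<in> X \<Longrightarrow> {y, x} \<notin> E"
  shows "{z, z'} \<in> E"
proof (rule ccontr)
  assume nadj: "{z, z'} \<notin> E"
  define walk where "walk f n \<longleftrightarrow> f 0 = z \<and> f n = z' \<and> (\<forall>i. 0 < i \<longrightarrow> i < n \<longrightarrow> f i \<in> X)
    \<and> (\<forall>i<n. {f i, f (Suc i)} \<in> E)" for f and n :: nat
  have "(x, x') \<in> (edge_rel E X)\<^sup>*" using X(1) z unfolding conn_def by blast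
  then obtain m g where g: "g 0 = x" "g m = x'" "\<And>i. i < m \<Longrightarrow> (g i, g (Suc i)) \<in> edge_rel E X"
    unfolding rtrancl_power relpow_fun_conv by blast
  have gX: "g i \<in> X" if "i \<le> m" for i
  proof (cases "i = m")
    case True then show ?thesis using g z by simp
  next
    case False then show ?thesis using g(3)[of i] that by (simp add: edge_rel_def)
  qed
  define f0 where "f0 i = (if i = 0 then z else if i \<le> Suc m then g (i - 1) else z')" for i
  have "walk f0 (Suc (Suc m))" unfolding walk_def
  proof (intro conjI allI impI)
    show "f0 0 = z" "f0 (Suc (Suc m)) = z'" by (simp_all add: f0_def)
    show "f0 i \<in> X" if "0 < i" "i < Suc (Suc m)" for i using that gX by (simp add: f0_def)
    show "{f0 i, f0 (Suc i)} \<in> E" if i: "i < Suc (Suc m)" for i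
    proof -
      consider "i = 0" | "0 < i" "i \<le> m" | "i = Suc m" using i by linarith
      then show ?thesis
      proof cases
        case 1 then show ?thesis using z g by (simp add: f0_def)
      next
        case 2 then show ?thesis using g(3)[of "i - 1"] by (simp add: f0_def edge_rel_def)
      next
        case 3 then show ?thesis using z g by (simp add: f0_def)
      qed
    qed
  qed
  then have ex: "\<exists>n. \<exists>f. walk f n" by blast
  define n where "n = (LEAST n. \<exists>f. walk f n)"
  obtain f where f: "walk f n" unfolding n_def using LeastI_ex[OF ex] by blast
  have least: "n \<le> n'" if "walk f' n'" for f' n' unfolding n_def by (rule Least_le) (use that in blast)
  have f0: "f 0 = z" and fn: "f n = z'" and fX: "\<And>i. 0 < i \<Longrightarrow> i < n \<Longrightarrow> f i \<in> X"
    and fE: "\<And>i. i < n \<Longrightarrow> {f i, f (Suc i)} \<in> E"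
    using f by (auto simp: walk_def)
  have "n \<noteq> 0" using f0 fn X(4) by metis
  moreover have "n \<noteq> 1" using f0 fn fE[of 0] nadj by auto
  ultimately have n: "2 \<le> n" by simp
  have no_chord: "b = Suc a" if ab: "a < b" "b \<le> n" "{f a, f b} \<in> E" for a b
  proof (rule ccontr)
    assume "b \<noteq> Suc a"
    then have b: "Suc a < b" using ab(1) by simp
    let ?d = "b - Suc a"
    define f' where "f' i = (if i \<le> a then f i else f (i + ?d))" for i
    have "walk f' (n - ?d)" unfolding walk_def
    proof (intro conjI allI impI)
      show "f' 0 = z" "f' (n - ?d) = z'" using f0 fn b ab(2) by (auto simp: f'_def)
      show "f' i \<in> X" if "0 < i" "i < n - ?d" for i using that fX by (auto simp: f'_def)
      show "{f' i, f' (Suc i)} \<in> E" if "i < n - ?d" for i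
      proof -
        consider "i < a" | "i = a" | "a < i" by linarith
        then show ?thesis
        proof cases
          case 1 then show ?thesis using fE[of i] ab by (simp add: f'_def)
        next
          case 2 then show ?thesis using ab(3) b by (simp add: f'_def)
        next
          case 3 then show ?thesis using fE[of "i + ?d"] that by (simp add: f'_def)
        qed
      qed
    qed
    then have "n \<le> n - ?d" by (rule least)
    then show False using b ab(2) by simp
  qed
  \<comment> \<open>If an interior vertex were repeated, the vertex before its first occurrence
    would be adjacent to the later one, a forbidden shortcut. The starting point z cannot recur
    because it is neither in X nor equal to z'.\<close>
  have fne: "f a \<noteq> f b" if ab: "a < b" "b \<le> n" for a b
  proof
    assume eq: "f a = f b"
    show False
    proof (cases "a = 0")
      case True
      then show False using eq f0 fn fX[of b] ab X by (cases "b = n") auto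
    next
      case False
      then have "{f (a - 1), f b} \<in> E" using fE[of "a - 1"] ab eq by simp
      moreover have "a - 1 < b" using ab(1) by simp
      ultimately have "b = Suc (a - 1)" using no_chord ab(2) by blast
      then show False using ab(1) False by simp
    qed
  qed
  have fy: "f i \<noteq> y" if "i \<le> n" for i
  proof -
    have "y \<noteq> z" "y \<noteq> z'" using simple_graphD[OF E] y(2,3) by blast+
    then show ?thesis using f0 fn fX[of i] y(1) that by (cases "i = 0"; cases "i = n") auto
  qed
  \<comment> \<open>With y in front, its edges to z and z' are the first and the closing edge of the
    cycle, and y has no other neighbour on it.\<close>
  define cs where "cs = y # map f [0..<Suc n]"
  have len: "length cs = n + 2" by (simp add: cs_def)
  have nth: "cs ! Suc i = f i" if "i \<le> n" for i
    using that unfolding cs_def by (simp del: upt_Suc)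
  show False
  proof (rule chordal_no_hole[OF E ch, of cs])
    have "inj_on f {0..<Suc n}"
      by (rule linorder_inj_onI) (use fne in auto)
    moreover have "y \<notin> f ` {0..<Suc n}" using fy by (metis atLeastLessThan_iff imageE less_Suc_eq_le)
    ultimately show "distinct cs" unfolding cs_def by (simp add: distinct_map del: upt_Suc)
    show "4 \<le> length cs" using n len by simp
    fix i j assume ij: "i < j" "j < length cs"
    obtain b where b: "j = Suc b" "b \<le> n" using ij len by (cases j) auto
    show "{cs ! i, cs ! j} \<in> E \<longleftrightarrow> j = Suc i \<or> i = 0 \<and> j = length cs - 1"
    proof (cases i)
      case 0
      have "{y, f b} \<in> E \<longleftrightarrow> b = 0 \<or> b = n"
        using f0 fn fX[of b] y b(2) by (cases "b = 0"; cases "b = n") auto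
      then show ?thesis using 0 b nth[of b] len by (simp add: cs_def)
    next
      case (Suc a)
      then have "{f a, f b} \<in> E \<longleftrightarrow> b = Suc a"
        using no_chord[of a b] fE[of a] ij b by auto
      then show ?thesis using Suc b nth[of b] nth[of a] ij by simp
    qed
  qed
qed

text \<open>X is a maximal connected set for which the rest Y, outside X and its boundary
  \<open>outer E W X\<close>, is nonempty. By maximality each boundary vertex is adjacent to all of
  Y, since otherwise it could join X; by chordality the boundary is a clique. A vertex simplicial in
  Y, which exists by induction, is simplicial in W because its further neighbours lie in the
  boundary.\<close>

lemma exists_simplicial:
  fixes E :: "'n::finite set set"
  assumes E: "simple_graph E" and ch: "chordal E" and "W \<noteq> {}"
  shows "\<exists>v\<in>W. clique E (nbrs E v \<inter> W)"
  using finite[of W] assms(3)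
proof (induct W rule: finite_psubset_induct)
  case (psubset W)
  show ?case
  proof (cases "clique E W")
    case True
    then show ?thesis using psubset.prems clique_subset[OF True] by blast
  next
    case False
    let ?good = "\<lambda>X. X \<subseteq> W \<and> X \<noteq> {} \<and> conn E X \<and> W - X - outer E W X \<noteq> {}"
    obtain u w where uw: "u \<in> W" "w \<in> W" "u \<noteq> w" "{u, w} \<notin> E"
      using False by (auto simp: clique_def)
    have "?good {u}" using uw by (auto simp: conn_def outer_def)
    then have "{X. ?good X} \<noteq> {}" by blast
    from finite_has_maximal[OF finite this]
    obtain X where X0: "X \<in> {X. ?good X}" "\<forall>X'\<in>{X. ?good X}. X \<le> X' \<longrightarrow> X = X'" by (elim bexE)
    from X0(1) have X: "?good X" by (rule CollectD)
    have max: "X = X'" if "?good X'" "X \<subseteq> X'" for X'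
      using bspec[OF X0(2) CollectI[of ?good, OF that(1)]] that(2) by (rule mp)
    define Y where "Y = W - X - outer E W X"
    have XY: "{x, y} \<notin> E" if "x \<in> X" "y \<in> Y" for x y using that by (auto simp: Y_def outer_def)
    have full: "{z, y} \<in> E" if z: "z \<in> outer E W X" and y: "y \<in> Y" for z y
    proof (rule ccontr)
      assume n: "{z, y} \<notin> E"
      obtain x where x: "x \<in> X" "{x, z} \<in> E" "z \<in> W" "z \<notin> X" using z by (auto simp: outer_def)
      have "y \<noteq> z" using y z by (auto simp: Y_def)
      then have "y \<in> W - insert z X - outer E W (insert z X)"
      proof -
        have "y \<in> W" "y \<notin> X" using y by (simp_all add: Y_def)
        moreover have "{w, y} \<notin> E" if "w \<in> insert z X" for w using that n XY[OF _ y] by auto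
        ultimately show ?thesis using \<open>y \<noteq> z\<close> by (simp add: outer_def)
      qed
      then have "?good (insert z X)" using X x conn_insert[of E X x z] by auto
      then show False using max[of "insert z X"] x(4) by auto
    qed
    have full': "{y, z} \<in> E" if "z \<in> outer E W X" "y \<in> Y" for z y
      using full[OF that] by (simp add: insert_commute)
    have "Y \<noteq> {}" "Y \<subset> W" using X unfolding Y_def by auto
    then obtain y where y: "y \<in> Y" "clique E (nbrs E y \<inter> Y)" using psubset.hyps(2) by blast
    have out: "{z, z'} \<in> E" if z: "z \<in> outer E W X" "z' \<in> outer E W X" "z \<noteq> z'" for z z'
    proof -
      obtain x x' where x: "x \<in> X" "{x, z} \<in> E" "x' \<in> X" "{x', z'} \<in> E" "z \<notin> X" "z' \<notin> X"
        using z by (auto simp: outer_def)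
      show ?thesis
        by (rule outer_adjacent[OF E ch, of X z z' x x' y])
          (use X x z full'[of z y] full'[of z' y] y XY in \<open>auto simp: insert_commute Y_def\<close>)
    qed
    have "nbrs E y \<inter> W \<subseteq> (nbrs E y \<inter> Y) \<union> outer E W X"
      using XY y(1) by (auto simp: nbrs_def Y_def)
    moreover have "clique E ((nbrs E y \<inter> Y) \<union> outer E W X)"
      using y(2) out full full' unfolding clique_def by blast
    ultimately have "clique E (nbrs E y \<inter> W)" by (rule clique_subset[rotated])
    moreover have "y \<in> W" using y(1) by (simp add: Y_def)
    ultimately show ?thesis by blast
  qed
qed

lemma elimination_list:
  fixes E :: "'n::finite set set"
  assumes E: "simple_graph E" and ch: "chordal E"
  shows "\<exists>vs. distinct vs \<and> set vs = W \<and> (\<forall>i<length vs. clique E (nbrs E (vs ! i) \<inter> set (take i vs)))"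
  using finite[of W]
proof (induct W rule: finite_psubset_induct)
  case (psubset W)
  show ?case
  proof (cases "W = {}")
    case True then show ?thesis by (intro exI[of _ "[]"]) simp
  next
    case False
    then obtain v where v: "v \<in> W" "clique E (nbrs E v \<inter> W)" using exists_simplicial[OF E ch] by blast
    then have "W - {v} \<subset> W" by blast
    from psubset(2)[OF this] obtain vs where vs: "distinct vs" "set vs = W - {v}"
      "\<And>i. i < length vs \<Longrightarrow> clique E (nbrs E (vs ! i) \<inter> set (take i vs))"
      by auto
    have "clique E (nbrs E v \<inter> set vs)" using v(2) by (rule clique_subset) (auto simp: vs(2))
    then have "clique E (nbrs E ((vs @ [v]) ! i) \<inter> set (take i (vs @ [v])))" if "i < length (vs @ [v])" for i
      using that vs(3)[of i] by (cases "i = length vs") (auto simp: nth_append)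
    then show ?thesis using vs v(1) by (intro exI[of _ "vs @ [v]"]) auto
  qed
qed

lemma nbrs_initial_graph:
  assumes E: "simple_graph E" and i: "i < length vs"
  shows "nbrs (initial_graph E vs i) (vs ! i) = nbrs E (vs ! i) \<inter> set (take i vs)"
proof -
  have "set (take (Suc i) vs) = insert (vs ! i) (set (take i vs))"
    using i by (simp add: take_Suc_conv_app_nth)
  then show ?thesis
    by (auto simp: nbrs_def initial_graph_def induced_def dest: simple_graphD[OF E])
qed

lemma simplicial_initial_graph:
  assumes E: "simple_graph E" and i: "i < length vs"
  shows "simplicial (initial_graph E vs i) (vs ! i) \<longleftrightarrow> clique E (nbrs E (vs ! i) \<inter> set (take i vs))"
proof -
  have "set (take i vs) \<subseteq> set (take (Suc i) vs)" by (rule set_take_subset_set_take) simp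
  then show ?thesis
    unfolding simplicial_def nbrs_initial_graph[OF assms]
    by (auto simp: clique_def initial_graph_def induced_def)
qed

theorem chordal_peo:
  fixes E :: "'n::finite set set"
  assumes E: "simple_graph E" and ch: "chordal E"
  shows "\<exists>vs. perfect_elimination_ordering E vs"
  using elimination_list[OF assms, of UNIV] simplicial_initial_graph[OF E]
  unfolding perfect_elimination_ordering_def by metis

section \<open>Induction along an elimination ordering; supersolvability\<close>

lemma peo_step:
  assumes E: "simple_graph E" and peo: "perfect_elimination_ordering E vs" and i: "i < length vs"
  shows "vs ! i \<notin> set (take i vs)" "clique E (nbrs E (vs ! i) \<inter> set (take i vs))"
    "set (take (Suc i) vs) = insert (vs ! i) (set (take i vs))"
proof -
  show "vs ! i \<notin> set (take i vs)"
    using peo i by (auto simp: perfect_elimination_ordering_def in_set_conv_nth nth_eq_iff_index_eq)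
  show "clique E (nbrs E (vs ! i) \<inter> set (take i vs))"
    using peo i simplicial_initial_graph[OF E i] by (simp add: perfect_elimination_ordering_def)
  show "set (take (Suc i) vs) = insert (vs ! i) (set (take i vs))"
    using i by (simp add: take_Suc_conv_app_nth)
qed

text \<open>Supersolvability and freeness use the ordering only through this induction on the set of
  vertices present so far.\<close>

lemma peo_induct:
  assumes E: "simple_graph E" and peo: "perfect_elimination_ordering E vs" and "P {}"
    and step: "\<And>W v. v \<notin> W \<Longrightarrow> clique E (nbrs E v \<inter> W) \<Longrightarrow> P W \<Longrightarrow> P (insert v W)"
  shows "P UNIV"
proof -
  have "P (set (take i vs))" if "i \<le> length vs" for i
    using that
  proof (induct i)
    case (Suc i)
    then show ?case using step[of "vs ! i" "set (take i vs)"] peo_step[OF E peo, of i] by simp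
  qed (simp add: assms(3))
  from this[of "length vs"] show ?thesis using peo by (simp add: perfect_elimination_ordering_def)
qed

lemma forms_in_empty: "0 \<notin> \<Phi> \<Longrightarrow> forms_in \<Phi> {} = {}"
  by (auto simp: forms_in_def)

lemma forms_in_UNIV: "forms_in \<Phi> UNIV = \<Phi>"
  by (simp add: forms_in_def)

lemma graph_forms_at:
  assumes "a \<in> forms_in (graph_forms E) (insert v W)" "a $ v \<noteq> 0" "simple_graph E" "v \<notin> W"
  obtains u where "u \<in> nbrs E v \<inter> W" "a = axis v 1 - axis u 1 \<or> a = axis u 1 - axis v 1"
proof -
  obtain i j where ij: "a = axis i 1 - axis j 1" "{i, j} \<in> E"
    using assms(1) by (auto simp: forms_in_def graph_forms_def)
  have ne: "i \<noteq> j" using simple_graphD[OF assms(3) ij(2)] .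
  then have "i \<in> supp a" "j \<in> supp a" by (auto simp: ij(1) supp_def axis_def)
  then have W: "i \<in> insert v W" "j \<in> insert v W" using assms(1) by (auto simp: forms_in_def)
  have "v = i \<or> v = j" using assms(2) unfolding ij(1) by (auto simp: axis_def split: if_splits)
  then show thesis
  proof
    assume "v = i"
    then show thesis using that[of j] ij W ne by (auto simp: nbrs_def insert_commute)
  next
    assume "v = j"
    then show thesis using that[of i] ij W ne by (auto simp: nbrs_def)
  qed
qed

lemma clique_insertD:
  assumes "clique E C" "C \<subseteq> insert v W" "v \<in> C"
  shows "C \<subseteq> insert v (nbrs E v \<inter> W)"
  using assms unfolding clique_def nbrs_def by blast

text \<open>Two new hyperplanes read \<open>x $ v = x $ u\<close> and \<open>x $ v = x $ w\<close>.
  They meet inside \<open>x $ u = x $ w\<close>, which belongs to the arrangement because the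
  earlier neighbours of v form a clique.\<close>

theorem peo_supersolvable_graph_forms:
  fixes E :: "'n::finite set set"
  assumes E: "simple_graph E" and peo: "perfect_elimination_ordering E vs"
  shows "supersolvable (hyperplane ` graph_forms E :: ('k::field, 'n) arrangement)"
proof -
  let ?\<Phi> = "graph_forms E :: ('k ^ 'n) set"
  have 0: "0 \<notin> ?\<Phi>" by (rule graph_forms_nonzero[OF E])
  have "supersolvable (hyperplane ` forms_in ?\<Phi> UNIV)"
  proof (rule peo_induct[OF E peo, of "\<lambda>W. supersolvable (hyperplane ` forms_in ?\<Phi> W)"])
    show "supersolvable (hyperplane ` forms_in ?\<Phi> {})"
      by (simp add: forms_in_empty[OF 0] supersolvable_empty)
    fix W v assume v: "v \<notin> W" "clique E (nbrs E v \<inter> W)" and ss: "supersolvable (hyperplane ` forms_in ?\<Phi> W)"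
    show "supersolvable (hyperplane ` forms_in ?\<Phi> (insert v W))"
    proof (rule supersolvable_insert[OF ss v(1) 0])
      fix a b assume ab: "a \<in> forms_in ?\<Phi> (insert v W)" "b \<in> forms_in ?\<Phi> (insert v W)" "a $ v \<noteq> 0"
        "b $ v \<noteq> 0"
        "hyperplane a \<noteq> hyperplane b"
      obtain u where u: "u \<in> nbrs E v \<inter> W" "a = axis v 1 - axis u 1 \<or> a = axis u 1 - axis v 1"
        by (rule graph_forms_at[OF ab(1,3) E v(1)])
      obtain w where w: "w \<in> nbrs E v \<inter> W" "b = axis v 1 - axis w 1 \<or> b = axis w 1 - axis v 1"
        by (rule graph_forms_at[OF ab(2,4) E v(1)])
      have ha: "hyperplane a = {x. x $ v = x $ u}" and hb: "hyperplane b = {x. x $ v = x $ w}"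
        using u(2) w(2) by (auto simp: hyperplane_dot dot_diff_left)
      have "u \<noteq> w" using ab(5) ha hb by auto
      then have "{u, w} \<in> E" using v(2) u(1) w(1) unfolding clique_def by blast
      then have "axis u 1 - axis w 1 \<in> ?\<Phi>" by (auto simp: graph_forms_def)
      moreover have "supp (axis u 1 - axis w 1 :: 'k ^ 'n) \<subseteq> W"
        using u(1) w(1) by (auto simp: supp_def axis_def split: if_splits)
      moreover have "hyperplane a \<inter> hyperplane b \<subseteq> hyperplane (axis u 1 - axis w 1)"
        unfolding ha hb by (auto simp: hyperplane_dot dot_diff_left)
      ultimately show "\<exists>c\<in>forms_in ?\<Phi> W. hyperplane a \<inter> hyperplane b \<subseteq> hyperplane c"
        unfolding forms_in_def by blast
    qed
  qed
  then show ?thesis by (simp add: forms_in_UNIV)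
qed

theorem peo_supersolvable_clique_forms:
  fixes E :: "'n::finite set set"
  assumes E: "simple_graph E" and peo: "perfect_elimination_ordering E vs"
  shows "supersolvable (hyperplane ` clique_forms E :: ('k::field, 'n) arrangement)"
proof -
  let ?\<Phi> = "clique_forms E :: ('k ^ 'n) set"
  have 0: "0 \<notin> ?\<Phi>" by (rule clique_forms_nonzero)
  have "supersolvable (hyperplane ` forms_in ?\<Phi> UNIV)"
  proof (rule peo_induct[OF E peo, of "\<lambda>W. supersolvable (hyperplane ` forms_in ?\<Phi> W)"])
    show "supersolvable (hyperplane ` forms_in ?\<Phi> {})"
      by (simp add: forms_in_empty[OF 0] supersolvable_empty)
    fix W v assume v: "v \<notin> W" "clique E (nbrs E v \<inter> W)" and ss: "supersolvable (hyperplane ` forms_in ?\<Phi> W)"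
    show "supersolvable (hyperplane ` forms_in ?\<Phi> (insert v W))"
    proof (rule supersolvable_insert[OF ss v(1) 0])
      fix a b assume ab: "a \<in> forms_in ?\<Phi> (insert v W)" "b \<in> forms_in ?\<Phi> (insert v W)" "a $ v \<noteq> 0"
        "b $ v \<noteq> 0"
        "hyperplane a \<noteq> hyperplane b"
      \<comment> \<open>Eliminates the coordinate v; what remains is supported on earlier neighbours
        of v, hence on a clique.\<close>
      define c where "c = b $ v *s a - a $ v *s b"
      have sub: "supp d \<subseteq> insert v (nbrs E v \<inter> W)" if "d \<in> forms_in ?\<Phi> (insert v W)" "d $ v \<noteq> 0" for d
        using that by (intro clique_insertD) (auto simp: forms_in_def clique_forms_def supp_def)
      have "w \<in> nbrs E v \<inter> W" if w: "w \<in> supp c" for w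
      proof -
        have "w \<noteq> v" using w by (auto simp: supp_def c_def)
        moreover have "w \<in> supp a \<union> supp b" using w by (auto simp: supp_def c_def)
        ultimately show ?thesis using sub[OF ab(1,3)] sub[OF ab(2,4)] by blast
      qed
      then have sc: "supp c \<subseteq> nbrs E v \<inter> W" by blast
      have "c \<noteq> 0"
      proof
        assume "c = 0"
        then have "b = (b $ v / a $ v) *s a"
          using ab(3) by (simp add: c_def vec_eq_iff field_simps)
        then show False using ab(4,5) hyperplane_scale[of "b $ v / a $ v" a] ab(3) by simp
      qed
      then have "c \<in> forms_in ?\<Phi> W"
        using clique_subset[OF v(2) sc] sc by (auto simp: forms_in_def clique_forms_def)
      moreover have "hyperplane a \<inter> hyperplane b \<subseteq> hyperplane c"
        by (auto simp: hyperplane_dot c_def dot_diff_left dot_scale_left)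
      ultimately show "\<exists>c\<in>forms_in ?\<Phi> W. hyperplane a \<inter> hyperplane b \<subseteq> hyperplane c" by blast
    qed
  qed
  then show ?thesis by (simp add: forms_in_UNIV)
qed

section \<open>Bases of derivations along a perfect elimination ordering\<close>

text \<open>The derivations of the subarrangement on W, padded with zeros so that the induction over
  W stays in one ambient module.\<close>

definition der_in :: "('k::field ^ 'n::finite) set \<Rightarrow> 'n set \<Rightarrow> (('k, 'n) mpoly ^ 'n) set" where
  "der_in \<Phi> W = {f. (\<forall>i. i \<notin> W \<longrightarrow> f $ i = 0) \<and> f \<in> der (forms_in \<Phi> W)}"

lemma der_sum_axis:
  "(\<Sum>i\<in>UNIV. mconst (a $ i) * (f + g *s axis v 1) $ i)
    = apply_form a f + mconst (a $ v) * (g :: ('k::comm_ring_1, 'n::finite) mpoly)"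
proof -
  have "(\<Sum>i\<in>UNIV. mconst (a $ i) * (g *s axis v 1) $ i)
      = (\<Sum>i\<in>UNIV. if i = v then mconst (a $ v) * g else 0)"
    by (intro sum.cong) (auto simp: axis_def)
  then show ?thesis by (simp add: distrib_left sum.distrib)
qed

lemma mconst_dvd_cancel:
  fixes p :: "('k::field, 'n) mpoly"
  assumes "c \<noteq> 0"
  shows "mconst c * p dvd mconst c * r \<longleftrightarrow> p dvd r"
proof
  assume "mconst c * p dvd mconst c * r"
  then have "mconst (inverse c) * (mconst c * p) dvd mconst (inverse c) * (mconst c * r)"
    by (rule mult_dvd_mono[OF dvd_refl])
  moreover have "mconst (inverse c) * (mconst c * x) = x" for x :: "('k, 'n) mpoly"
    using assms by (simp flip: mult.assoc mconst_mult)
  ultimately show "p dvd r" by simp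
qed (rule mult_dvd_mono[OF dvd_refl])

text \<open>Restriction to W is onto by the extension hypothesis. A multiple of
  \<open>axis v 1\<close> lies in the module exactly if its coefficient is divisible by all forms
  involving v, that is, by the product Q of these forms made monic in v.\<close>

lemma free_der_insert:
  fixes \<Phi> :: "('k::field ^ 'n::finite) set"
  assumes fin: "finite \<Phi>" and v: "v \<notin> W" and free: "free_submodule (der_in \<Phi> W)"
    and extend: "\<And>f. f \<in> der_in \<Phi> W \<Longrightarrow> \<exists>g. \<forall>a\<in>forms_in \<Phi> (insert v W). a $ v \<noteq> 0 \<longrightarrow>
      linear_form a dvd apply_form a f + mconst (a $ v) * g"
  shows "free_submodule (der_in \<Phi> (insert v W))"
proof -
  interpret module "(*s) :: ('k, 'n) mpoly \<Rightarrow> ('k, 'n) mpoly ^ 'n \<Rightarrow> ('k, 'n) mpoly ^ 'n"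
    by (rule module_vec)
  let ?F = "{a \<in> forms_in \<Phi> (insert v W). a $ v \<noteq> 0}"
  define L where "L a = linear_form (\<chi> i. if i = v then 0 else - a $ i / a $ v)" for a :: "'k ^ 'n"
  have L: "indep v (L a)" for a unfolding L_def by (rule indep_linear_form) simp
  have lin: "linear_form a = mconst (a $ v) * (mvar v - L a)" if "a $ v \<noteq> 0" for a
  proof -
    have "a = a $ v *s (axis v 1 + (- 1) *s (\<chi> i. if i = v then 0 else - a $ i / a $ v))"
      using that by (simp add: vec_eq_iff axis_def)
    then have "linear_form a = linear_form \<dots>" by simp
    then show ?thesis
      unfolding linear_form_scale linear_form_add linear_form_axis L_def[symmetric]
      by (simp add: mconst_uminus)
  qed
  \<comment> \<open>The product runs over the image of \<open>L\<close>, so that proportional forms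
    contribute a single factor.\<close>
  define Q where "Q = (\<Prod>l\<in>L ` ?F. mvar v - l)"
  have finF: "finite ?F" using fin by (simp add: forms_in_def)
  have Qnz: "Q \<noteq> 0"
    unfolding Q_def
  proof (rule mpoly_prod_nonzero)
    fix l assume "l \<in> L ` ?F"
    then obtain a where a: "l = L a" by blast
    show "mvar v - l \<noteq> 0"
    proof
      assume "mvar v - l = 0"
      then have "sub v 0 (mvar v) = sub v 1 (mvar v :: ('k, 'n) mpoly)"
        using L[of a] a by (simp add: indep_def)
      then show False by simp
    qed
  qed
  have kernel: "Q dvd c \<longleftrightarrow> (\<forall>a\<in>?F. linear_form a dvd mconst (a $ v) * c)" for c
  proof
    assume "Q dvd c"
    moreover have "mvar v - L a dvd Q" if "a \<in> ?F" for a
      unfolding Q_def using finF that by (intro dvd_prodI) auto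
    ultimately show "\<forall>a\<in>?F. linear_form a dvd mconst (a $ v) * c"
      by (auto simp: lin mconst_dvd_cancel intro: dvd_trans)
  next
    assume "\<forall>a\<in>?F. linear_form a dvd mconst (a $ v) * c"
    then have "\<forall>a\<in>?F. mvar v - L a dvd c" by (auto simp: lin mconst_dvd_cancel)
    then show "Q dvd c" unfolding Q_def using finF L by (intro prod_dvd_mpoly) auto
  qed
  have mem: "f + g *s axis v 1 \<in> der_in \<Phi> (insert v W)
    \<longleftrightarrow> (\<forall>a\<in>?F. linear_form a dvd apply_form a f + mconst (a $ v) * g)"
    if "f \<in> der_in \<Phi> W" for f g
  proof -
    have "\<forall>i. i \<notin> insert v W \<longrightarrow> (f + g *s axis v 1) $ i = 0"
      using that by (auto simp: der_in_def axis_def)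
    moreover have "linear_form a dvd apply_form a f + mconst (a $ v) * g"
      if "a \<in> forms_in \<Phi> (insert v W)" "a $ v = 0" for a
      using \<open>f \<in> der_in \<Phi> W\<close> that forms_in_insert[OF v, of a \<Phi>] by (auto simp: der_in_def der_def)
    ultimately show ?thesis
      unfolding der_in_def[of \<Phi> "insert v W"] der_def mem_Collect_eq der_sum_axis by blast
  qed
  have sub: "subspace (der_in \<Phi> U)" for U
    using subspace_der[of "forms_in \<Phi> U"] unfolding der_in_def subspace_def by auto
  show ?thesis
  proof (rule free_submodule_extend[OF mpoly_no_zero_divisors free sub, where v = v and Q = Q])
    show "f $ v = 0" if "f \<in> der_in \<Phi> W" for f using that v by (simp add: der_in_def)
    show "f - f $ v *s axis v 1 \<in> der_in \<Phi> W" if f: "f \<in> der_in \<Phi> (insert v W)" for f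
    proof -
      have "(f - f $ v *s axis v 1) $ i = 0" if "i \<notin> W" for i
        using that f by (cases "i = v") (auto simp: der_in_def axis_def)
      moreover have "linear_form a dvd (\<Sum>i\<in>UNIV. mconst (a $ i) * (f + (- f $ v) *s axis v 1) $ i)"
        if "a \<in> forms_in \<Phi> W" for a
        unfolding der_sum_axis using that f forms_in_insert[OF v, of a \<Phi>] by (auto simp: der_in_def der_def)
      moreover have "f + (- f $ v) *s axis v 1 = f - f $ v *s axis v 1" by simp
      ultimately show ?thesis unfolding der_in_def der_def by auto
    qed
    show "\<exists>g. f + g *s axis v 1 \<in> der_in \<Phi> (insert v W)" if "f \<in> der_in \<Phi> W" for f
      using extend[OF that] unfolding mem[OF that] by auto
    show "c *s axis v 1 \<in> der_in \<Phi> (insert v W) \<longleftrightarrow> Q dvd c" for c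
      using mem[OF subspace_0[OF sub], of c] unfolding kernel by simp
    show "Q \<noteq> 0" by (rule Qnz)
  qed
qed

lemma free_der_empty: "free_submodule (der_in (\<Phi> :: ('k::field ^ 'n::finite) set) {})"
proof -
  interpret module "(*s) :: ('k, 'n) mpoly \<Rightarrow> ('k, 'n) mpoly ^ 'n \<Rightarrow> ('k, 'n) mpoly ^ 'n"
    by (rule module_vec)
  have "der_in \<Phi> {} = {0}" by (auto simp: der_in_def der_def vec_eq_iff)
  moreover have "\<not> dependent ({} :: (('k, 'n) mpoly ^ 'n) set)" by (rule independent_empty)
  ultimately show ?thesis unfolding free_submodule_def using span_empty by blast
qed

lemma der_in_UNIV: "der_in \<Phi> UNIV = der \<Phi>"
  by (simp add: der_in_def forms_in_UNIV)

text \<open>When u is added, the correction is c times the product of \<open>x - l\<close> over the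
  old nodes. The factor c exists because each \<open>mvar u - mvar w\<close> divides the error at u.
  Of the interpolating polynomial only the congruence property of the function \<open>\<tau>\<close>
  is kept.\<close>

lemma graph_interpolation:
  fixes f :: "'n::finite \<Rightarrow> ('k::field, 'n) mpoly"
  assumes "finite N" "\<And>u w. u \<in> N \<Longrightarrow> w \<in> N \<Longrightarrow> u \<noteq> w \<Longrightarrow> mvar u - mvar w dvd f u - f w"
  shows "\<exists>\<tau>. (\<forall>x y. x - y dvd \<tau> x - \<tau> y) \<and> (\<forall>u\<in>N. \<tau> (mvar u) = f u)"
  using assms
proof (induct N)
  case empty
  then show ?case by (intro exI[of _ "\<lambda>_. 0"]) simp
next
  case (insert u N)
  have "\<exists>\<tau>. (\<forall>x y. x - y dvd \<tau> x - \<tau> y) \<and> (\<forall>u\<in>N. \<tau> (mvar u) = f u)"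
    by (rule insert.hyps(3)) (rule insert.prems, auto)
  then obtain \<tau> where "(\<forall>x y. x - y dvd \<tau> x - \<tau> y) \<and> (\<forall>u\<in>N. \<tau> (mvar u) = f u)" ..
  then have \<tau>: "\<And>x y. x - y dvd \<tau> x - \<tau> y" "\<And>w. w \<in> N \<Longrightarrow> \<tau> (mvar w) = f w" by simp_all
  have "(\<Prod>l\<in>mvar ` N. mvar u - l) dvd f u - \<tau> (mvar u)"
  proof (rule prod_dvd_mpoly)
    fix l :: "('k, 'n) mpoly" assume "l \<in> mvar ` N"
    then obtain w where w: "w \<in> N" "l = mvar w" by blast
    have "w \<noteq> u" using w insert.hyps by blast
    then show "indep u l" by (simp add: w indep_def)
    have "mvar u - mvar w dvd (f u - f w) - (\<tau> (mvar u) - \<tau> (mvar w))"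
      using w(1) \<open>w \<noteq> u\<close> by (intro dvd_diff[OF insert.prems \<tau>(1)]) auto
    then show "mvar u - l dvd f u - \<tau> (mvar u)" using \<tau>(2)[OF w(1)] w(2) by simp
  qed (use insert.hyps in simp)
  then obtain c where c: "f u - \<tau> (mvar u) = (\<Prod>l\<in>mvar ` N. mvar u - l) * c" by (elim dvdE)
  define \<sigma> where "\<sigma> x = \<tau> x + (\<Prod>l\<in>mvar ` N. x - l) * c" for x
  have "x - y dvd \<sigma> x - \<sigma> y" for x y
  proof -
    have "\<sigma> x - \<sigma> y = (\<tau> x - \<tau> y) + ((\<Prod>l\<in>mvar ` N. x - l) - (\<Prod>l\<in>mvar ` N. y - l)) * c"
      by (simp add: \<sigma>_def algebra_simps)
    moreover have "x - y dvd (\<Prod>l\<in>mvar ` N. x - l) - (\<Prod>l\<in>mvar ` N. y - l)"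
      by (rule prod_diff_dvd) simp
    ultimately show ?thesis using \<tau>(1) by (simp add: dvd_add dvd_mult2)
  qed
  moreover have "\<sigma> (mvar w) = f w" if "w \<in> insert u N" for w
  proof (cases "w \<in> N")
    case True
    then have "(\<Prod>l\<in>mvar ` N. mvar w - l :: ('k, 'n) mpoly) = 0"
      using insert.hyps(1) by (intro prod_zero) auto
    then show ?thesis using \<tau>(2)[OF True] by (simp add: \<sigma>_def)
  next
    case False
    then have "w = u" using that by simp
    then show ?thesis using c by (simp add: \<sigma>_def algebra_simps)
  qed
  ultimately show ?case by blast
qed

theorem peo_free_graph_forms:
  fixes E :: "'n::finite set set"
  assumes E: "simple_graph E" and peo: "perfect_elimination_ordering E vs"
  shows "free_submodule (der (graph_forms E :: ('k::field ^ 'n) set))"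
proof -
  let ?\<Phi> = "graph_forms E :: ('k ^ 'n) set"
  have "free_submodule (der_in ?\<Phi> UNIV)"
  proof (rule peo_induct[OF E peo, of "\<lambda>W. free_submodule (der_in ?\<Phi> W)"])
    show "free_submodule (der_in ?\<Phi> {})" by (rule free_der_empty)
    fix W v assume v: "v \<notin> W" "clique E (nbrs E v \<inter> W)" and free: "free_submodule (der_in ?\<Phi> W)"
    let ?N = "nbrs E v \<inter> W"
    show "free_submodule (der_in ?\<Phi> (insert v W))"
    proof (rule free_der_insert[OF finite_graph_forms v(1) free])
      fix f assume f: "f \<in> der_in ?\<Phi> W"
      have int: "mvar u - mvar w dvd f $ u - f $ w" if uw: "u \<in> ?N" "w \<in> ?N" "u \<noteq> w" for u w
      proof -
        have "{u, w} \<in> E" using v(2) uw unfolding clique_def by blast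
        moreover have "supp (axis u 1 - axis w 1 :: 'k ^ 'n) \<subseteq> W"
          using uw by (auto simp: supp_def axis_def split: if_splits)
        ultimately have "axis u 1 - axis w 1 \<in> forms_in ?\<Phi> W"
          unfolding forms_in_def graph_forms_def by blast
        then have "linear_form (axis u 1 - axis w 1)
          dvd (\<Sum>i\<in>UNIV. mconst ((axis u 1 - axis w 1 :: 'k ^ 'n) $ i) * f $ i)"
          using f unfolding der_in_def der_def by blast
        then show ?thesis unfolding der_graph_forms[OF uw(3)] .
      qed
      obtain \<tau> where "(\<forall>x y. x - y dvd \<tau> x - \<tau> y) \<and> (\<forall>u\<in>?N. \<tau> (mvar u) = f $ u)"
        using graph_interpolation[of ?N "\<lambda>u. f $ u", OF finite int] ..
      then have \<tau>: "\<And>x y. x - y dvd \<tau> x - \<tau> y" "\<And>u. u \<in> ?N \<Longrightarrow> \<tau> (mvar u) = f $ u" by auto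
      show "\<exists>g. \<forall>a\<in>forms_in ?\<Phi> (insert v W). a $ v \<noteq> 0 \<longrightarrow>
        linear_form a dvd apply_form a f + mconst (a $ v) * g"
      \<comment> \<open>The congruence between the values of \<open>\<tau>\<close> at
        \<open>mvar v\<close> and at a node \<open>mvar u\<close> is the condition for the edge from
        v to u.\<close>
      proof (intro exI[of _ "\<tau> (mvar v)"] ballI impI)
        fix a assume a: "a \<in> forms_in ?\<Phi> (insert v W)" "a $ v \<noteq> 0"
        obtain u where u: "u \<in> ?N" "a = axis v 1 - axis u 1 \<or> a = axis u 1 - axis v 1"
          by (rule graph_forms_at[OF a E v(1)])
        have ne: "v \<noteq> u" "u \<noteq> v" using u(1) v(1) by auto
        have fv: "f $ v = 0" using f v(1) by (simp add: der_in_def)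
        have d: "mvar v - mvar u dvd \<tau> (mvar v) - f $ u" "mvar u - mvar v dvd f $ u - \<tau> (mvar v)"
          using \<tau>(1)[of "mvar v" "mvar u"] \<tau>(1)[of "mvar u" "mvar v"] \<tau>(2)[OF u(1)] by auto
        from u(2) show "linear_form a dvd apply_form a f + mconst (a $ v) * \<tau> (mvar v)"
        proof
          assume a: "a = axis v 1 - axis u 1"
          then have "a $ v = 1" using ne by (simp add: axis_def)
          then show ?thesis using d(1) unfolding a der_graph_forms[OF ne(1)] by (simp add: fv)
        next
          assume a: "a = axis u 1 - axis v 1"
          then have "a $ v = - 1" using ne by (simp add: axis_def)
          then show ?thesis using d(2) unfolding a der_graph_forms[OF ne(2)] by (simp add: fv mconst_uminus)
        qed
      qed
    qed
  qed
  then show ?thesis by (simp add: der_in_UNIV)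
qed

text \<open>Over a finite field, the interpolating functions are the \<open>q\<close>-polynomials
  \<open>x \<mapsto> c\<^sub>0 x + c\<^sub>1 x\<^sup>q + c\<^sub>2 x\<^sup>q\<^sup>2 + \<dots>\<close>, of which only the following properties matter.\<close>

definition linearized :: "(('k::field, 'n::finite) mpoly \<Rightarrow> ('k, 'n) mpoly) \<Rightarrow> bool" where
  "linearized \<tau> \<longleftrightarrow> (\<forall>x y. \<tau> (x + y) = \<tau> x + \<tau> y) \<and> (\<forall>c x. \<tau> (mconst c * x) = mconst c * \<tau> x)
     \<and> (\<forall>x. x dvd \<tau> x)"

lemma linearized_linear_form:
  assumes "linearized \<tau>"
  shows "\<tau> (linear_form a) = (\<Sum>i\<in>UNIV. mconst (a $ i) * \<tau> (mvar i))"
proof -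
  have "\<tau> 0 = 0" using assms unfolding linearized_def by (metis add_cancel_left_right add.right_neutral)
  then have "\<tau> (\<Sum>i\<in>A. mconst (a $ i) * mvar i) = (\<Sum>i\<in>A. mconst (a $ i) * \<tau> (mvar i))" for A
    using assms by (induct A rule: infinite_finite_induct) (auto simp: linearized_def)
  then show ?thesis by (simp add: linear_form_eq)
qed

text \<open>The product of the translates of x by the span of the variables in N serves as the nodal
  polynomial. When y is added, the translates are grouped by the multiples of \<open>mvar y\<close>,
  and the product of \<open>Q x + mconst t * Q (mvar y)\<close> over all t is \<open>R x\<close>.
  Additivity of \<open>R\<close> comes from the Frobenius map.\<close>

lemma exists_linearized_product:
  assumes q: "primepow (CARD('k::{field, finite}))" and "finite N"
  shows "\<exists>Q. linearized Q \<and> (\<forall>w\<in>N. Q (mvar w) = 0)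
    \<and> (\<forall>x :: ('k, 'n::finite) mpoly. Q x = (\<Prod>a\<in>{a. supp a \<subseteq> N}. x + linear_form a))"
  using assms(2)
proof (induct N)
  case empty
  have "{a :: 'k ^ 'n. supp a \<subseteq> {}} = {0}" by auto
  then show ?case by (intro exI[of _ "\<lambda>x. x"]) (simp add: linearized_def)
next
  case (insert y N)
  let ?q = "CARD('k)" and ?V = "\<lambda>N. {a :: 'k ^ 'n. supp a \<subseteq> N}"
  obtain Q where "linearized Q \<and> (\<forall>w\<in>N. Q (mvar w) = 0)
    \<and> (\<forall>x :: ('k, 'n) mpoly. Q x = (\<Prod>a\<in>?V N. x + linear_form a))"
    using insert.hyps(3) ..
  then have Q: "linearized Q" "\<And>w. w \<in> N \<Longrightarrow> Q (mvar w) = 0"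
    "\<And>x. Q x = (\<Prod>a\<in>?V N. x + linear_form a)" by blast+
  have Ql: "Q (x + z) = Q x + Q z" "Q (mconst c * x) = mconst c * Q x" "x dvd Q x" for x z c
    using Q(1) by (simp_all add: linearized_def)
  define R where "R x = Q x ^ ?q - Q x * Q (mvar y) ^ (?q - 1)" for x
  have q0: "0 < ?q" using card_field_ge_2[where 'k = 'k] by simp
  have "c ^ ?q = c" for c :: 'k
  proof (cases "c = 0")
    case False
    then have "c ^ Suc (?q - 1) = c" by (simp only: power_Suc finite_field_power_eq_1[OF False] mult_1_right)
    then show ?thesis using q0 by simp
  qed (use q0 in simp)
  then have pw: "(mconst c * p) ^ ?q = mconst c * p ^ ?q" for c and p :: "('k, 'n) mpoly"
    by (simp add: power_mult_distrib flip: mconst_power)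
  have q1: "Suc (?q - 1) = ?q" using q0 by simp
  have lin: "linearized R"
    unfolding linearized_def
  proof (intro conjI allI)
    show "R (x + z) = R x + R z" for x z
      unfolding R_def Ql(1) mpoly_frobenius_add[OF q] by (simp add: algebra_simps)
    show "R (mconst c * x) = mconst c * R x" for c x
      unfolding R_def Ql(2) pw by (simp add: right_diff_distrib mult.assoc)
    show "x dvd R x" for x
      unfolding R_def using dvd_trans[OF Ql(3) dvd_power[of ?q "Q x"]] q0 dvd_mult2[OF Ql(3)]
      by (intro dvd_diff) auto
  qed
  have "R (mvar y) = Q (mvar y) ^ Suc (?q - 1) - Q (mvar y) * Q (mvar y) ^ (?q - 1)"
    unfolding R_def q1 ..
  then have "R (mvar y) = 0" by (simp only: power_Suc diff_self)
  moreover have "R (mvar w) = 0" if "w \<in> N" for w using Q(2)[OF that] q0 by (simp add: R_def power_0_left)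
  moreover have "R x = (\<Prod>a\<in>?V (insert y N). x + linear_form a)" for x
  proof -
    let ?g = "\<lambda>(t, a). a + t *s axis y 1 :: 'k ^ 'n"
    have z: "a $ y = 0" if "supp a \<subseteq> N" for a :: "'k ^ 'n"
      using that insert.hyps(2) by (auto simp: supp_def)
    have bij: "bij_betw ?g (UNIV \<times> ?V N) (?V (insert y N))"
    proof (rule bij_betwI[of _ _ _ "\<lambda>a. (a $ y, a - a $ y *s axis y 1)"])
      show "?g \<in> UNIV \<times> ?V N \<rightarrow> ?V (insert y N)"
        by (auto simp: supp_def axis_def split: if_splits)
      show "(\<lambda>a. (a $ y, a - a $ y *s axis y 1)) \<in> ?V (insert y N) \<rightarrow> UNIV \<times> ?V N"
        by (auto simp: supp_def axis_def split: if_splits)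
    qed (auto simp: z axis_def)
    have "(\<Prod>a\<in>?V (insert y N). x + linear_form a) = (\<Prod>p\<in>UNIV \<times> ?V N. x + linear_form (?g p))"
      by (rule prod.reindex_bij_betw[OF bij, symmetric])
    also have "\<dots> = (\<Prod>(t, a)\<in>UNIV \<times> ?V N. (x + mconst t * mvar y) + linear_form a)"
      by (intro prod.cong) (auto simp: linear_form_add linear_form_scale linear_form_axis)
    also have "\<dots> = (\<Prod>t\<in>UNIV. \<Prod>a\<in>?V N. (x + mconst t * mvar y) + linear_form a)"
      by (rule prod.cartesian_product[symmetric])
    also have "\<dots> = (\<Prod>t\<in>UNIV. Q x + mconst t * Q (mvar y))"
      unfolding Q(3)[symmetric] Ql(1,2) ..
    also have "\<dots> = R x" unfolding R_def by (rule prod_linear_field)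
    finally show ?thesis by simp
  qed
  ultimately show ?case using lin by (intro exI[of _ R] conjI) blast+
qed

text \<open>Newton interpolation by linearized functions, with Q as nodal function. The correction
  at u exists because every \<open>mvar u + linear_form a\<close> with a supported on N divides the
  error \<open>f u - \<tau> (mvar u)\<close>: it divides the values that f and \<open>\<tau>\<close>
  assign to this form, and since these agree on N, their difference is the error.\<close>

lemma clique_interpolation:
  fixes f :: "'n::finite \<Rightarrow> ('k::{field, finite}, 'n) mpoly"
  assumes q: "primepow (CARD('k))" and "finite N"
    and "\<And>a. supp a \<subseteq> N \<Longrightarrow> a \<noteq> 0 \<Longrightarrow> linear_form a dvd (\<Sum>i\<in>UNIV. mconst (a $ i) * f i)"
  shows "\<exists>\<tau>. linearized \<tau> \<and> (\<forall>u\<in>N. \<tau> (mvar u) = f u)"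
  using assms(2,3)
proof (induct N)
  case empty
  then show ?case by (intro exI[of _ "\<lambda>_. 0"]) (simp add: linearized_def)
next
  case (insert u N)
  have "\<exists>\<tau>. linearized \<tau> \<and> (\<forall>u\<in>N. \<tau> (mvar u) = f u)"
    by (rule insert.hyps(3)) (rule insert.prems, auto)
  then obtain \<tau> where \<tau>: "linearized \<tau>" "\<And>w. w \<in> N \<Longrightarrow> \<tau> (mvar w) = f w" by auto
  obtain Q where "linearized Q \<and> (\<forall>w\<in>N. Q (mvar w) = 0)
    \<and> (\<forall>x :: ('k, 'n) mpoly. Q x = (\<Prod>a\<in>{a. supp a \<subseteq> N}. x + linear_form a))"
    using exists_linearized_product[OF q insert.hyps(1)] ..
  then have Q: "linearized Q" "\<And>w. w \<in> N \<Longrightarrow> Q (mvar w) = 0"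
    "\<And>x. Q x = (\<Prod>a\<in>{a. supp a \<subseteq> N}. x + linear_form a)" by blast+
  let ?T = "(\<lambda>a :: 'k ^ 'n. - linear_form a) ` {a. supp a \<subseteq> N}"
  have inj: "inj_on (\<lambda>a :: 'k ^ 'n. - linear_form a) {a. supp a \<subseteq> N}"
    by (rule inj_onI) (simp add: linear_form_inj)
  have "(\<Prod>l\<in>?T. mvar u - l) dvd f u - \<tau> (mvar u)"
  proof (rule prod_dvd_mpoly)
    fix l assume "l \<in> ?T"
    then obtain a where a: "supp a \<subseteq> N" "l = - linear_form a" by blast
    have au: "a $ u = 0" using a(1) insert.hyps(2) by (auto simp: supp_def)
    then have "indep u (linear_form a)" by (rule indep_linear_form)
    then show "indep u l" by (simp add: a(2) indep_def sub.ev_uminus)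
    let ?b = "a + 1 *s axis u 1"
    have "?b $ u = 1" using au by (simp add: axis_def)
    then have "?b \<noteq> 0" by (metis zero_index zero_neq_one)
    moreover have "supp ?b \<subseteq> insert u N" using a(1) by (auto simp: supp_def axis_def split: if_splits)
    ultimately have d: "linear_form ?b dvd (\<Sum>i\<in>UNIV. mconst (?b $ i) * f i)" by (intro insert.prems)
    have s: "(\<Sum>i\<in>UNIV. mconst (?b $ i) * g i) = (\<Sum>i\<in>UNIV. mconst (a $ i) * g i) + g u"
      for g :: "'n \<Rightarrow> ('k, 'n) mpoly"
    proof -
      have "mconst (?b $ i) * g i = mconst (a $ i) * g i + (if i = u then g u else 0)" for i
        by (auto simp: axis_def mconst_add algebra_simps)
      then show ?thesis by (simp add: sum.distrib)
    qed
    have "linear_form ?b dvd \<tau> (linear_form ?b)" using \<tau>(1) by (simp add: linearized_def)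
    then have d': "linear_form ?b dvd (\<Sum>i\<in>UNIV. mconst (?b $ i) * \<tau> (mvar i))"
      unfolding linearized_linear_form[OF \<tau>(1)] .
    have "(\<Sum>i\<in>UNIV. mconst (a $ i) * \<tau> (mvar i)) = (\<Sum>i\<in>UNIV. mconst (a $ i) * f i)"
    proof (rule sum.cong)
      fix i show "mconst (a $ i) * \<tau> (mvar i) = mconst (a $ i) * f i"
        using a(1) \<tau>(2)[of i] by (cases "a $ i = 0") (auto simp: supp_def)
    qed simp
    then have "(\<Sum>i\<in>UNIV. mconst (?b $ i) * f i) - (\<Sum>i\<in>UNIV. mconst (?b $ i) * \<tau> (mvar i))
      = f u - \<tau> (mvar u)"
      unfolding s by simp
    moreover have "linear_form ?b = mvar u - l"
      by (simp only: linear_form_add linear_form_scale linear_form_axis a(2)) (simp add: add.commute)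
    ultimately show "mvar u - l dvd f u - \<tau> (mvar u)" using dvd_diff[OF d d'] by metis
  qed simp
  then have "Q (mvar u) dvd f u - \<tau> (mvar u)"
    unfolding prod.reindex[OF inj] Q(3) by simp
  then obtain c where c: "f u - \<tau> (mvar u) = Q (mvar u) * c" by (elim dvdE)
  have "linearized (\<lambda>x. \<tau> x + c * Q x)"
    using \<tau>(1) Q(1) by (auto simp: linearized_def algebra_simps)
  moreover have "\<tau> (mvar w) + c * Q (mvar w) = f w" if "w \<in> insert u N" for w
    using that c \<tau>(2) Q(2) by (cases "w \<in> N") (auto simp: algebra_simps)
  ultimately show ?case by (intro exI[of _ "\<lambda>x. \<tau> x + c * Q x"]) auto
qed

theorem peo_free_clique_forms:
  fixes E :: "'n::finite set set"
  assumes E: "simple_graph E" and peo: "perfect_elimination_ordering E vs" and q: "primepow (CARD('k))"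
  shows "free_submodule (der (clique_forms E :: ('k::{field, finite} ^ 'n) set))"
proof -
  let ?\<Phi> = "clique_forms E :: ('k ^ 'n) set"
  have "free_submodule (der_in ?\<Phi> UNIV)"
  proof (rule peo_induct[OF E peo, of "\<lambda>W. free_submodule (der_in ?\<Phi> W)"])
    show "free_submodule (der_in ?\<Phi> {})" by (rule free_der_empty)
    fix W v assume v: "v \<notin> W" "clique E (nbrs E v \<inter> W)" and free: "free_submodule (der_in ?\<Phi> W)"
    let ?N = "nbrs E v \<inter> W"
    show "free_submodule (der_in ?\<Phi> (insert v W))"
    proof (rule free_der_insert[OF _ v(1) free])
      show "finite ?\<Phi>" by simp
      fix f assume f: "f \<in> der_in ?\<Phi> W"
      have "linear_form a dvd apply_form a f" if "supp a \<subseteq> ?N" "a \<noteq> 0" for a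
      proof -
        have "a \<in> forms_in ?\<Phi> W"
          using that clique_subset[OF v(2) that(1)] by (auto simp: forms_in_def clique_forms_def)
        then show ?thesis using f unfolding der_in_def der_def by blast
      qed
      from clique_interpolation[OF q finite, of ?N "\<lambda>u. f $ u", OF this]
      obtain \<tau> where "linearized \<tau> \<and> (\<forall>u\<in>?N. \<tau> (mvar u) = f $ u)" ..
      then have \<tau>: "linearized \<tau>" "\<And>u. u \<in> ?N \<Longrightarrow> \<tau> (mvar u) = f $ u" by auto
      show "\<exists>g. \<forall>a\<in>forms_in ?\<Phi> (insert v W). a $ v \<noteq> 0 \<longrightarrow>
        linear_form a dvd apply_form a f + mconst (a $ v) * g"
      proof (intro exI[of _ "\<tau> (mvar v)"] ballI impI)
        fix a assume a: "a \<in> forms_in ?\<Phi> (insert v W)" "a $ v \<noteq> 0"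
        have sub: "supp a \<subseteq> insert v ?N"
          using a by (intro clique_insertD) (auto simp: forms_in_def clique_forms_def supp_def)
        have fv: "f $ v = 0" using f v(1) by (simp add: der_in_def)
        \<comment> \<open>On the support of a, the extended derivation has the values of
          \<open>\<tau>\<close> as coordinates. By linearity it sends the form to its image under
          \<open>\<tau>\<close>, a multiple of the form.\<close>
        have "(f + \<tau> (mvar v) *s axis v 1) $ i = \<tau> (mvar i)" if "a $ i \<noteq> 0" for i
          using that sub \<tau>(2)[of i] fv v(1) by (cases "i = v") (auto simp: supp_def axis_def)
        then have "(\<Sum>i\<in>UNIV. mconst (a $ i) * (f + \<tau> (mvar v) *s axis v 1) $ i) = \<tau> (linear_form a)"
          unfolding linearized_linear_form[OF \<tau>(1)] by (intro sum.cong refl) (metis mconst_0 mult_zero_left)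
        then show "linear_form a dvd apply_form a f + mconst (a $ v) * \<tau> (mvar v)"
          using \<tau>(1) unfolding der_sum_axis by (simp add: linearized_def)
      qed
    qed
  qed
  then show ?thesis by (simp add: der_in_UNIV)
qed

section \<open>The characteristic polynomial by counting tuples\<close>

lemma moebius_sum:
  fixes L :: "'a set set"
  assumes "finite L" "UNIV \<in> L" "X \<in> L"
  shows "(\<Sum>Y\<in>{Y \<in> L. X \<subseteq> Y}. moebius L UNIV Y) = (if X = UNIV then 1 else 0)"
proof (cases "X = UNIV")
  case True
  then have "{Y \<in> L. X \<subseteq> Y} = {UNIV}" using assms by auto
  then show ?thesis using True assms(1) by (simp add: moebius.simps)
next
  case False
  then have "moebius L UNIV X = - (\<Sum>Y\<in>{Y \<in> L. X \<subset> Y \<and> Y \<subseteq> UNIV}. moebius L UNIV Y)"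
    using assms(1) by (subst moebius.simps) (auto simp: psubset_eq)
  moreover have "{Y \<in> L. X \<subseteq> Y} = insert X {Y \<in> L. X \<subset> Y \<and> Y \<subseteq> UNIV}" using assms(3) by auto
  ultimately show ?thesis using False assms(1) by simp
qed

lemma card_subspace:
  fixes X :: "('k::{field, finite} ^ 'n::finite) set"
  assumes "vec.subspace X"
  shows "card X = CARD('k) ^ vec.dim X"
proof -
  obtain B where B: "B \<subseteq> X" "vec.independent B" "X \<subseteq> vec.span B" "card B = vec.dim X"
    using vec.basis_exists[of X] by blast
  have fin: "finite B" by simp
  let ?g = "\<lambda>c. \<Sum>b\<in>B. c b *s b"
  have "inj_on ?g (B \<rightarrow>\<^sub>E UNIV)"
  proof (rule inj_onI)
    fix c d assume cd: "c \<in> B \<rightarrow>\<^sub>E UNIV" "d \<in> B \<rightarrow>\<^sub>E UNIV" "?g c = ?g d"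
    then have "(\<Sum>b\<in>B. (c b - d b) *s b) = 0"
      by (simp add: vec.scale_left_diff_distrib sum_subtractf)
    then have "c b - d b = 0" if "b \<in> B" for b
      using vec.independentD[OF B(2) fin subset_refl, of "\<lambda>b. c b - d b"] that by simp
    then show "c = d" using cd by (intro PiE_ext[OF cd(1,2)]) simp
  qed
  moreover have "?g ` (B \<rightarrow>\<^sub>E UNIV) = X"
  proof
    show "?g ` (B \<rightarrow>\<^sub>E UNIV) \<subseteq> X"
      using B(1) assms by (auto intro!: vec.subspace_sum vec.subspace_scale)
    show "X \<subseteq> ?g ` (B \<rightarrow>\<^sub>E UNIV)"
    proof
      fix x assume "x \<in> X"
      then obtain u where u: "x = (\<Sum>b\<in>B. u b *s b)"
        using B(3) unfolding vec.span_finite[OF fin] by auto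
      have "x = ?g (restrict u B)" unfolding u by (intro sum.cong) auto
      then show "x \<in> ?g ` (B \<rightarrow>\<^sub>E UNIV)" by (intro image_eqI[where x = "restrict u B"]) simp_all
    qed
  qed
  ultimately have "card X = card (B \<rightarrow>\<^sub>E (UNIV :: 'k set))" using card_image by blast
  then show ?thesis by (simp add: card_PiE fin B(4))
qed

text \<open>At this argument the power with exponent \<open>vec.dim X\<close> is the number of
  s-tuples in X. For each tuple y, \<open>cl y\<close> is the least member of the lattice containing
  it, and the Moebius sum over the members above \<open>cl y\<close> is 0 unless
  \<open>cl y = UNIV\<close>. Tuples stand in for points over the extension field of degree s, so
  that one field gives infinitely many values.\<close>

theorem poly_char_poly:
  fixes A :: "('k::{field, finite}, 'n::finite) arrangement"
  assumes A: "\<And>H. H \<in> A \<Longrightarrow> vec.subspace H \<and> H \<noteq> UNIV"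
  shows "poly (char_poly A) (int CARD('k) ^ s)
    = int (card {y \<in> {..<s} \<rightarrow>\<^sub>E UNIV. \<forall>H\<in>A. \<exists>j<s. y j \<notin> H})"
proof -
  let ?L = "intersection_lattice A" and ?T = "{..<s} \<rightarrow>\<^sub>E (UNIV :: ('k ^ 'n) set)"
  define cl where "cl y = \<Inter>{H \<in> A. \<forall>j<s. y j \<in> H}" for y :: "nat \<Rightarrow> 'k ^ 'n"
  have finT: "finite ?T" by (intro finite_PiE) auto
  have cl_L: "cl y \<in> ?L" for y unfolding cl_def intersection_lattice_def by blast
  have UL: "UNIV \<in> ?L" unfolding intersection_lattice_def by (intro CollectI exI[of _ "{}"]) simp
  have sub: "vec.subspace X" if "X \<in> ?L" for X
    using that A unfolding intersection_lattice_def by (auto intro!: vec.subspace_Inter)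
  have tuples: "{y \<in> ?T. cl y \<subseteq> X} = {..<s} \<rightarrow>\<^sub>E X" if X: "X \<in> ?L" for X
  proof -
    obtain B where B: "B \<subseteq> A" "X = \<Inter>B" using X by (auto simp: intersection_lattice_def)
    have "cl y \<subseteq> X \<longleftrightarrow> (\<forall>j<s. y j \<in> X)" for y
    proof
      assume "cl y \<subseteq> X"
      moreover have "y j \<in> cl y" if "j < s" for j using that by (auto simp: cl_def)
      ultimately show "\<forall>j<s. y j \<in> X" by blast
    next
      assume "\<forall>j<s. y j \<in> X"
      then have "B \<subseteq> {H \<in> A. \<forall>j<s. y j \<in> H}" using B by auto
      then show "cl y \<subseteq> X" unfolding cl_def B(2) by (rule Inter_anti_mono)
    qed
    then show ?thesis by (auto simp: PiE_def Pi_def)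
  qed
  have "poly (char_poly A) (int CARD('k) ^ s) = (\<Sum>X\<in>?L. moebius ?L UNIV X * int (card X ^ s))"
    unfolding char_poly_def poly_sum
  proof (intro sum.cong refl)
    fix X assume "X \<in> ?L"
    then have "card X = CARD('k) ^ vec.dim X" by (intro card_subspace sub)
    then show "poly (monom (moebius ?L UNIV X) (vec.dim X)) (int CARD('k) ^ s)
      = moebius ?L UNIV X * int (card X ^ s)"
      by (simp add: poly_monom mult.commute flip: power_mult)
  qed
  also have "\<dots> = (\<Sum>X\<in>?L. \<Sum>y\<in>?T. if cl y \<subseteq> X then moebius ?L UNIV X else 0)"
  proof (intro sum.cong refl)
    fix X assume X: "X \<in> ?L"
    have "(\<Sum>y\<in>?T. if cl y \<subseteq> X then moebius ?L UNIV X else 0) = (\<Sum>y\<in>{y \<in> ?T. cl y \<subseteq> X}. moebius ?L UNIV X)"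
      by (rule sum.inter_filter[OF finT, symmetric])
    also have "\<dots> = moebius ?L UNIV X * int (card X ^ s)"
      unfolding tuples[OF X] by (simp add: card_PiE)
    finally show "moebius ?L UNIV X * int (card X ^ s)
      = (\<Sum>y\<in>?T. if cl y \<subseteq> X then moebius ?L UNIV X else 0)" ..
  qed
  also have "\<dots> = (\<Sum>y\<in>?T. \<Sum>X\<in>{X \<in> ?L. cl y \<subseteq> X}. moebius ?L UNIV X)"
    by (subst sum.swap) (simp add: sum.inter_filter)
  also have "\<dots> = (\<Sum>y\<in>?T. if cl y = UNIV then 1 else 0)"
    by (intro sum.cong refl moebius_sum UL cl_L) simp
  also have "\<dots> = int (card {y \<in> ?T. cl y = UNIV})"
    using finT by (simp flip: sum.inter_filter)
  finally have "poly (char_poly A) (int CARD('k) ^ s) = int (card {y \<in> ?T. cl y = UNIV})" .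
  moreover have "cl y = UNIV \<longleftrightarrow> (\<forall>H\<in>A. \<exists>j<s. y j \<notin> H)" for y
    unfolding cl_def Inter_UNIV_conv using A by auto
  ultimately show ?thesis by simp
qed

lemma card_supported:
  fixes N :: "'n::finite set"
  shows "card {x :: 'k::{field, finite} ^ 'n. supp x \<subseteq> N} = CARD('k) ^ card N"
proof -
  have "bij_betw (\<lambda>x :: 'k ^ 'n. \<lambda>i\<in>N. x $ i) {x. supp x \<subseteq> N} (N \<rightarrow>\<^sub>E UNIV)"
  proof (rule bij_betwI[of _ _ _ "\<lambda>f. \<chi> i. if i \<in> N then f i else 0"])
    show "(\<lambda>f. \<chi> i. if i \<in> N then f i else 0) \<in> (N \<rightarrow>\<^sub>E UNIV) \<rightarrow> {x :: 'k ^ 'n. supp x \<subseteq> N}"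
      by (auto simp: supp_def split: if_splits)
    show "(\<chi> i. if i \<in> N then (\<lambda>i\<in>N. x $ i) i else 0) = x" if "x \<in> {x. supp x \<subseteq> N}" for x :: "'k ^ 'n"
      using that by (auto simp: vec_eq_iff supp_def)
    show "(\<lambda>i\<in>N. (\<chi> i. if i \<in> N then f i else 0) $ i) = f" if "f \<in> N \<rightarrow>\<^sub>E UNIV" for f :: "'n \<Rightarrow> 'k"
      using that by (auto simp: fun_eq_iff PiE_def extensional_def)
  qed auto
  then show ?thesis by (simp add: bij_betw_same_card card_PiE)
qed

definition tuples_off :: "('k::field ^ 'n::finite) set \<Rightarrow> 'n set \<Rightarrow> nat \<Rightarrow> (nat \<Rightarrow> 'k ^ 'n) set" where
  "tuples_off \<Phi> W s = {y \<in> {..<s} \<rightarrow>\<^sub>E {x. supp x \<subseteq> W}. \<forall>a\<in>forms_in \<Phi> W. \<exists>j<s. dot a (y j) \<noteq> 0}"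

text \<open>Adding a simplicial vertex \<open>v\<close> appends a row \<open>r\<close> to the matrix with columns \<open>y j\<close>, which has to
  avoid the span of the linearly independent rows belonging to the neighbours of \<open>v\<close>.\<close>

lemma card_tuples_off_insert:
  fixes E :: "'n::finite set set"
  defines "\<Phi> \<equiv> clique_forms E :: ('k::{field, finite} ^ 'n) set"
  assumes v: "v \<notin> W" and cl: "clique E (nbrs E v \<inter> W)" and E: "simple_graph E"
  shows "int (card (tuples_off \<Phi> (insert v W) s))
    = int (card (tuples_off \<Phi> W s)) * (int CARD('k) ^ s - int CARD('k) ^ card (nbrs E v \<inter> W))"
proof -
  let ?N = "nbrs E v \<inter> W" and ?R = "{..<s} \<rightarrow>\<^sub>E (UNIV :: 'k set)"
  define row where "row y b = (\<lambda>j\<in>{..<s}. dot b (y j))" for y :: "nat \<Rightarrow> 'k ^ 'n" and b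
  \<comment> \<open>The rows whose addition makes some form involving v vanish on all
    columns.\<close>
  define bad where "bad y = row y ` {b. supp b \<subseteq> ?N}" for y
  define app where "app p = (\<lambda>j\<in>{..<s}. fst p j + snd p j *s axis v 1)"
    for p :: "(nat \<Rightarrow> 'k ^ 'n) \<times> (nat \<Rightarrow> 'k)"
  let ?S = "SIGMA y:tuples_off \<Phi> W s. ?R - bad y"
  have yv: "y j $ v = 0" if "y \<in> tuples_off \<Phi> W s" "j < s" for y j
    using that v by (auto simp: tuples_off_def PiE_iff supp_def)
  have dot_app: "dot a (app (y, r) j) = dot a (y j) + a $ v * r j" if "j < s" for a y r j
    using that by (simp add: app_def dot_add_right dot_scale_right)
  have nbr_form: "b \<in> forms_in \<Phi> W" if "supp b \<subseteq> ?N" "b \<noteq> 0" for b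
    using that clique_subset[OF cl that(1)] by (auto simp: forms_in_def clique_forms_def \<Phi>_def)
  \<comment> \<open>If two vectors supported on the neighbours gave the same row, their difference
    would be a form on a clique in W that vanishes on all of y.\<close>
  have card_bad: "card (bad y) = CARD('k) ^ card ?N" if y: "y \<in> tuples_off \<Phi> W s" for y
  proof -
    have "inj_on (row y) {b. supp b \<subseteq> ?N}"
    proof (rule inj_onI)
      fix b b' assume b: "b \<in> {b. supp b \<subseteq> ?N}" "b' \<in> {b. supp b \<subseteq> ?N}" "row y b = row y b'"
      have "dot (b - b') (y j) = 0" if "j < s" for j
        using fun_cong[OF b(3), of j] that by (simp add: row_def dot_diff_left)
      moreover have "supp (b - b') \<subseteq> supp b \<union> supp b'" by (auto simp: supp_def)
      then have "supp (b - b') \<subseteq> ?N" using b(1,2) by auto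
      then have "b - b' \<noteq> 0 \<Longrightarrow> b - b' \<in> forms_in \<Phi> W" by (rule nbr_form)
      ultimately have "b - b' = 0" using y unfolding tuples_off_def by blast
      then show "b = b'" by simp
    qed
    then show ?thesis unfolding bad_def using card_image card_supported by metis
  qed
  have bad_R: "bad y \<subseteq> ?R" for y
    unfolding bad_def by (rule image_subsetI) (simp add: row_def)
  have fin: "finite (tuples_off \<Phi> W s)" "finite ?R"
  proof -
    show "finite ?R" by (intro finite_PiE) auto
    have "finite ({..<s} \<rightarrow>\<^sub>E {x :: 'k ^ 'n. supp x \<subseteq> W})" by (intro finite_PiE) auto
    then show "finite (tuples_off \<Phi> W s)" by (rule rev_finite_subset) (auto simp: tuples_off_def)
  qed
  have inj: "inj_on app ?S"
  proof (rule inj_onI)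
    fix p p' assume p: "p \<in> ?S" "p' \<in> ?S" "app p = app p'"
    obtain y r y' r' where yr: "p = (y, r)" "p' = (y', r')" by (cases p, cases p')
    have eq: "y j + r j *s axis v 1 = y' j + r' j *s axis v 1" if "j < s" for j
      using fun_cong[OF p(3), of j] that by (simp add: app_def yr)
    have rj: "r j = r' j" if "j < s" for j
      using arg_cong[OF eq[OF that], of "\<lambda>x. x $ v"] yv[of y j] yv[of y' j] p(1,2) that
        by (simp add: yr axis_def)
    have "y j = y' j" if "j < s" for j using eq[OF that] rj[OF that] by simp
    then have "y = y'" using p(1,2) by (intro PiE_ext[of y "{..<s}" _ y']) (auto simp: yr tuples_off_def)
    moreover have "r = r'" using p(1,2) rj by (intro PiE_ext[of r "{..<s}" _ r']) (auto simp: yr)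
    ultimately show "p = p'" by (simp add: yr)
  qed
  have img: "app ` ?S = tuples_off \<Phi> (insert v W) s"
  proof (intro equalityI subsetI)
    fix z assume "z \<in> app ` ?S"
    then obtain y r where yr: "z = app (y, r)" "y \<in> tuples_off \<Phi> W s" "r \<in> ?R" "r \<notin> bad y" by auto
    have "z \<in> {..<s} \<rightarrow>\<^sub>E {x. supp x \<subseteq> insert v W}"
      using yr(2) unfolding yr(1) by (auto simp: app_def tuples_off_def PiE_iff supp_def axis_def split: if_splits)
    moreover have "\<exists>j<s. dot a (z j) \<noteq> 0" if a: "a \<in> forms_in \<Phi> (insert v W)" for a
    proof (rule ccontr)
      assume "\<not> ?thesis"
      then have z: "dot a (y j) + a $ v * r j = 0" if "j < s" for j
        using that dot_app[OF that] by (auto simp: yr(1))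
      show False
      proof (cases "a $ v = 0")
        case True
        then have "a \<in> forms_in \<Phi> W" using a forms_in_insert[OF v] by blast
        then show False using z True yr(2) by (auto simp: tuples_off_def)
      next
        case False
        \<comment> \<open>The form a solved for the coordinate v: its vanishing on all columns says
          that r is the row of b.\<close>
        define b where "b = axis v 1 - (1 / a $ v) *s a"
        have sub: "supp a \<subseteq> insert v ?N"
          using a False by (intro clique_insertD) (auto simp: forms_in_def clique_forms_def supp_def \<Phi>_def)
        then have "supp b \<subseteq> ?N" using False by (auto simp: supp_def b_def axis_def split: if_splits)
        moreover have "r j = dot b (y j)" if "j < s" for j
        proof -
          have "a $ v * r j = - dot a (y j)" using z[OF that] by (simp add: eq_neg_iff_add_eq_0 add.commute)
          then have "r j = - dot a (y j) / a $ v" using False by (simp add: field_simps)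
          then show ?thesis using yv[OF yr(2) that] by (simp add: b_def dot_diff_left dot_scale_left)
        qed
        then have "r = row y b"
          using yr(3) by (intro PiE_ext[of r "{..<s}" "\<lambda>_. UNIV"]) (auto simp: row_def)
        ultimately show False using yr(4) by (auto simp: bad_def)
      qed
    qed
    ultimately show "z \<in> tuples_off \<Phi> (insert v W) s" by (simp add: tuples_off_def)
  next
    fix z assume z: "z \<in> tuples_off \<Phi> (insert v W) s"
    define r where "r = (\<lambda>j\<in>{..<s}. z j $ v)"
    define y where "y = (\<lambda>j\<in>{..<s}. z j - z j $ v *s axis v 1)"
    have zs: "z \<in> {..<s} \<rightarrow>\<^sub>E {x. supp x \<subseteq> insert v W}" using z by (simp add: tuples_off_def)
    have app: "z = app (y, r)"
      by (rule ext) (auto simp: app_def y_def r_def PiE_arb[OF zs])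
    have dz: "\<exists>j<s. dot a (y j) + a $ v * r j \<noteq> 0" if a: "a \<in> forms_in \<Phi> (insert v W)" for a
    proof -
      obtain j where "j < s" "dot a (z j) \<noteq> 0" using z a by (auto simp: tuples_off_def)
      then show ?thesis using dot_app[of j a y r] unfolding app by auto
    qed
    have "y \<in> {..<s} \<rightarrow>\<^sub>E {x. supp x \<subseteq> W}"
      using zs by (auto simp: y_def PiE_iff supp_def axis_def split: if_splits)
    moreover have "\<exists>j<s. dot a (y j) \<noteq> 0" if "a \<in> forms_in \<Phi> W" for a
      using dz[of a] that forms_in_insert[OF v, of a] by auto
    ultimately have y: "y \<in> tuples_off \<Phi> W s" by (simp add: tuples_off_def)
    have "r \<notin> bad y"
    proof
      assume "r \<in> bad y"
      then obtain b where b: "supp b \<subseteq> ?N" "r = row y b" by (auto simp: bad_def)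
      define a where "a = axis v 1 - b"
      have bv: "b $ v = 0" using b(1) v by (auto simp: supp_def)
      have "supp a \<subseteq> insert v ?N" using b(1) by (auto simp: a_def supp_def axis_def split: if_splits)
      moreover have "clique E (insert v ?N)"
      proof -
        have "{v, u} \<in> E" "{u, v} \<in> E" if "u \<in> ?N" for u
          using that by (auto simp: nbrs_def insert_commute)
        then show ?thesis using cl unfolding clique_def by auto
      qed
      moreover have "a $ v = 1" using bv by (simp add: a_def axis_def)
      ultimately have "a \<in> forms_in \<Phi> (insert v W)"
        using clique_subset by (auto simp: forms_in_def clique_forms_def \<Phi>_def)
      then obtain j where "j < s" "dot a (y j) + a $ v * r j \<noteq> 0" using dz by blast
      then show False using \<open>a $ v = 1\<close> yv[OF y] by (simp add: b(2) row_def a_def dot_diff_left)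
    qed
    moreover have "r \<in> ?R" by (simp add: r_def)
    ultimately show "z \<in> app ` ?S" using y by (intro image_eqI[where f = app, OF app]) simp
  qed
  have "card (tuples_off \<Phi> (insert v W) s) = card ?S" using card_image[OF inj] img by simp
  also have "\<dots> = (\<Sum>y\<in>tuples_off \<Phi> W s. card (?R - bad y))"
    using fin by (intro card_SigmaI) auto
  finally have "int (card (tuples_off \<Phi> (insert v W) s))
    = (\<Sum>y\<in>tuples_off \<Phi> W s. int (card (?R - bad y)))" by simp
  also have "\<dots> = (\<Sum>y\<in>tuples_off \<Phi> W s. int CARD('k) ^ s - int CARD('k) ^ card ?N)"
  proof (intro sum.cong refl)
    fix y assume y: "y \<in> tuples_off \<Phi> W s"
    have "card (bad y) \<le> card ?R" using bad_R fin by (intro card_mono)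
    then show "int (card (?R - bad y)) = int CARD('k) ^ s - int CARD('k) ^ card ?N"
      using card_Diff_subset[OF finite_subset[OF bad_R fin(2)] bad_R, of y] card_bad[OF y]
      by (simp add: card_PiE of_nat_diff)
  qed
  finally show ?thesis by simp
qed

theorem char_poly_clique_forms:
  fixes E :: "'n::finite set set"
  assumes E: "simple_graph E" and peo: "perfect_elimination_ordering E vs"
  shows "char_poly (hyperplane ` clique_forms E :: ('k::{field, finite}, 'n) arrangement)
    = (\<Prod>i<length vs. [:- (int CARD('k) ^ card (nbrs (initial_graph E vs i) (vs ! i))), 1:])"
    (is "char_poly ?A = ?P")
proof -
  let ?\<Phi> = "clique_forms E :: ('k ^ 'n) set" and ?q = "int CARD('k)"
  have count: "int (card (tuples_off ?\<Phi> (set (take i vs)) s))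
      = (\<Prod>l<i. ?q ^ s - ?q ^ card (nbrs (initial_graph E vs l) (vs ! l)))" if "i \<le> length vs" for i s
    using that
  proof (induct i)
    case 0
    have "tuples_off ?\<Phi> {} s = {..<s} \<rightarrow>\<^sub>E {0}"
      by (simp add: tuples_off_def forms_in_empty[OF clique_forms_nonzero])
    then show ?case by (simp add: card_PiE)
  next
    case (Suc i)
    then have i: "i < length vs" by simp
    show ?case
      using Suc card_tuples_off_insert[OF peo_step(1,2)[OF E peo i] E, where s = s and 'k = 'k]
      unfolding peo_step(3)[OF E peo i] nbrs_initial_graph[OF E i]
      by (simp add: nbrs_initial_graph[OF E i])
  qed
  have A: "vec.subspace H \<and> H \<noteq> UNIV" if "H \<in> ?A" for H
  proof -
    obtain a where "H = hyperplane a" "a \<in> ?\<Phi>" using \<open>H \<in> ?A\<close> by (rule imageE)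
    then have a: "H = hyperplane a" "a \<noteq> 0" using clique_forms_nonzero[of E] by auto
    obtain x where "dot a x \<noteq> 0" using exists_dot_nonzero[OF a(2)] by blast
    then have "x \<notin> H" by (simp add: a(1) hyperplane_dot)
    then show ?thesis using subspace_hyperplane[of a] a(1) by auto
  qed
  have eval: "poly (char_poly ?A) (?q ^ s) = poly ?P (?q ^ s)" for s
  proof -
    have "{y \<in> {..<s} \<rightarrow>\<^sub>E UNIV. \<forall>H\<in>?A. \<exists>j<s. y j \<notin> H} = tuples_off ?\<Phi> UNIV s"
      by (auto simp: tuples_off_def forms_in_UNIV hyperplane_dot)
    moreover have "set (take (length vs) vs) = UNIV" using peo
      by (simp add: perfect_elimination_ordering_def)
    ultimately show ?thesis
      using poly_char_poly[of ?A s, OF A] count[of "length vs" s] by (simp add: poly_prod)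
  qed
  \<comment> \<open>The two polynomials agree at the powers of q, and these are infinitely
    many.\<close>
  have "inj (\<lambda>s. ?q ^ s)"
    using card_field_ge_2[where 'k = 'k] by (intro injI) (simp add: power_inject_exp)
  then have "infinite (range (\<lambda>s. ?q ^ s))" by (rule range_inj_infinite)
  moreover have "range (\<lambda>s. ?q ^ s) \<subseteq> {x. poly (char_poly ?A - ?P) x = 0}" using eval by auto
  ultimately have "infinite {x. poly (char_poly ?A - ?P) x = 0}" using finite_subset by blast
  then have "char_poly ?A - ?P = 0" using poly_roots_finite by blast
  then show ?thesis by simp
qed

theorem theorem3p2:
  fixes E :: "'n::finite set set"
    and Aq :: "('k::{field, finite}, 'n) arrangement"
    and q :: nat
  assumes "simple_graph E"
    and "primepow q"
    and "CARD('k) = q"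
    and "Aq = q_graphical_arrangement E"
  shows "((\<exists>vs. perfect_elimination_ordering E vs) \<longleftrightarrow> supersolvable (graphical_arrangement E))
    \<and> ((\<exists>vs. perfect_elimination_ordering E vs) \<longleftrightarrow> free_arrangement (graphical_arrangement E))
    \<and> ((\<exists>vs. perfect_elimination_ordering E vs) \<longleftrightarrow> chordal E)
    \<and> ((\<exists>vs. perfect_elimination_ordering E vs) \<longleftrightarrow> supersolvable Aq)
    \<and> ((\<exists>vs. perfect_elimination_ordering E vs) \<longleftrightarrow> free_arrangement Aq)
    \<and> (\<forall>vs. perfect_elimination_ordering E vs \<longrightarrow>
         char_poly Aq =
           (\<Prod>i<length vs. [:- (int q ^ card (nbrs (initial_graph E vs i) (vs ! i))), 1:]))"
proof -
  let ?P = "\<exists>vs. perfect_elimination_ordering E vs"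
  have E: "simple_graph E" and q: "primepow (CARD('k))" and Aq: "Aq = hyperplane ` clique_forms E"
    using assms by (simp_all add: q_graphical_arrangement_eq)
  have peo: "chordal E \<Longrightarrow> ?P" by (rule chordal_peo[OF E])
  have free_g: "free_arrangement (graphical_arrangement E) \<longleftrightarrow> free_submodule (der (graph_forms E :: (real ^ 'n) set))"
    unfolding free_arrangement_def graphical_arrangement_eq
      derivation_module_hyperplanes[OF graph_forms_nonzero[OF E]] ..
  have free_q: "free_arrangement Aq \<longleftrightarrow> free_submodule (der (clique_forms E :: ('k ^ 'n) set))"
    unfolding free_arrangement_def Aq derivation_module_hyperplanes[OF clique_forms_nonzero] ..
  have "?P \<longleftrightarrow> supersolvable (graphical_arrangement E)"
    unfolding graphical_arrangement_eq
    using peo supersolvable_graph_forms_chordal[OF E] peo_supersolvable_graph_forms[OF E] by blast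
  moreover have "?P \<longleftrightarrow> free_arrangement (graphical_arrangement E)"
    unfolding free_g using peo free_graph_forms_chordal[OF E] peo_free_graph_forms[OF E] by blast
  \<comment> \<open>That an ordering forces chordality is read off the real graphical arrangement,
    which becomes supersolvable and thereby excludes holes.\<close>
  moreover have "?P \<longleftrightarrow> chordal E"
    using peo supersolvable_graph_forms_chordal[OF E, where 'k = real]
      peo_supersolvable_graph_forms[OF E, where 'k = real] by blast
  moreover have "?P \<longleftrightarrow> supersolvable Aq"
    unfolding Aq using peo supersolvable_clique_forms_chordal[OF E] peo_supersolvable_clique_forms[OF E] by blast
  moreover have "?P \<longleftrightarrow> free_arrangement Aq"
    unfolding free_q using peo free_clique_forms_chordal[OF E] peo_free_clique_forms[OF E _ q] by blast
  moreover have "\<forall>vs. perfect_elimination_ordering E vs \<longrightarrow> char_poly Aq =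
      (\<Prod>i<length vs. [:- (int q ^ card (nbrs (initial_graph E vs i) (vs ! i))), 1:])"
    unfolding Aq assms(3)[symmetric] using char_poly_clique_forms[OF E] by blast
  ultimately show ?thesis by (intro conjI)
qed

end
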